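(* Consider the term calculus $\mathbf{ILL}_p^{\lozenge}$, the non-associative category $\mathscr D$ of its terms, the category $\mathscr P_t$ of positive types and thunkable morphisms of $\mathscr D$, the category $\mathscr N_l$ of negative types and linear morphisms of $\mathscr D$, and the adjoint functors $\Uparrow=\mathbf 1\multimap-:\mathscr P_t\to\mathscr N_l$ and $\Downarrow=\mathbf 1\otimes-:\mathscr N_l\to\mathscr P_t$ (with $\Uparrow\dashv\Downarrow$), all recalled in the context. Then: (1) the assignment $N\mapsto\,!N$ ($N$ a negative type) underlies a relative comonad $!:\mathscr N_l\to\mathscr P_t$ on $\Downarrow:\mathscr N_l\to\mathscr P_t$, given by the rules of $!$: under the bijection $\mathscr P_t(P,\Downarrow M)\cong\mathscr D(P,M)$, the counit $\varepsilon_N\in\mathscr P_t(!N,\Downarrow N)$ corresponds to the command $\langle x\,\|\,!\alpha\rangle^+:(x:{!N}\vdash\alpha:N)$, and the coextension of the morphism corresponding to $c:(x:{!N}\vdash\alpha:M)$ is given by the value $x:{!N}\vdash\mu{!\alpha}.c:{!M}\mid$, that is, by the command $\langle\mu{!\alpha}.c\,\|\,\gamma\rangle^+:(x:{!N}\vdash\gamma:{!M})$; (2) the assignment $P\mapsto\lozenge P$ ($P$ a positive type) underlies a relative monad $\lozenge:\mathscr P_t\to\mathscr N_l$ on $\Uparrow:\mathscr P_t\to\mathscr N_l$, given dually by the rules of $\lozenge$: under the bijection $\mathscr N_l(\Uparrow P,N)\cong\mathscr D(P,N)$, the unit $\eta_P\in\mathscr N_l(\Uparrow P,\lozenge P)$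 corresponds to $\langle\diamond x\,\|\,\alpha\rangle^-:(x:P\vdash\alpha:\lozenge P)$, and the extension of the morphism corresponding to $c:(x:P\vdash\alpha:\lozenge Q)$ is given by the stack $\mid\bar\mu{\diamond x}.c:\lozenge P\vdash\alpha:\lozenge Q$, that is, by the command $\langle z\,\|\,\bar\mu{\diamond x}.c\rangle^-:(z:\lozenge P\vdash\alpha:\lozenge Q)$.
   Context: **Types.** Polarities $\varepsilon\in\{+,-\}$. Positive types $P,Q::=X^+\mid\mathbf 1\mid A\otimes B\mid A\oplus B\mid\mathbf 0\mid{!A}$; negative types $N,M::=X^-\mid A\multimap B\mid A\,\&\,B\mid\top\mid\lozenge A$; types $A,B::=P\mid N$. $A_\varepsilon$ denotes a type of polarity $\varepsilon$. **Pseudo-terms** (variables $x,y$; co-variables $\alpha,\beta$; up to $\alpha$-conversion; $i\in\{1,2\}$). Values: $V,W::=x\mid\mu\alpha^-.c\mid()\mid V\otimes W\mid\iota_i(V)\mid\mu(x\cdot\alpha).c\mid\mu\langle\alpha.c;\beta.c'\rangle\mid\mu\langle V\rangle\mid\mu{!\alpha}.c\mid\diamond V$. Stacks: $S::=\alpha\mid\bar\mu x^+.c\mid\bar\mu().c\mid\bar\mu(x\otimes y).c\mid\bar\mu[x.c\,|\,y.c']\mid V\cdot S\mid\pi_i\cdot S\mid\bar\mu[S]\mid{!S}\mid\bar\mu{\diamond x}.c$. Expressions: $t,u::=V\mid\mu\alpha^+.c$. Contexts: $e::=S\mid\bar\mu x^-.c$. Commands: $c::=\langle V\|e\rangle^-\mid\langle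 t\|S\rangle^+$. **Reductions** $\triangleright_R$: $\langle V\|\bar\mu x^\varepsilon.c\rangle^\varepsilon\triangleright c[V/x]$; $\langle\mu\alpha^\varepsilon.c\|S\rangle^\varepsilon\triangleright c[S/\alpha]$; $\langle()\|\bar\mu().c\rangle^+\triangleright c$; $\langle V\otimes W\|\bar\mu(x\otimes y).c\rangle^+\triangleright c[V/x,W/y]$; $\langle\iota_i(V)\|\bar\mu[x_1.c_1|x_2.c_2]\rangle^+\triangleright c_i[V/x_i]$; $\langle\mu(x\cdot\alpha).c\|V\cdot S\rangle^-\triangleright c[V/x,S/\alpha]$; $\langle\mu\langle\alpha_1.c_1;\alpha_2.c_2\rangle\|\pi_i\cdot S\rangle^-\triangleright c_i[S/\alpha_i]$; $\langle\mu{!\alpha}.c\|{!S}\rangle^+\triangleright c[S/\alpha]$; $\langle\diamond V\|\bar\mu{\diamond x}.c\rangle^-\triangleright c[V/x]$. **Expansions** $\triangleright_E$ (bound variables fresh): $e\triangleright\bar\mu x^\varepsilon.\langle x\|e\rangle^\varepsilon$; $t\triangleright\mu\alpha^\varepsilon.\langle t\|\alpha\rangle^\varepsilon$; $S\triangleright\bar\mu().\langle()\|S\rangle^+$; $S\triangleright\bar\mu(x\otimes y).\langle x\otimes y\|S\rangle^+$; $S\triangleright\bar\mu[x.\langle\iota_1(x)\|S\rangle^+|y.\langle\iota_2(y)\|S\rangle^+]$; $V\triangleright\mu(x\cdot\alpha).\langle V\|x\cdot\alpha\rangle^-$; $V\triangleright\mu\langle\alpha.\langle V\|\pi_1\cdot\alpha\rangle^-;\beta.\langle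 V\|\pi_2\cdot\beta\rangle^-\rangle$; $V\triangleright\mu\langle x_1\otimes\cdots\otimes x_n\rangle$ (type $\top$); $S\triangleright\bar\mu[x_1\cdots x_n\cdot\alpha]$ (type $\mathbf 0$); $V\triangleright\mu{!\alpha}.\langle V\|{!\alpha}\rangle^+$; $S\triangleright\bar\mu{\diamond x}.\langle\diamond x\|S\rangle^-$. $\simeq_{RE}$ is the well-typed restriction of the compatible equivalence closure of $\triangleright_R\cup\triangleright_E$ (steps relate terms with the same typing judgement, with expansions applied at the type whose connective they mention). **Typing.** Judgements $\Gamma\vdash t:A\mid$, $\ \Gamma\mid e:A\vdash\Delta$, $\ c:(\Gamma\vdash\Delta)$; $\Gamma$ is an ordered list of distinct typed variables, $\Delta$ is a single $\alpha:A$; $!\Gamma$ means all types are of the form $!A_i$; $\lozenge\Delta$ means $\alpha:\lozenge A$. Rules (premises $\Rightarrow$ conclusion): $x:A\vdash x:A\mid$; $\ \mid\alpha:A\vdash\alpha:A$; $c:(\Gamma,x:A_\varepsilon\vdash\Delta)\Rightarrow\Gamma\mid\bar\mu x^\varepsilon.c:A_\varepsilon\vdash\Delta$; $c:(\Gamma\vdash\alpha:A_\varepsilon)\Rightarrow\Gamma\vdash\mu\alpha^\varepsilon.c:A_\varepsilon\mid$; $\Gamma\vdash t:A_\varepsilon\mid$ and $\Gamma'\mid e:A_\varepsilon\vdash\Delta\Rightarrow\langle t\|e\rangle^\varepsilon:(\Gamma,\Gamma'\vdash\Delta)$; structural: any judgement with context $\Gamma$ may be renamed along $\sigma$ to context $\Gamma'$,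 where $\sigma:\mathrm{dom}\,\Gamma\to\mathrm{dom}\,\Gamma'$ is type-preserving and is bijective on variables whose type is not of the form $!A$ (so exchange always, weakening and contraction only on $!A$); $\Gamma\vdash V:A\mid$, $\Gamma'\mid S:B\vdash\Delta\Rightarrow\Gamma,\Gamma'\mid V\cdot S:A\multimap B\vdash\Delta$; $c:(\Gamma,x:A\vdash\alpha:B)\Rightarrow\Gamma\vdash\mu(x\cdot\alpha).c:A\multimap B\mid$; $\Gamma\vdash V:A\mid$, $\Gamma'\vdash W:B\mid\Rightarrow\Gamma,\Gamma'\vdash V\otimes W:A\otimes B\mid$; $c:(\Gamma,x:A,y:B\vdash\Delta)\Rightarrow\Gamma\mid\bar\mu(x\otimes y).c:A\otimes B\vdash\Delta$; $c:(\Gamma\vdash\alpha:A)$, $c':(\Gamma\vdash\beta:B)\Rightarrow\Gamma\vdash\mu\langle\alpha.c;\beta.c'\rangle:A\&B\mid$; $\Gamma\mid S:A_i\vdash\Delta\Rightarrow\Gamma\mid\pi_i\cdot S:A_1\&A_2\vdash\Delta$; $c:(\Gamma,x:A\vdash\Delta)$, $c':(\Gamma,y:B\vdash\Delta)\Rightarrow\Gamma\mid\bar\mu[x.c|y.c']:A\oplus B\vdash\Delta$; $\Gamma\vdash V:A_i\mid\Rightarrow\Gamma\vdash\iota_i(V):A_1\oplus A_2\mid$; $\vdash():\mathbf 1\mid$; $c:(\Gamma\vdash\Delta)\Rightarrow\Gamma\mid\bar\mu().c:\mathbf 1\vdash\Delta$; $\Gamma\vdash V:A\mid\Rightarrow\Gamma\vdash\mu\langle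 V\rangle:\top\mid$; $\Gamma\mid S:A\vdash\Delta\Rightarrow\Gamma\mid\bar\mu[S]:\mathbf 0\vdash\Delta$; $c:(!\Gamma\vdash\alpha:A)\Rightarrow{!\Gamma}\vdash\mu{!\alpha}.c:{!A}\mid$; $\Gamma\mid S:A\vdash\Delta\Rightarrow\Gamma\mid{!S}:{!A}\vdash\Delta$; $\Gamma\vdash V:A\mid\Rightarrow\Gamma\vdash\diamond V:\lozenge A\mid$; $c:(!\Gamma,x:A\vdash\lozenge\Delta)\Rightarrow{!\Gamma}\mid\bar\mu{\diamond x}.c:\lozenge A\vdash\lozenge\Delta$. **Non-associative category $\mathscr D$** (a category without the associativity axiom): objects are types; $\mathscr D(A,B)$ is the set of $\simeq_{RE}$-classes of commands $c:(x:A\vdash\alpha:B)$ (up to renaming $x,\alpha$); the identity is $\langle x\|\alpha\rangle$; the composite of $c:(x:A\vdash\alpha:B_\varepsilon)$ followed by $c':(y:B_\varepsilon\vdash\beta:C)$ is $\langle\mu\alpha^\varepsilon.c\|\bar\mu y^\varepsilon.c'\rangle^\varepsilon$. A morphism $f$ is thunkable if $(h\circ g)\circ f=h\circ(g\circ f)$ for all composable $g,h$; a morphism $h$ is linear if $(h\circ g)\circ f=h\circ(g\circ f)$ for all composable $f,g$. $\mathscr P_t$ (positive types, thunkable maps) and $\mathscr N_l$ (negative types, linear maps) are ordinary categories. **Shifts.** $\Downarrow N=\mathbf 1\otimes N$, sending $c:(x:N\vdash\alpha:M)$ to $\langle z\|\bar\mu(u\otimes x).\langle u\otimes\mu\alpha^-.c\|\gamma\rangle^+\rangle^+$;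 $\Uparrow P=\mathbf 1\multimap P$, sending $c:(x:P\vdash\alpha:Q)$ to $\langle\mu(u\cdot\alpha).\langle z\|u\cdot\bar\mu x^+.c\rangle^-\|\gamma\rangle^-$. The bijection $\mathscr D(P,M)\cong\mathscr P_t(P,\Downarrow M)$ sends $c:(x:P\vdash\alpha:M)$ to $\langle()\otimes\mu\alpha^-.c\|\gamma\rangle^+$; the bijection $\mathscr D(P,N)\cong\mathscr N_l(\Uparrow P,N)$ sends $c:(x:P\vdash\alpha:N)$ to $\langle z\|()\cdot\bar\mu x^+.c\rangle^-$. **Relative (co)monads.** A relative monad on a functor $L:\mathscr A\to\mathscr B$: an object map $T:|\mathscr A|\to|\mathscr B|$, maps $\eta_A\in\mathscr B(LA,TA)$, and for each $f\in\mathscr B(LA,TB)$ a map $f^*\in\mathscr B(TA,TB)$ with $f=f^*\circ\eta_A$, $\eta_A^*=\mathrm{id}$, $(f^*\circ g)^*=f^*\circ g^*$. A relative comonad on $R:\mathscr B\to\mathscr A$: an object map $S:|\mathscr B|\to|\mathscr A|$, maps $\varepsilon_B\in\mathscr A(SB,RB)$, and for each $f\in\mathscr A(SA,RB)$ a map ${}^*f\in\mathscr A(SA,SB)$ with $f=\varepsilon_B\circ{}^*f$, ${}^*\varepsilon_B=\mathrm{id}$, ${}^*(f\circ{}^*g)={}^*f\circ{}^*g$. *)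

theory Defs
  imports Main
begin

datatype polarity = Pos | Neg

datatype ty =
    PAtom nat | TOne | TTensor ty ty | TPlus ty ty | TZero | TBang ty
  | NAtom nat | TLolli ty ty | TWith ty ty | TTop | TDia ty

fun pol :: "ty \<Rightarrow> polarity" where
  "pol (PAtom X) = Pos"
| "pol TOne = Pos"
| "pol (TTensor A B) = Pos"
| "pol (TPlus A B) = Pos"
| "pol TZero = Pos"
| "pol (TBang A) = Pos"
| "pol (NAtom X) = Neg"
| "pol (TLolli A B) = Neg"
| "pol (TWith A B) = Neg"
| "pol TTop = Neg"
| "pol (TDia A) = Neg"

definition is_bang :: "ty \<Rightarrow> bool" where
  "is_bang A \<longleftrightarrow> (\<exists>B. A = TBang B)"

definition is_dia :: "ty \<Rightarrow> bool" where
  "is_dia A \<longleftrightarrow> (\<exists>B. A = TDia B)"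

text \<open>
  De Bruijn representation with two independent index spaces, one for variables and one for
  co-variables. Each constructor is annotated with the notation it stands for. A binder of two
  variables, such as \<open>\<mu>\<^sup>~(x \<otimes> y).c\<close> (where \<open>\<mu>\<^sup>~\<close> is the binder of stacks and contexts), gives
  index 1 to \<open>x\<close> and index 0 to \<open>y\<close>.
\<close>

datatype val =
    Var nat
  | MuN cmd            \<comment> \<open>\<open>\<mu>\<alpha>\<^sup>-.c\<close>\<close>
  | VUnit              \<comment> \<open>\<open>()\<close>\<close>
  | VTensor val val    \<comment> \<open>\<open>V \<otimes> W\<close>\<close>
  | In1 val
  | In2 val
  | MuFun cmd          \<comment> \<open>\<open>\<mu>(x \<cdot> \<alpha>).c\<close>\<close>
  | MuWith cmd cmd     \<comment> \<open>\<open>\<mu>\<langle>\<alpha>.c; \<beta>.c'\<rangle>\<close>\<close>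
  | MuTop val          \<comment> \<open>\<open>\<mu>\<langle>V\<rangle>\<close>\<close>
  | MuBang cmd         \<comment> \<open>\<open>\<mu>!\<alpha>.c\<close>\<close>
  | VDia val           \<comment> \<open>\<open>\<diamond>V\<close>\<close>
and stk =
    Covar nat
  | MtP cmd            \<comment> \<open>\<open>\<mu>\<^sup>~x\<^sup>+.c\<close>\<close>
  | MtUnit cmd         \<comment> \<open>\<open>\<mu>\<^sup>~().c\<close>\<close>
  | MtTensor cmd       \<comment> \<open>\<open>\<mu>\<^sup>~(x \<otimes> y).c\<close>\<close>
  | MtPlus cmd cmd     \<comment> \<open>\<open>\<mu>\<^sup>~[x.c | y.c']\<close>\<close>
  | Push val stk       \<comment> \<open>\<open>V \<cdot> S\<close>\<close>
  | Pi1 stk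
  | Pi2 stk
  | MtZero stk         \<comment> \<open>\<open>\<mu>\<^sup>~[S]\<close>\<close>
  | SBang stk          \<comment> \<open>\<open>!S\<close>\<close>
  | MtDia cmd          \<comment> \<open>\<open>\<mu>\<^sup>~\<diamond>x.c\<close>\<close>
and expr =
    Val val
  | MuP cmd            \<comment> \<open>\<open>\<mu>\<alpha>\<^sup>+.c\<close>\<close>
and ctxt =
    Stk stk
  | MtN cmd            \<comment> \<open>\<open>\<mu>\<^sup>~x\<^sup>-.c\<close>\<close>
and cmd =
    CutN val ctxt      \<comment> \<open>\<open>\<langle>V \<parallel> e\<rangle>\<^sup>-\<close>\<close>
  | CutP expr stk      \<comment> \<open>\<open>\<langle>t \<parallel> S\<rangle>\<^sup>+\<close>\<close>

text \<open>Renaming of variables (first argument) and co-variables (second argument).\<close>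

definition up :: "(nat \<Rightarrow> nat) \<Rightarrow> nat \<Rightarrow> nat" where
  "up r = case_nat 0 (\<lambda>n. Suc (r n))"

primrec
      ren_val :: "(nat \<Rightarrow> nat) \<Rightarrow> (nat \<Rightarrow> nat) \<Rightarrow> val \<Rightarrow> val"
  and ren_stk :: "(nat \<Rightarrow> nat) \<Rightarrow> (nat \<Rightarrow> nat) \<Rightarrow> stk \<Rightarrow> stk"
  and ren_expr :: "(nat \<Rightarrow> nat) \<Rightarrow> (nat \<Rightarrow> nat) \<Rightarrow> expr \<Rightarrow> expr"
  and ren_ctxt :: "(nat \<Rightarrow> nat) \<Rightarrow> (nat \<Rightarrow> nat) \<Rightarrow> ctxt \<Rightarrow> ctxt"
  and ren_cmd :: "(nat \<Rightarrow> nat) \<Rightarrow> (nat \<Rightarrow> nat) \<Rightarrow> cmd \<Rightarrow> cmd"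
where
  "ren_val r k (Var n) = Var (r n)"
| "ren_val r k (MuN c) = MuN (ren_cmd r (up k) c)"
| "ren_val r k VUnit = VUnit"
| "ren_val r k (VTensor V W) = VTensor (ren_val r k V) (ren_val r k W)"
| "ren_val r k (In1 V) = In1 (ren_val r k V)"
| "ren_val r k (In2 V) = In2 (ren_val r k V)"
| "ren_val r k (MuFun c) = MuFun (ren_cmd (up r) (up k) c)"
| "ren_val r k (MuWith c d) = MuWith (ren_cmd r (up k) c) (ren_cmd r (up k) d)"
| "ren_val r k (MuTop V) = MuTop (ren_val r k V)"
| "ren_val r k (MuBang c) = MuBang (ren_cmd r (up k) c)"
| "ren_val r k (VDia V) = VDia (ren_val r k V)"
| "ren_stk r k (Covar n) = Covar (k n)"
| "ren_stk r k (MtP c) = MtP (ren_cmd (up r) k c)"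
| "ren_stk r k (MtUnit c) = MtUnit (ren_cmd r k c)"
| "ren_stk r k (MtTensor c) = MtTensor (ren_cmd (up (up r)) k c)"
| "ren_stk r k (MtPlus c d) = MtPlus (ren_cmd (up r) k c) (ren_cmd (up r) k d)"
| "ren_stk r k (Push V S) = Push (ren_val r k V) (ren_stk r k S)"
| "ren_stk r k (Pi1 S) = Pi1 (ren_stk r k S)"
| "ren_stk r k (Pi2 S) = Pi2 (ren_stk r k S)"
| "ren_stk r k (MtZero S) = MtZero (ren_stk r k S)"
| "ren_stk r k (SBang S) = SBang (ren_stk r k S)"
| "ren_stk r k (MtDia c) = MtDia (ren_cmd (up r) k c)"
| "ren_expr r k (Val V) = Val (ren_val r k V)"
| "ren_expr r k (MuP c) = MuP (ren_cmd r (up k) c)"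
| "ren_ctxt r k (Stk S) = Stk (ren_stk r k S)"
| "ren_ctxt r k (MtN c) = MtN (ren_cmd (up r) k c)"
| "ren_cmd r k (CutN V e) = CutN (ren_val r k V) (ren_ctxt r k e)"
| "ren_cmd r k (CutP t S) = CutP (ren_expr r k t) (ren_stk r k S)"

text \<open>
  Simultaneous capture-avoiding substitution of values for variables and of stacks for
  co-variables. The suffixes \<open>v\<close> and \<open>k\<close> of the lifting operations refer to going under a binder of
  a variable and of a co-variable, respectively.
\<close>

definition liftv_val :: "(nat \<Rightarrow> val) \<Rightarrow> nat \<Rightarrow> val" where
  "liftv_val s = case_nat (Var 0) (\<lambda>n. ren_val Suc id (s n))"

definition liftv_stk :: "(nat \<Rightarrow> stk) \<Rightarrow> nat \<Rightarrow> stk" where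
  "liftv_stk k = (\<lambda>n. ren_stk Suc id (k n))"

definition liftk_val :: "(nat \<Rightarrow> val) \<Rightarrow> nat \<Rightarrow> val" where
  "liftk_val s = (\<lambda>n. ren_val id Suc (s n))"

definition liftk_stk :: "(nat \<Rightarrow> stk) \<Rightarrow> nat \<Rightarrow> stk" where
  "liftk_stk k = case_nat (Covar 0) (\<lambda>n. ren_stk id Suc (k n))"

primrec
      sub_val :: "(nat \<Rightarrow> val) \<Rightarrow> (nat \<Rightarrow> stk) \<Rightarrow> val \<Rightarrow> val"
  and sub_stk :: "(nat \<Rightarrow> val) \<Rightarrow> (nat \<Rightarrow> stk) \<Rightarrow> stk \<Rightarrow> stk"
  and sub_expr :: "(nat \<Rightarrow> val) \<Rightarrow> (nat \<Rightarrow> stk) \<Rightarrow> expr \<Rightarrow> expr"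
  and sub_ctxt :: "(nat \<Rightarrow> val) \<Rightarrow> (nat \<Rightarrow> stk) \<Rightarrow> ctxt \<Rightarrow> ctxt"
  and sub_cmd :: "(nat \<Rightarrow> val) \<Rightarrow> (nat \<Rightarrow> stk) \<Rightarrow> cmd \<Rightarrow> cmd"
where
  "sub_val s k (Var n) = s n"
| "sub_val s k (MuN c) = MuN (sub_cmd (liftk_val s) (liftk_stk k) c)"
| "sub_val s k VUnit = VUnit"
| "sub_val s k (VTensor V W) = VTensor (sub_val s k V) (sub_val s k W)"
| "sub_val s k (In1 V) = In1 (sub_val s k V)"
| "sub_val s k (In2 V) = In2 (sub_val s k V)"
| "sub_val s k (MuFun c) =
     MuFun (sub_cmd (liftk_val (liftv_val s)) (liftk_stk (liftv_stk k)) c)"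
| "sub_val s k (MuWith c d) =
     MuWith (sub_cmd (liftk_val s) (liftk_stk k) c) (sub_cmd (liftk_val s) (liftk_stk k) d)"
| "sub_val s k (MuTop V) = MuTop (sub_val s k V)"
| "sub_val s k (MuBang c) = MuBang (sub_cmd (liftk_val s) (liftk_stk k) c)"
| "sub_val s k (VDia V) = VDia (sub_val s k V)"
| "sub_stk s k (Covar n) = k n"
| "sub_stk s k (MtP c) = MtP (sub_cmd (liftv_val s) (liftv_stk k) c)"
| "sub_stk s k (MtUnit c) = MtUnit (sub_cmd s k c)"
| "sub_stk s k (MtTensor c) =
     MtTensor (sub_cmd (liftv_val (liftv_val s)) (liftv_stk (liftv_stk k)) c)"
| "sub_stk s k (MtPlus c d) =
     MtPlus (sub_cmd (liftv_val s) (liftv_stk k) c) (sub_cmd (liftv_val s) (liftv_stk k) d)"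
| "sub_stk s k (Push V S) = Push (sub_val s k V) (sub_stk s k S)"
| "sub_stk s k (Pi1 S) = Pi1 (sub_stk s k S)"
| "sub_stk s k (Pi2 S) = Pi2 (sub_stk s k S)"
| "sub_stk s k (MtZero S) = MtZero (sub_stk s k S)"
| "sub_stk s k (SBang S) = SBang (sub_stk s k S)"
| "sub_stk s k (MtDia c) = MtDia (sub_cmd (liftv_val s) (liftv_stk k) c)"
| "sub_expr s k (Val V) = Val (sub_val s k V)"
| "sub_expr s k (MuP c) = MuP (sub_cmd (liftk_val s) (liftk_stk k) c)"
| "sub_ctxt s k (Stk S) = Stk (sub_stk s k S)"
| "sub_ctxt s k (MtN c) = MtN (sub_cmd (liftv_val s) (liftv_stk k) c)"
| "sub_cmd s k (CutN V e) = CutN (sub_val s k V) (sub_ctxt s k e)"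
| "sub_cmd s k (CutP t S) = CutP (sub_expr s k t) (sub_stk s k S)"

text \<open>\<open>c[V/x]\<close>, \<open>c[S/\<alpha>]\<close>, \<open>c[V/x, W/y]\<close> and \<open>c[V/x, S/\<alpha>]\<close>.\<close>

definition inst_v :: "cmd \<Rightarrow> val \<Rightarrow> cmd" where
  "inst_v c V = sub_cmd (case_nat V Var) Covar c"

definition inst_k :: "cmd \<Rightarrow> stk \<Rightarrow> cmd" where
  "inst_k c S = sub_cmd Var (case_nat S Covar) c"

definition inst_vv :: "cmd \<Rightarrow> val \<Rightarrow> val \<Rightarrow> cmd" where
  "inst_vv c V W = sub_cmd (case_nat W (case_nat V Var)) Covar c"

definition inst_vk :: "cmd \<Rightarrow> val \<Rightarrow> stk \<Rightarrow> cmd" where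
  "inst_vk c V S = sub_cmd (case_nat V Var) (case_nat S Covar) c"

inductive red :: "cmd \<Rightarrow> cmd \<Rightarrow> bool" where
  "red (CutP (Val V) (MtP c)) (inst_v c V)"
| "red (CutN V (MtN c)) (inst_v c V)"
| "red (CutP (MuP c) S) (inst_k c S)"
| "red (CutN (MuN c) (Stk S)) (inst_k c S)"
| "red (CutP (Val VUnit) (MtUnit c)) c"
| "red (CutP (Val (VTensor V W)) (MtTensor c)) (inst_vv c V W)"
| "red (CutP (Val (In1 V)) (MtPlus c d)) (inst_v c V)"
| "red (CutP (Val (In2 V)) (MtPlus c d)) (inst_v d V)"
| "red (CutN (MuFun c) (Stk (Push V S))) (inst_vk c V S)"
| "red (CutN (MuWith c d) (Stk (Pi1 S))) (inst_k c S)"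
| "red (CutN (MuWith c d) (Stk (Pi2 S))) (inst_k d S)"
| "red (CutP (Val (MuBang c)) (SBang S)) (inst_k c S)"
| "red (CutN (VDia V) (Stk (MtDia c))) (inst_v c V)"

text \<open>
  The value \<open>x\<^sub>1 \<otimes> (x\<^sub>2 \<otimes> \<dots> \<otimes> x\<^sub>n)\<close>, which is \<open>()\<close> for \<open>n = 0\<close>, and the stack
  \<open>x\<^sub>1 \<cdot> (x\<^sub>2 \<cdot> \<dots> (x\<^sub>n \<cdot> \<alpha>))\<close>, where \<open>x\<^sub>1, \<dots>, x\<^sub>n\<close> are all the variables of a context of length \<open>n\<close>. The
  rightmost variable of a context has index 0.
\<close>

fun tensor_vals :: "val list \<Rightarrow> val" where
  "tensor_vals [] = VUnit"
| "tensor_vals [V] = V"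
| "tensor_vals (V # W # Vs) = VTensor V (tensor_vals (W # Vs))"

definition tensor_ctx :: "nat \<Rightarrow> val" where
  "tensor_ctx n = tensor_vals (map Var (rev [0..<n]))"

definition push_ctx :: "nat \<Rightarrow> stk" where
  "push_ctx n = foldr Push (map Var (rev [0..<n])) (Covar 0)"

text \<open>
  Expansion at a given type, for terms in a context of length \<open>n\<close> (which matters only for \<open>\<top>\<close>
  and \<open>0\<close>).
\<close>

inductive expand_val :: "nat \<Rightarrow> ty \<Rightarrow> val \<Rightarrow> val \<Rightarrow> bool" where
  "pol A = Neg \<Longrightarrow> expand_val n A V (MuN (CutN (ren_val id Suc V) (Stk (Covar 0))))"
| "expand_val n (TLolli A B) V
     (MuFun (CutN (ren_val Suc Suc V) (Stk (Push (Var 0) (Covar 0)))))"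
| "expand_val n (TWith A B) V
     (MuWith (CutN (ren_val id Suc V) (Stk (Pi1 (Covar 0))))
             (CutN (ren_val id Suc V) (Stk (Pi2 (Covar 0)))))"
| "expand_val n TTop V (MuTop (tensor_ctx n))"
| "expand_val n (TBang A) V (MuBang (CutP (Val (ren_val id Suc V)) (SBang (Covar 0))))"

inductive expand_stk :: "nat \<Rightarrow> ty \<Rightarrow> stk \<Rightarrow> stk \<Rightarrow> bool" where
  "pol A = Pos \<Longrightarrow> expand_stk n A S (MtP (CutP (Val (Var 0)) (ren_stk Suc id S)))"
| "expand_stk n TOne S (MtUnit (CutP (Val VUnit) S))"
| "expand_stk n (TTensor A B) S
     (MtTensor (CutP (Val (VTensor (Var 1) (Var 0))) (ren_stk (\<lambda>i. i + 2) id S)))"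
| "expand_stk n (TPlus A B) S
     (MtPlus (CutP (Val (In1 (Var 0))) (ren_stk Suc id S))
             (CutP (Val (In2 (Var 0))) (ren_stk Suc id S)))"
| "expand_stk n TZero S (MtZero (push_ctx n))"
| "expand_stk n (TDia A) S (MtDia (CutN (VDia (Var 0)) (Stk (ren_stk Suc id S))))"

inductive expand_expr :: "ty \<Rightarrow> expr \<Rightarrow> expr \<Rightarrow> bool" where
  "pol A = Pos \<Longrightarrow> expand_expr A t (MuP (CutP (ren_expr id Suc t) (Covar 0)))"

inductive expand_ctxt :: "ty \<Rightarrow> ctxt \<Rightarrow> ctxt \<Rightarrow> bool" where
  "pol A = Neg \<Longrightarrow> expand_ctxt A e (MtN (CutN (Var 0) (ren_ctxt Suc id e)))"

text \<open>
  A context \<open>x\<^sub>1 : A\<^sub>1, \<dots>, x\<^sub>n : A\<^sub>n\<close> is the list \<open>[A\<^sub>n, \<dots>, A\<^sub>1]\<close>, so that the variable with index \<open>i\<close> has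
  the \<open>i\<close>-th type of the list and \<open>\<Gamma>, x : A\<close> is \<open>A # \<Gamma>\<close>. Accordingly the concatenation
  \<open>\<Gamma>, \<Gamma>'\<close> is \<open>\<Gamma>' @ \<Gamma>\<close>, and a term in context \<open>\<Gamma>\<close> has to be shifted by \<open>length \<Gamma>'\<close> there.
  As \<open>\<Delta>\<close> consists of a single co-variable, it is given by its type; that co-variable has index 0.
\<close>

definition structural :: "ty list \<Rightarrow> (nat \<Rightarrow> nat) \<Rightarrow> ty list \<Rightarrow> bool" where
  "structural \<Gamma> \<sigma> \<Gamma>' \<longleftrightarrow>
     (\<forall>i < length \<Gamma>. \<sigma> i < length \<Gamma>' \<and> \<Gamma>' ! \<sigma> i = \<Gamma> ! i) \<and>
     bij_betw \<sigma> {i. i < length \<Gamma> \<and> \<not> is_bang (\<Gamma> ! i)}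
                {j. j < length \<Gamma>' \<and> \<not> is_bang (\<Gamma>' ! j)}"

abbreviation shift_val :: "ty list \<Rightarrow> val \<Rightarrow> val" where
  "shift_val \<Gamma> \<equiv> ren_val (\<lambda>i. i + length \<Gamma>) id"

abbreviation shift_expr :: "ty list \<Rightarrow> expr \<Rightarrow> expr" where
  "shift_expr \<Gamma> \<equiv> ren_expr (\<lambda>i. i + length \<Gamma>) id"

text \<open>
  \<open>ty_val \<Gamma> V A\<close> and \<open>ty_expr \<Gamma> t A\<close> stand for \<open>\<Gamma> \<turnstile> t : A |\<close>, \<open>ty_stk \<Gamma> S A B\<close> and
  \<open>ty_ctxt \<Gamma> e A B\<close> for \<open>\<Gamma> | e : A \<turnstile> \<alpha> : B\<close>, and \<open>ty_cmd \<Gamma> c B\<close> for \<open>c : (\<Gamma> \<turnstile> \<alpha> : B)\<close>.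
\<close>

inductive
      ty_val :: "ty list \<Rightarrow> val \<Rightarrow> ty \<Rightarrow> bool"
  and ty_stk :: "ty list \<Rightarrow> stk \<Rightarrow> ty \<Rightarrow> ty \<Rightarrow> bool"
  and ty_expr :: "ty list \<Rightarrow> expr \<Rightarrow> ty \<Rightarrow> bool"
  and ty_ctxt :: "ty list \<Rightarrow> ctxt \<Rightarrow> ty \<Rightarrow> ty \<Rightarrow> bool"
  and ty_cmd :: "ty list \<Rightarrow> cmd \<Rightarrow> ty \<Rightarrow> bool"
where
  ty_Val: "ty_val \<Gamma> V A \<Longrightarrow> ty_expr \<Gamma> (Val V) A"
| ty_Stk: "ty_stk \<Gamma> S A B \<Longrightarrow> ty_ctxt \<Gamma> (Stk S) A B"

| ty_Var: "ty_val [A] (Var 0) A"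
| ty_Covar: "ty_stk [] (Covar 0) A A"
| ty_MtP: "ty_cmd (A # \<Gamma>) c B \<Longrightarrow> pol A = Pos \<Longrightarrow> ty_stk \<Gamma> (MtP c) A B"
| ty_MtN: "ty_cmd (A # \<Gamma>) c B \<Longrightarrow> pol A = Neg \<Longrightarrow> ty_ctxt \<Gamma> (MtN c) A B"
| ty_MuP: "ty_cmd \<Gamma> c A \<Longrightarrow> pol A = Pos \<Longrightarrow> ty_expr \<Gamma> (MuP c) A"
| ty_MuN: "ty_cmd \<Gamma> c A \<Longrightarrow> pol A = Neg \<Longrightarrow> ty_val \<Gamma> (MuN c) A"
| ty_CutP: "ty_expr \<Gamma> t A \<Longrightarrow> ty_stk \<Gamma>' S A B \<Longrightarrow> pol A = Pos \<Longrightarrow>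
    ty_cmd (\<Gamma>' @ \<Gamma>) (CutP (shift_expr \<Gamma>' t) S) B"
| ty_CutN: "ty_val \<Gamma> V A \<Longrightarrow> ty_ctxt \<Gamma>' e A B \<Longrightarrow> pol A = Neg \<Longrightarrow>
    ty_cmd (\<Gamma>' @ \<Gamma>) (CutN (shift_val \<Gamma>' V) e) B"

| ty_struct_val: "ty_val \<Gamma> V A \<Longrightarrow> structural \<Gamma> \<sigma> \<Gamma>' \<Longrightarrow> ty_val \<Gamma>' (ren_val \<sigma> id V) A"
| ty_struct_stk: "ty_stk \<Gamma> S A B \<Longrightarrow> structural \<Gamma> \<sigma> \<Gamma>' \<Longrightarrow> ty_stk \<Gamma>' (ren_stk \<sigma> id S) A B"
| ty_struct_expr: "ty_expr \<Gamma> t A \<Longrightarrow> structural \<Gamma> \<sigma> \<Gamma>' \<Longrightarrow> ty_expr \<Gamma>' (ren_expr \<sigma> id t) A"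
| ty_struct_ctxt: "ty_ctxt \<Gamma> e A B \<Longrightarrow> structural \<Gamma> \<sigma> \<Gamma>' \<Longrightarrow> ty_ctxt \<Gamma>' (ren_ctxt \<sigma> id e) A B"
| ty_struct_cmd: "ty_cmd \<Gamma> c B \<Longrightarrow> structural \<Gamma> \<sigma> \<Gamma>' \<Longrightarrow> ty_cmd \<Gamma>' (ren_cmd \<sigma> id c) B"

| ty_Push: "ty_val \<Gamma> V A \<Longrightarrow> ty_stk \<Gamma>' S B C \<Longrightarrow>
    ty_stk (\<Gamma>' @ \<Gamma>) (Push (shift_val \<Gamma>' V) S) (TLolli A B) C"
| ty_MuFun: "ty_cmd (A # \<Gamma>) c B \<Longrightarrow> ty_val \<Gamma> (MuFun c) (TLolli A B)"
| ty_VTensor: "ty_val \<Gamma> V A \<Longrightarrow> ty_val \<Gamma>' W B \<Longrightarrow>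
    ty_val (\<Gamma>' @ \<Gamma>) (VTensor (shift_val \<Gamma>' V) W) (TTensor A B)"
| ty_MtTensor: "ty_cmd (B # A # \<Gamma>) c C \<Longrightarrow> ty_stk \<Gamma> (MtTensor c) (TTensor A B) C"
| ty_MuWith: "ty_cmd \<Gamma> c A \<Longrightarrow> ty_cmd \<Gamma> d B \<Longrightarrow> ty_val \<Gamma> (MuWith c d) (TWith A B)"
| ty_Pi1: "ty_stk \<Gamma> S A C \<Longrightarrow> ty_stk \<Gamma> (Pi1 S) (TWith A B) C"
| ty_Pi2: "ty_stk \<Gamma> S B C \<Longrightarrow> ty_stk \<Gamma> (Pi2 S) (TWith A B) C"
| ty_MtPlus: "ty_cmd (A # \<Gamma>) c C \<Longrightarrow> ty_cmd (B # \<Gamma>) d C \<Longrightarrow>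
    ty_stk \<Gamma> (MtPlus c d) (TPlus A B) C"
| ty_In1: "ty_val \<Gamma> V A \<Longrightarrow> ty_val \<Gamma> (In1 V) (TPlus A B)"
| ty_In2: "ty_val \<Gamma> V B \<Longrightarrow> ty_val \<Gamma> (In2 V) (TPlus A B)"
| ty_VUnit: "ty_val [] VUnit TOne"
| ty_MtUnit: "ty_cmd \<Gamma> c B \<Longrightarrow> ty_stk \<Gamma> (MtUnit c) TOne B"
| ty_MuTop: "ty_val \<Gamma> V A \<Longrightarrow> ty_val \<Gamma> (MuTop V) TTop"
| ty_MtZero: "ty_stk \<Gamma> S A B \<Longrightarrow> ty_stk \<Gamma> (MtZero S) TZero B"

| ty_MuBang: "ty_cmd \<Gamma> c A \<Longrightarrow> \<forall>G\<in>set \<Gamma>. is_bang G \<Longrightarrow> ty_val \<Gamma> (MuBang c) (TBang A)"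
| ty_SBang: "ty_stk \<Gamma> S A B \<Longrightarrow> ty_stk \<Gamma> (SBang S) (TBang A) B"
| ty_VDia: "ty_val \<Gamma> V A \<Longrightarrow> ty_val \<Gamma> (VDia V) (TDia A)"
| ty_MtDia: "ty_cmd (A # \<Gamma>) c B \<Longrightarrow> \<forall>G\<in>set \<Gamma>. is_bang G \<Longrightarrow> is_dia B \<Longrightarrow>
    ty_stk \<Gamma> (MtDia c) (TDia A) B"

text \<open>
  The typed compatible equivalence closure of reduction and expansion: a step relates two terms
  with the same judgement, an expansion step is taken at the type of that judgement, and there is
  one congruence rule for each typing rule.
\<close>

inductive
      eq_val :: "ty list \<Rightarrow> val \<Rightarrow> val \<Rightarrow> ty \<Rightarrow> bool"
  and eq_stk :: "ty list \<Rightarrow> stk \<Rightarrow> stk \<Rightarrow> ty \<Rightarrow> ty \<Rightarrow> bool"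
  and eq_expr :: "ty list \<Rightarrow> expr \<Rightarrow> expr \<Rightarrow> ty \<Rightarrow> bool"
  and eq_ctxt :: "ty list \<Rightarrow> ctxt \<Rightarrow> ctxt \<Rightarrow> ty \<Rightarrow> ty \<Rightarrow> bool"
  and eq_cmd :: "ty list \<Rightarrow> cmd \<Rightarrow> cmd \<Rightarrow> ty \<Rightarrow> bool"
where
  eq_red: "red c c' \<Longrightarrow> ty_cmd \<Gamma> c B \<Longrightarrow> ty_cmd \<Gamma> c' B \<Longrightarrow> eq_cmd \<Gamma> c c' B"
| eq_expand_val: "expand_val (length \<Gamma>) A V V' \<Longrightarrow> ty_val \<Gamma> V A \<Longrightarrow> ty_val \<Gamma> V' A \<Longrightarrow>
    eq_val \<Gamma> V V' A"
| eq_expand_stk: "expand_stk (length \<Gamma>) A S S' \<Longrightarrow> ty_stk \<Gamma> S A B \<Longrightarrow> ty_stk \<Gamma> S' A B \<Longrightarrow>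
    eq_stk \<Gamma> S S' A B"
| eq_expand_expr: "expand_expr A t t' \<Longrightarrow> ty_expr \<Gamma> t A \<Longrightarrow> ty_expr \<Gamma> t' A \<Longrightarrow>
    eq_expr \<Gamma> t t' A"
| eq_expand_ctxt: "expand_ctxt A e e' \<Longrightarrow> ty_ctxt \<Gamma> e A B \<Longrightarrow> ty_ctxt \<Gamma> e' A B \<Longrightarrow>
    eq_ctxt \<Gamma> e e' A B"

| eq_refl_val: "ty_val \<Gamma> V A \<Longrightarrow> eq_val \<Gamma> V V A"
| eq_refl_stk: "ty_stk \<Gamma> S A B \<Longrightarrow> eq_stk \<Gamma> S S A B"
| eq_refl_expr: "ty_expr \<Gamma> t A \<Longrightarrow> eq_expr \<Gamma> t t A"
| eq_refl_ctxt: "ty_ctxt \<Gamma> e A B \<Longrightarrow> eq_ctxt \<Gamma> e e A B"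
| eq_refl_cmd: "ty_cmd \<Gamma> c B \<Longrightarrow> eq_cmd \<Gamma> c c B"
| eq_sym_val: "eq_val \<Gamma> V V' A \<Longrightarrow> eq_val \<Gamma> V' V A"
| eq_sym_stk: "eq_stk \<Gamma> S S' A B \<Longrightarrow> eq_stk \<Gamma> S' S A B"
| eq_sym_expr: "eq_expr \<Gamma> t t' A \<Longrightarrow> eq_expr \<Gamma> t' t A"
| eq_sym_ctxt: "eq_ctxt \<Gamma> e e' A B \<Longrightarrow> eq_ctxt \<Gamma> e' e A B"
| eq_sym_cmd: "eq_cmd \<Gamma> c c' B \<Longrightarrow> eq_cmd \<Gamma> c' c B"
| eq_trans_val: "eq_val \<Gamma> V V' A \<Longrightarrow> eq_val \<Gamma> V' V'' A \<Longrightarrow> eq_val \<Gamma> V V'' A"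
| eq_trans_stk: "eq_stk \<Gamma> S S' A B \<Longrightarrow> eq_stk \<Gamma> S' S'' A B \<Longrightarrow> eq_stk \<Gamma> S S'' A B"
| eq_trans_expr: "eq_expr \<Gamma> t t' A \<Longrightarrow> eq_expr \<Gamma> t' t'' A \<Longrightarrow> eq_expr \<Gamma> t t'' A"
| eq_trans_ctxt: "eq_ctxt \<Gamma> e e' A B \<Longrightarrow> eq_ctxt \<Gamma> e' e'' A B \<Longrightarrow> eq_ctxt \<Gamma> e e'' A B"
| eq_trans_cmd: "eq_cmd \<Gamma> c c' B \<Longrightarrow> eq_cmd \<Gamma> c' c'' B \<Longrightarrow> eq_cmd \<Gamma> c c'' B"

| eq_Val: "eq_val \<Gamma> V V' A \<Longrightarrow> eq_expr \<Gamma> (Val V) (Val V') A"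
| eq_Stk: "eq_stk \<Gamma> S S' A B \<Longrightarrow> eq_ctxt \<Gamma> (Stk S) (Stk S') A B"

| eq_MtP: "eq_cmd (A # \<Gamma>) c c' B \<Longrightarrow> pol A = Pos \<Longrightarrow> eq_stk \<Gamma> (MtP c) (MtP c') A B"
| eq_MtN: "eq_cmd (A # \<Gamma>) c c' B \<Longrightarrow> pol A = Neg \<Longrightarrow> eq_ctxt \<Gamma> (MtN c) (MtN c') A B"
| eq_MuP: "eq_cmd \<Gamma> c c' A \<Longrightarrow> pol A = Pos \<Longrightarrow> eq_expr \<Gamma> (MuP c) (MuP c') A"
| eq_MuN: "eq_cmd \<Gamma> c c' A \<Longrightarrow> pol A = Neg \<Longrightarrow> eq_val \<Gamma> (MuN c) (MuN c') A"
| eq_CutP: "eq_expr \<Gamma> t t' A \<Longrightarrow> eq_stk \<Gamma>' S S' A B \<Longrightarrow> pol A = Pos \<Longrightarrow>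
    eq_cmd (\<Gamma>' @ \<Gamma>) (CutP (shift_expr \<Gamma>' t) S) (CutP (shift_expr \<Gamma>' t') S') B"
| eq_CutN: "eq_val \<Gamma> V V' A \<Longrightarrow> eq_ctxt \<Gamma>' e e' A B \<Longrightarrow> pol A = Neg \<Longrightarrow>
    eq_cmd (\<Gamma>' @ \<Gamma>) (CutN (shift_val \<Gamma>' V) e) (CutN (shift_val \<Gamma>' V') e') B"

| eq_struct_val: "eq_val \<Gamma> V V' A \<Longrightarrow> structural \<Gamma> \<sigma> \<Gamma>' \<Longrightarrow>
    eq_val \<Gamma>' (ren_val \<sigma> id V) (ren_val \<sigma> id V') A"
| eq_struct_stk: "eq_stk \<Gamma> S S' A B \<Longrightarrow> structural \<Gamma> \<sigma> \<Gamma>' \<Longrightarrow>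
    eq_stk \<Gamma>' (ren_stk \<sigma> id S) (ren_stk \<sigma> id S') A B"
| eq_struct_expr: "eq_expr \<Gamma> t t' A \<Longrightarrow> structural \<Gamma> \<sigma> \<Gamma>' \<Longrightarrow>
    eq_expr \<Gamma>' (ren_expr \<sigma> id t) (ren_expr \<sigma> id t') A"
| eq_struct_ctxt: "eq_ctxt \<Gamma> e e' A B \<Longrightarrow> structural \<Gamma> \<sigma> \<Gamma>' \<Longrightarrow>
    eq_ctxt \<Gamma>' (ren_ctxt \<sigma> id e) (ren_ctxt \<sigma> id e') A B"
| eq_struct_cmd: "eq_cmd \<Gamma> c c' B \<Longrightarrow> structural \<Gamma> \<sigma> \<Gamma>' \<Longrightarrow>
    eq_cmd \<Gamma>' (ren_cmd \<sigma> id c) (ren_cmd \<sigma> id c') B"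

| eq_Push: "eq_val \<Gamma> V V' A \<Longrightarrow> eq_stk \<Gamma>' S S' B C \<Longrightarrow>
    eq_stk (\<Gamma>' @ \<Gamma>) (Push (shift_val \<Gamma>' V) S) (Push (shift_val \<Gamma>' V') S') (TLolli A B) C"
| eq_MuFun: "eq_cmd (A # \<Gamma>) c c' B \<Longrightarrow> eq_val \<Gamma> (MuFun c) (MuFun c') (TLolli A B)"
| eq_VTensor: "eq_val \<Gamma> V V' A \<Longrightarrow> eq_val \<Gamma>' W W' B \<Longrightarrow>
    eq_val (\<Gamma>' @ \<Gamma>) (VTensor (shift_val \<Gamma>' V) W) (VTensor (shift_val \<Gamma>' V') W') (TTensor A B)"
| eq_MtTensor: "eq_cmd (B # A # \<Gamma>) c c' C \<Longrightarrow>
    eq_stk \<Gamma> (MtTensor c) (MtTensor c') (TTensor A B) C"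
| eq_MuWith: "eq_cmd \<Gamma> c c' A \<Longrightarrow> eq_cmd \<Gamma> d d' B \<Longrightarrow>
    eq_val \<Gamma> (MuWith c d) (MuWith c' d') (TWith A B)"
| eq_Pi1: "eq_stk \<Gamma> S S' A C \<Longrightarrow> eq_stk \<Gamma> (Pi1 S) (Pi1 S') (TWith A B) C"
| eq_Pi2: "eq_stk \<Gamma> S S' B C \<Longrightarrow> eq_stk \<Gamma> (Pi2 S) (Pi2 S') (TWith A B) C"
| eq_MtPlus: "eq_cmd (A # \<Gamma>) c c' C \<Longrightarrow> eq_cmd (B # \<Gamma>) d d' C \<Longrightarrow>
    eq_stk \<Gamma> (MtPlus c d) (MtPlus c' d') (TPlus A B) C"
| eq_In1: "eq_val \<Gamma> V V' A \<Longrightarrow> eq_val \<Gamma> (In1 V) (In1 V') (TPlus A B)"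
| eq_In2: "eq_val \<Gamma> V V' B \<Longrightarrow> eq_val \<Gamma> (In2 V) (In2 V') (TPlus A B)"
| eq_MtUnit: "eq_cmd \<Gamma> c c' B \<Longrightarrow> eq_stk \<Gamma> (MtUnit c) (MtUnit c') TOne B"
| eq_MuTop: "eq_val \<Gamma> V V' A \<Longrightarrow> eq_val \<Gamma> (MuTop V) (MuTop V') TTop"
| eq_MtZero: "eq_stk \<Gamma> S S' A B \<Longrightarrow> eq_stk \<Gamma> (MtZero S) (MtZero S') TZero B"
| eq_MuBang: "eq_cmd \<Gamma> c c' A \<Longrightarrow> \<forall>G\<in>set \<Gamma>. is_bang G \<Longrightarrow>
    eq_val \<Gamma> (MuBang c) (MuBang c') (TBang A)"
| eq_SBang: "eq_stk \<Gamma> S S' A B \<Longrightarrow> eq_stk \<Gamma> (SBang S) (SBang S') (TBang A) B"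
| eq_VDia: "eq_val \<Gamma> V V' A \<Longrightarrow> eq_val \<Gamma> (VDia V) (VDia V') (TDia A)"
| eq_MtDia: "eq_cmd (A # \<Gamma>) c c' B \<Longrightarrow> \<forall>G\<in>set \<Gamma>. is_bang G \<Longrightarrow> is_dia B \<Longrightarrow>
    eq_stk \<Gamma> (MtDia c) (MtDia c') (TDia A) B"

text \<open>
  \<open>Comp C X Y Z g f\<close> is the composite \<open>g \<circ> f\<close> of \<open>f : X \<rightarrow> Y\<close> and \<open>g : Y \<rightarrow> Z\<close>. Hom-sets of different
  pairs of objects need not be disjoint, which is why composition takes the objects as arguments.
\<close>

record ('o, 'm) cat_data =
  Ob :: "'o set"
  Hom :: "'o \<Rightarrow> 'o \<Rightarrow> 'm set"
  Idn :: "'o \<Rightarrow> 'm"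
  Comp :: "'o \<Rightarrow> 'o \<Rightarrow> 'o \<Rightarrow> 'm \<Rightarrow> 'm \<Rightarrow> 'm"

locale category =
  fixes C :: "('o, 'm) cat_data"
  assumes Idn_in_Hom: "X \<in> Ob C \<Longrightarrow> Idn C X \<in> Hom C X X"
    and Comp_in_Hom:
      "X \<in> Ob C \<Longrightarrow> Y \<in> Ob C \<Longrightarrow> Z \<in> Ob C \<Longrightarrow> f \<in> Hom C X Y \<Longrightarrow> g \<in> Hom C Y Z \<Longrightarrow>
       Comp C X Y Z g f \<in> Hom C X Z"
    and Comp_Idn_left:
      "X \<in> Ob C \<Longrightarrow> Y \<in> Ob C \<Longrightarrow> f \<in> Hom C X Y \<Longrightarrow> Comp C X Y Y (Idn C Y) f = f"
    and Comp_Idn_right: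
      "X \<in> Ob C \<Longrightarrow> Y \<in> Ob C \<Longrightarrow> f \<in> Hom C X Y \<Longrightarrow> Comp C X X Y f (Idn C X) = f"
    and Comp_assoc:
      "W \<in> Ob C \<Longrightarrow> X \<in> Ob C \<Longrightarrow> Y \<in> Ob C \<Longrightarrow> Z \<in> Ob C \<Longrightarrow>
       f \<in> Hom C W X \<Longrightarrow> g \<in> Hom C X Y \<Longrightarrow> h \<in> Hom C Y Z \<Longrightarrow>
       Comp C W X Z (Comp C X Y Z h g) f = Comp C W Y Z h (Comp C W X Y g f)"

locale cat_functor = dom: category C + cod: category D
  for C :: "('o, 'm) cat_data" and D :: "('p, 'n) cat_data" +
  fixes Fo :: "'o \<Rightarrow> 'p" and Fm :: "'o \<Rightarrow> 'o \<Rightarrow> 'm \<Rightarrow> 'n"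
  assumes Fo_in_Ob: "X \<in> Ob C \<Longrightarrow> Fo X \<in> Ob D"
    and Fm_in_Hom:
      "X \<in> Ob C \<Longrightarrow> Y \<in> Ob C \<Longrightarrow> f \<in> Hom C X Y \<Longrightarrow> Fm X Y f \<in> Hom D (Fo X) (Fo Y)"
    and Fm_Idn: "X \<in> Ob C \<Longrightarrow> Fm X X (Idn C X) = Idn D (Fo X)"
    and Fm_Comp:
      "X \<in> Ob C \<Longrightarrow> Y \<in> Ob C \<Longrightarrow> Z \<in> Ob C \<Longrightarrow> f \<in> Hom C X Y \<Longrightarrow> g \<in> Hom C Y Z \<Longrightarrow>
       Fm X Z (Comp C X Y Z g f) = Comp D (Fo X) (Fo Y) (Fo Z) (Fm Y Z g) (Fm X Y f)"

locale relative_monad = cat_functor A B Lo Lm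
  for A :: "('o, 'm) cat_data" and B :: "('p, 'n) cat_data"
    and Lo :: "'o \<Rightarrow> 'p" and Lm :: "'o \<Rightarrow> 'o \<Rightarrow> 'm \<Rightarrow> 'n" +
  fixes T :: "'o \<Rightarrow> 'p" and unit :: "'o \<Rightarrow> 'n" and ext :: "'o \<Rightarrow> 'o \<Rightarrow> 'n \<Rightarrow> 'n"
  assumes T_in_Ob: "X \<in> Ob A \<Longrightarrow> T X \<in> Ob B"
    and unit_in_Hom: "X \<in> Ob A \<Longrightarrow> unit X \<in> Hom B (Lo X) (T X)"
    and ext_in_Hom:
      "X \<in> Ob A \<Longrightarrow> Y \<in> Ob A \<Longrightarrow> f \<in> Hom B (Lo X) (T Y) \<Longrightarrow> ext X Y f \<in> Hom B (T X) (T Y)"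
    and ext_unit:
      "X \<in> Ob A \<Longrightarrow> Y \<in> Ob A \<Longrightarrow> f \<in> Hom B (Lo X) (T Y) \<Longrightarrow>
       f = Comp B (Lo X) (T X) (T Y) (ext X Y f) (unit X)"
    and unit_ext: "X \<in> Ob A \<Longrightarrow> ext X X (unit X) = Idn B (T X)"
    and ext_Comp:
      "X \<in> Ob A \<Longrightarrow> Y \<in> Ob A \<Longrightarrow> Z \<in> Ob A \<Longrightarrow>
       f \<in> Hom B (Lo Y) (T Z) \<Longrightarrow> g \<in> Hom B (Lo X) (T Y) \<Longrightarrow>
       ext X Z (Comp B (Lo X) (T Y) (T Z) (ext Y Z f) g) =
       Comp B (T X) (T Y) (T Z) (ext Y Z f) (ext X Y g)"

locale relative_comonad = cat_functor B A Ro Rm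
  for B :: "('o, 'm) cat_data" and A :: "('p, 'n) cat_data"
    and Ro :: "'o \<Rightarrow> 'p" and Rm :: "'o \<Rightarrow> 'o \<Rightarrow> 'm \<Rightarrow> 'n" +
  fixes S :: "'o \<Rightarrow> 'p" and counit :: "'o \<Rightarrow> 'n" and coext :: "'o \<Rightarrow> 'o \<Rightarrow> 'n \<Rightarrow> 'n"
  assumes S_in_Ob: "X \<in> Ob B \<Longrightarrow> S X \<in> Ob A"
    and counit_in_Hom: "X \<in> Ob B \<Longrightarrow> counit X \<in> Hom A (S X) (Ro X)"
    and coext_in_Hom:
      "X \<in> Ob B \<Longrightarrow> Y \<in> Ob B \<Longrightarrow> f \<in> Hom A (S X) (Ro Y) \<Longrightarrow> coext X Y f \<in> Hom A (S X) (S Y)"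
    and counit_coext:
      "X \<in> Ob B \<Longrightarrow> Y \<in> Ob B \<Longrightarrow> f \<in> Hom A (S X) (Ro Y) \<Longrightarrow>
       f = Comp A (S X) (S Y) (Ro Y) (counit Y) (coext X Y f)"
    and coext_counit: "X \<in> Ob B \<Longrightarrow> coext X X (counit X) = Idn A (S X)"
    and coext_Comp:
      "X \<in> Ob B \<Longrightarrow> Y \<in> Ob B \<Longrightarrow> Z \<in> Ob B \<Longrightarrow>
       f \<in> Hom A (S Y) (Ro Z) \<Longrightarrow> g \<in> Hom A (S X) (Ro Y) \<Longrightarrow>
       coext X Z (Comp A (S X) (S Y) (Ro Z) f (coext X Y g)) =
       Comp A (S X) (S Y) (S Z) (coext Y Z f) (coext X Y g)"

definition thunkable_mor :: "('o, 'm) cat_data \<Rightarrow> 'o \<Rightarrow> 'o \<Rightarrow> 'm \<Rightarrow> bool" where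
  "thunkable_mor C W X f \<longleftrightarrow>
     (\<forall>Y\<in>Ob C. \<forall>Z\<in>Ob C. \<forall>g\<in>Hom C X Y. \<forall>h\<in>Hom C Y Z.
        Comp C W X Z (Comp C X Y Z h g) f = Comp C W Y Z h (Comp C W X Y g f))"

definition linear_mor :: "('o, 'm) cat_data \<Rightarrow> 'o \<Rightarrow> 'o \<Rightarrow> 'm \<Rightarrow> bool" where
  "linear_mor C Y Z h \<longleftrightarrow>
     (\<forall>W\<in>Ob C. \<forall>X\<in>Ob C. \<forall>f\<in>Hom C W X. \<forall>g\<in>Hom C X Y.
        Comp C W X Z (Comp C X Y Z h g) f = Comp C W Y Z h (Comp C W X Y g f))"

text \<open>
  A command \<open>c : (x : A \<turnstile> \<alpha> : B)\<close> has the variable \<open>x\<close> at index 0 and the co-variable \<open>\<alpha>\<close> at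
  index 0, which takes care of the renaming of \<open>x\<close> and \<open>\<alpha>\<close>.
\<close>

definition cmds :: "ty \<Rightarrow> ty \<Rightarrow> cmd set" where
  "cmds A B = {c. ty_cmd [A] c B}"

definition eqv :: "ty \<Rightarrow> ty \<Rightarrow> (cmd \<times> cmd) set" where
  "eqv A B = {(c, c'). eq_cmd [A] c c' B}"

definition cls :: "ty \<Rightarrow> ty \<Rightarrow> cmd \<Rightarrow> cmd set" where
  "cls A B c = eqv A B `` {c}"

text \<open>\<open>\<langle>x \<parallel> \<alpha>\<rangle>\<close> and \<open>\<langle>\<mu>\<alpha>.c \<parallel> \<mu>\<^sup>~y.c'\<rangle>\<close> at a given polarity.\<close>

fun id_cmd :: "polarity \<Rightarrow> cmd" where
  "id_cmd Pos = CutP (Val (Var 0)) (Covar 0)"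
| "id_cmd Neg = CutN (Var 0) (Stk (Covar 0))"

fun comp_cmd :: "polarity \<Rightarrow> cmd \<Rightarrow> cmd \<Rightarrow> cmd" where
  "comp_cmd Pos c c' = CutP (MuP c) (MtP c')"
| "comp_cmd Neg c c' = CutN (MuN c) (MtN c')"

text \<open>
  As usual for operations on quotients, the operations below take the union of the classes obtained
  from all representatives; this is a single class when the operation respects equivalence.
\<close>

definition Dcat :: "(ty, cmd set) cat_data" where
  "Dcat = \<lparr>Ob = UNIV,
        Hom = (\<lambda>A B. cmds A B // eqv A B),
        Idn = (\<lambda>A. cls A A (id_cmd (pol A))),
        Comp = (\<lambda>A B C g f. \<Union>c\<in>f. \<Union>c'\<in>g. cls A C (comp_cmd (pol B) c c'))\<rparr>"

definition Pt :: "(ty, cmd set) cat_data" where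
  "Pt = Dcat\<lparr>Ob := {A. pol A = Pos}, Hom := (\<lambda>A B. {f \<in> Hom Dcat A B. thunkable_mor Dcat A B f})\<rparr>"

definition Nl :: "(ty, cmd set) cat_data" where
  "Nl = Dcat\<lparr>Ob := {A. pol A = Neg}, Hom := (\<lambda>A B. {f \<in> Hom Dcat A B. linear_mor Dcat A B f})\<rparr>"

text \<open>
  The commands below are
  \<open>\<langle>z \<parallel> \<mu>\<^sup>~(u \<otimes> x).\<langle>u \<otimes> \<mu>\<alpha>\<^sup>-.c \<parallel> \<gamma>\<rangle>\<^sup>+\<rangle>\<^sup>+\<close>, \<open>\<langle>\<mu>(u \<cdot> \<alpha>).\<langle>z \<parallel> u \<cdot> \<mu>\<^sup>~x\<^sup>+.c\<rangle>\<^sup>- \<parallel> \<gamma>\<rangle>\<^sup>-\<close>,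
  \<open>\<langle>() \<otimes> \<mu>\<alpha>\<^sup>-.c \<parallel> \<gamma>\<rangle>\<^sup>+\<close> and \<open>\<langle>z \<parallel> () \<cdot> \<mu>\<^sup>~x\<^sup>+.c\<rangle>\<^sup>-\<close>.
  No shifting of \<open>c\<close> is needed, because its only variable and its only co-variable are at index 0
  in each of them.
\<close>

definition down :: "ty \<Rightarrow> ty" where
  "down N = TTensor TOne N"

definition down_map :: "ty \<Rightarrow> ty \<Rightarrow> cmd set \<Rightarrow> cmd set" where
  "down_map N M f =
     (\<Union>c\<in>f. cls (down N) (down M)
        (CutP (Val (Var 0)) (MtTensor (CutP (Val (VTensor (Var 1) (MuN c))) (Covar 0)))))"

definition shift_up :: "ty \<Rightarrow> ty" where
  "shift_up P = TLolli TOne P"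

definition up_map :: "ty \<Rightarrow> ty \<Rightarrow> cmd set \<Rightarrow> cmd set" where
  "up_map P Q f =
     (\<Union>c\<in>f. cls (shift_up P) (shift_up Q)
        (CutN (MuFun (CutN (Var 1) (Stk (Push (Var 0) (MtP c))))) (Stk (Covar 0))))"

definition down_transpose :: "ty \<Rightarrow> ty \<Rightarrow> cmd set \<Rightarrow> cmd set" where
  "down_transpose P M f =
     (\<Union>c\<in>f. cls P (down M) (CutP (Val (VTensor VUnit (MuN c))) (Covar 0)))"

definition up_transpose :: "ty \<Rightarrow> ty \<Rightarrow> cmd set \<Rightarrow> cmd set" where
  "up_transpose P N f =
     (\<Union>c\<in>f. cls (shift_up P) N (CutN (Var 0) (Stk (Push VUnit (MtP c)))))"

end

theory Submission
  imports Defs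
begin

text \<open>
  Morphisms \<open>\<langle>V \<parallel> \<gamma>\<rangle>\<close> given by a value are thunkable and morphisms \<open>\<langle>z \<parallel> S\<rangle>\<close> given by a stack are linear,
  because composing with them is substitution of \<open>V\<close>, respectively \<open>S\<close>. The first transposition is
  postcomposition with the value morphism \<open>\<theta> = \<langle>() \<otimes> y \<parallel> \<gamma>\<rangle> : N \<rightarrow> 1 \<otimes> N\<close>, which is epi by the \<open>\<eta>\<close>-laws of
  \<open>\<otimes>\<close> and \<open>1\<close> and has as retraction a stack morphism \<open>\<pi>\<close>; hence \<open>\<theta>\<close> and \<open>\<pi>\<close> are mutually inverse, and
  \<open>\<Down>f = \<theta> \<circ> (f \<circ> \<pi>)\<close>. Dually, the second one is precomposition with the stack morphism
  \<open>\<lambda> = \<langle>z \<parallel> () \<cdot> \<alpha>\<rangle> : 1 \<multimap> P \<rightarrow> P\<close>, which is mono and has as section a value morphism \<open>\<kappa>\<close>. With the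
  associativity laws of linear and thunkable maps, the (co)monad laws become the \<open>\<beta>\<close>-, \<open>\<eta>\<close>- and
  substitution laws of \<open>\<mu>!\<alpha>.c\<close> and \<open>\<mu>\<^sup>~\<diamond>x.c\<close>.
\<close>

section \<open>Renaming and substitution\<close>

text \<open>The obstacle is the substitution lemma: the typing rules split contexts and allow a
  renaming at every step, so an induction on them has no control over how a context was divided. An
  equivalent system with a fixed context and explicit usage sets makes renaming and substitution
  plain inductions, and the results are then transferred. A judgement has exactly one co-variable on
  the right. Hence values have no free co-variable, and the stack of a stack morphism has no free
  variable, so shifts under binders mostly vanish. Equality is never shown to be stable under
  substitution: up to equality, substituting is composing with a value or stack morphism, and for
  this the congruence of cuts suffices. As composition in D is not associative, the brackets in all
  formulas matter; each rebracketing is licensed by one factor known to be thunkable (on the right)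
  or linear (on the left).\<close>

lemma fun_id [simp]: "(\<lambda>i. i) = id"
  by auto

lemma up_simps [simp]: "up r 0 = 0" "up r (Suc n) = Suc (r n)"
  by (simp_all add: up_def)

lemma up_id [simp]: "up id = id"
  by (auto simp: up_def fun_eq_iff split: nat.splits)

lemma up_comp: "up r \<circ> up r' = up (r \<circ> r')"
  by (auto simp: up_def fun_eq_iff split: nat.splits)

lemma ren_ren:
  "ren_val r k (ren_val r' k' V) = ren_val (r \<circ> r') (k \<circ> k') V"
  "ren_stk r k (ren_stk r' k' S) = ren_stk (r \<circ> r') (k \<circ> k') S"
  "ren_expr r k (ren_expr r' k' t) = ren_expr (r \<circ> r') (k \<circ> k') t"
  "ren_ctxt r k (ren_ctxt r' k' e) = ren_ctxt (r \<circ> r') (k \<circ> k') e"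
  "ren_cmd r k (ren_cmd r' k' c) = ren_cmd (r \<circ> r') (k \<circ> k') c"
  by (induction V and S and t and e and c arbitrary: r k r' k' and r k r' k' and r k r' k'
        and r k r' k' and r k r' k') (simp_all add: up_comp)

lemma liftv_val_simps [simp]:
  "liftv_val s 0 = Var 0" "liftv_val s (Suc n) = ren_val Suc id (s n)"
  by (simp_all add: liftv_val_def)

lemma liftk_stk_simps [simp]:
  "liftk_stk k 0 = Covar 0" "liftk_stk k (Suc n) = ren_stk id Suc (k n)"
  by (simp_all add: liftk_stk_def)

lemma liftk_val_apply [simp]: "liftk_val s n = ren_val id Suc (s n)"
  by (simp add: liftk_val_def)

lemma liftv_stk_apply [simp]: "liftv_stk k n = ren_stk Suc id (k n)"
  by (simp add: liftv_stk_def)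

lemma lift_up:
  "liftv_val s \<circ> up r = liftv_val (s \<circ> r)" "liftv_stk k \<circ> l = liftv_stk (k \<circ> l)"
  "liftk_val s \<circ> r = liftk_val (s \<circ> r)" "liftk_stk k \<circ> up l = liftk_stk (k \<circ> l)"
  by (auto simp: fun_eq_iff up_def split: nat.splits)

lemma sub_ren:
  "sub_val s k (ren_val r l V) = sub_val (s \<circ> r) (k \<circ> l) V"
  "sub_stk s k (ren_stk r l S) = sub_stk (s \<circ> r) (k \<circ> l) S"
  "sub_expr s k (ren_expr r l t) = sub_expr (s \<circ> r) (k \<circ> l) t"
  "sub_ctxt s k (ren_ctxt r l e) = sub_ctxt (s \<circ> r) (k \<circ> l) e"
  "sub_cmd s k (ren_cmd r l c) = sub_cmd (s \<circ> r) (k \<circ> l) c"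
  by (induction V and S and t and e and c arbitrary: s k r l and s k r l and s k r l
        and s k r l and s k r l) (simp_all add: lift_up)

lemma ren_lift:
  "ren_val (up r) l \<circ> liftv_val s = liftv_val (ren_val r l \<circ> s)"
  "ren_stk (up r) l \<circ> liftv_stk k = liftv_stk (ren_stk r l \<circ> k)"
  "ren_val r (up l) \<circ> liftk_val s = liftk_val (ren_val r l \<circ> s)"
  "ren_stk r (up l) \<circ> liftk_stk k = liftk_stk (ren_stk r l \<circ> k)"
proof -
  have *: "up r \<circ> Suc = Suc \<circ> r" for r by (auto simp: fun_eq_iff)
  show "ren_val (up r) l \<circ> liftv_val s = liftv_val (ren_val r l \<circ> s)"
    "ren_stk (up r) l \<circ> liftv_stk k = liftv_stk (ren_stk r l \<circ> k)"
    "ren_val r (up l) \<circ> liftk_val s = liftk_val (ren_val r l \<circ> s)"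
    "ren_stk r (up l) \<circ> liftk_stk k = liftk_stk (ren_stk r l \<circ> k)"
    by (auto simp: fun_eq_iff liftv_val_def liftk_stk_def ren_ren * split: nat.splits)
qed

lemma ren_sub:
  "ren_val r l (sub_val s k V) = sub_val (ren_val r l \<circ> s) (ren_stk r l \<circ> k) V"
  "ren_stk r l (sub_stk s k S) = sub_stk (ren_val r l \<circ> s) (ren_stk r l \<circ> k) S"
  "ren_expr r l (sub_expr s k t) = sub_expr (ren_val r l \<circ> s) (ren_stk r l \<circ> k) t"
  "ren_ctxt r l (sub_ctxt s k e) = sub_ctxt (ren_val r l \<circ> s) (ren_stk r l \<circ> k) e"
  "ren_cmd r l (sub_cmd s k c) = sub_cmd (ren_val r l \<circ> s) (ren_stk r l \<circ> k) c"
  by (induction V and S and t and e and c arbitrary: s k r l and s k r l and s k r l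
        and s k r l and s k r l) (simp_all add: ren_lift)

text \<open>A lifted entry is a weakened one, so moving a substitution past it takes the mixed laws
  \<open>sub_ren\<close> and \<open>ren_sub\<close>; this is why they precede
  \<open>sub_sub\<close>.\<close>

lemma sub_lift:
  "sub_val (liftv_val s) (liftv_stk k) \<circ> liftv_val s' = liftv_val (sub_val s k \<circ> s')"
  "sub_stk (liftv_val s) (liftv_stk k) \<circ> liftv_stk k' = liftv_stk (sub_stk s k \<circ> k')"
  "sub_val (liftk_val s) (liftk_stk k) \<circ> liftk_val s' = liftk_val (sub_val s k \<circ> s')"
  "sub_stk (liftk_val s) (liftk_stk k) \<circ> liftk_stk k' = liftk_stk (sub_stk s k \<circ> k')"
proof -
  have *: "liftv_val s \<circ> Suc = ren_val Suc id \<circ> s" "liftv_stk k \<circ> id = ren_stk Suc id \<circ> k"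
    "liftk_val s \<circ> id = ren_val id Suc \<circ> s" "liftk_stk k \<circ> Suc = ren_stk id Suc \<circ> k"
    by (auto simp: fun_eq_iff)
  show "sub_val (liftv_val s) (liftv_stk k) \<circ> liftv_val s' = liftv_val (sub_val s k \<circ> s')"
    "sub_stk (liftv_val s) (liftv_stk k) \<circ> liftv_stk k' = liftv_stk (sub_stk s k \<circ> k')"
    "sub_val (liftk_val s) (liftk_stk k) \<circ> liftk_val s' = liftk_val (sub_val s k \<circ> s')"
    "sub_stk (liftk_val s) (liftk_stk k) \<circ> liftk_stk k' = liftk_stk (sub_stk s k \<circ> k')"
    unfolding fun_eq_iff by (auto simp: liftv_val_def[of s'] liftk_stk_def[of k'] liftv_val_def[of "_ \<circ> _"]
        liftk_stk_def[of "_ \<circ> _"]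
        sub_ren ren_sub * simp del: id_apply comp_id split: nat.splits)
qed

lemma sub_sub:
  "sub_val s k (sub_val s' k' V) = sub_val (sub_val s k \<circ> s') (sub_stk s k \<circ> k') V"
  "sub_stk s k (sub_stk s' k' S) = sub_stk (sub_val s k \<circ> s') (sub_stk s k \<circ> k') S"
  "sub_expr s k (sub_expr s' k' t) = sub_expr (sub_val s k \<circ> s') (sub_stk s k \<circ> k') t"
  "sub_ctxt s k (sub_ctxt s' k' e) = sub_ctxt (sub_val s k \<circ> s') (sub_stk s k \<circ> k') e"
  "sub_cmd s k (sub_cmd s' k' c) = sub_cmd (sub_val s k \<circ> s') (sub_stk s k \<circ> k') c"
  by (induction V and S and t and e and c arbitrary: s k s' k' and s k s' k' and s k s' k'
        and s k s' k' and s k s' k') (simp_all add: sub_lift)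

lemma lift_Var_Covar:
  "liftv_val (Var \<circ> r) = Var \<circ> up r" "liftv_stk (Covar \<circ> l) = Covar \<circ> l"
  "liftk_val (Var \<circ> r) = Var \<circ> r" "liftk_stk (Covar \<circ> l) = Covar \<circ> up l"
  by (auto simp: fun_eq_iff liftv_val_def liftk_stk_def up_def split: nat.splits)

text \<open>Turns facts about substitutions into facts about renamings: \<open>ren_id\<close> and
  \<open>ty_ren_cong\<close> then need no induction of their own.\<close>

lemma ren_eq_sub:
  "ren_val r l V = sub_val (Var \<circ> r) (Covar \<circ> l) V"
  "ren_stk r l S = sub_stk (Var \<circ> r) (Covar \<circ> l) S"
  "ren_expr r l t = sub_expr (Var \<circ> r) (Covar \<circ> l) t"
  "ren_ctxt r l e = sub_ctxt (Var \<circ> r) (Covar \<circ> l) e"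
  "ren_cmd r l c = sub_cmd (Var \<circ> r) (Covar \<circ> l) c"
  by (induction V and S and t and e and c arbitrary: r l and r l and r l and r l and r l)
    (simp_all add: lift_Var_Covar)

lemma lift_ids [simp]:
  "liftv_val Var = Var" "liftv_stk Covar = Covar" "liftk_val Var = Var" "liftk_stk Covar = Covar"
  by (auto simp: fun_eq_iff liftv_val_def liftk_stk_def split: nat.splits)

lemma sub_id [simp]:
  "sub_val Var Covar V = V" "sub_stk Var Covar S = S" "sub_expr Var Covar t = t"
  "sub_ctxt Var Covar e = e" "sub_cmd Var Covar c = c"
  by (induction V and S and t and e and c) simp_all

lemma ren_id [simp]:
  "ren_val id id V = V" "ren_stk id id S = S" "ren_expr id id t = t"
  "ren_ctxt id id e = e" "ren_cmd id id c = c"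
  by (simp_all add: ren_eq_sub)

section \<open>Typing with explicit use of linear variables\<close>

text \<open>Linearity is enforced at the binder: unless \<open>A\<close> is of the form !B, the new
  index 0 enters the usage set, so the body has to use it.\<close>

definition bindu :: "ty \<Rightarrow> nat set \<Rightarrow> nat set" where
  "bindu A U = (if is_bang A then {} else {0}) \<union> Suc ` U"

text \<open>
  \<open>u_val \<Gamma> U V A\<close> types \<open>V\<close> in the whole context \<open>\<Gamma>\<close>, of which exactly the variables in \<open>U\<close> are
  used linearly; the variables of type \<open>!A\<close> are available everywhere. Contexts are therefore never
  split, and no structural rule is needed.
\<close>

inductive
      u_val :: "ty list \<Rightarrow> nat set \<Rightarrow> val \<Rightarrow> ty \<Rightarrow> bool"
  and u_stk :: "ty list \<Rightarrow> nat set \<Rightarrow> stk \<Rightarrow> ty \<Rightarrow> ty \<Rightarrow> bool"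
  and u_expr :: "ty list \<Rightarrow> nat set \<Rightarrow> expr \<Rightarrow> ty \<Rightarrow> bool"
  and u_ctxt :: "ty list \<Rightarrow> nat set \<Rightarrow> ctxt \<Rightarrow> ty \<Rightarrow> ty \<Rightarrow> bool"
  and u_cmd :: "ty list \<Rightarrow> nat set \<Rightarrow> cmd \<Rightarrow> ty \<Rightarrow> bool"
where
  u_Val: "u_val \<Gamma> U V A \<Longrightarrow> u_expr \<Gamma> U (Val V) A"
| u_Stk: "u_stk \<Gamma> U S A B \<Longrightarrow> u_ctxt \<Gamma> U (Stk S) A B"
| u_Var: "i < length \<Gamma> \<Longrightarrow> A = \<Gamma> ! i \<Longrightarrow> U = (if is_bang A then {} else {i}) \<Longrightarrow>
    u_val \<Gamma> U (Var i) A"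
| u_Covar: "u_stk \<Gamma> {} (Covar 0) A A"
| u_MtP: "u_cmd (A # \<Gamma>) (bindu A U) c B \<Longrightarrow> pol A = Pos \<Longrightarrow> u_stk \<Gamma> U (MtP c) A B"
| u_MtN: "u_cmd (A # \<Gamma>) (bindu A U) c B \<Longrightarrow> pol A = Neg \<Longrightarrow> u_ctxt \<Gamma> U (MtN c) A B"
| u_MuP: "u_cmd \<Gamma> U c A \<Longrightarrow> pol A = Pos \<Longrightarrow> u_expr \<Gamma> U (MuP c) A"
| u_MuN: "u_cmd \<Gamma> U c A \<Longrightarrow> pol A = Neg \<Longrightarrow> u_val \<Gamma> U (MuN c) A"
| u_CutP: "u_expr \<Gamma> U t A \<Longrightarrow> u_stk \<Gamma> U' S A B \<Longrightarrow> pol A = Pos \<Longrightarrow>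
    U \<inter> U' = {} \<Longrightarrow> W = U \<union> U' \<Longrightarrow> u_cmd \<Gamma> W (CutP t S) B"
| u_CutN: "u_val \<Gamma> U V A \<Longrightarrow> u_ctxt \<Gamma> U' e A B \<Longrightarrow> pol A = Neg \<Longrightarrow>
    U \<inter> U' = {} \<Longrightarrow> W = U \<union> U' \<Longrightarrow> u_cmd \<Gamma> W (CutN V e) B"
| u_Push: "u_val \<Gamma> U V A \<Longrightarrow> u_stk \<Gamma> U' S B C \<Longrightarrow>
    U \<inter> U' = {} \<Longrightarrow> W = U \<union> U' \<Longrightarrow> u_stk \<Gamma> W (Push V S) (TLolli A B) C"
| u_MuFun: "u_cmd (A # \<Gamma>) (bindu A U) c B \<Longrightarrow> u_val \<Gamma> U (MuFun c) (TLolli A B)"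
| u_VTensor: "u_val \<Gamma> U V A \<Longrightarrow> u_val \<Gamma> U' V' B \<Longrightarrow>
    U \<inter> U' = {} \<Longrightarrow> W = U \<union> U' \<Longrightarrow> u_val \<Gamma> W (VTensor V V') (TTensor A B)"
| u_MtTensor: "u_cmd (B # A # \<Gamma>) (bindu B (bindu A U)) c C \<Longrightarrow>
    u_stk \<Gamma> U (MtTensor c) (TTensor A B) C"
| u_MuWith: "u_cmd \<Gamma> U c A \<Longrightarrow> u_cmd \<Gamma> U d B \<Longrightarrow> u_val \<Gamma> U (MuWith c d) (TWith A B)"
| u_Pi1: "u_stk \<Gamma> U S A C \<Longrightarrow> u_stk \<Gamma> U (Pi1 S) (TWith A B) C"
| u_Pi2: "u_stk \<Gamma> U S B C \<Longrightarrow> u_stk \<Gamma> U (Pi2 S) (TWith A B) C"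
| u_MtPlus: "u_cmd (A # \<Gamma>) (bindu A U) c C \<Longrightarrow> u_cmd (B # \<Gamma>) (bindu B U) d C \<Longrightarrow>
    u_stk \<Gamma> U (MtPlus c d) (TPlus A B) C"
| u_In1: "u_val \<Gamma> U V A \<Longrightarrow> u_val \<Gamma> U (In1 V) (TPlus A B)"
| u_In2: "u_val \<Gamma> U V B \<Longrightarrow> u_val \<Gamma> U (In2 V) (TPlus A B)"
| u_VUnit: "u_val \<Gamma> {} VUnit TOne"
| u_MtUnit: "u_cmd \<Gamma> U c B \<Longrightarrow> u_stk \<Gamma> U (MtUnit c) TOne B"
| u_MuTop: "u_val \<Gamma> U V A \<Longrightarrow> u_val \<Gamma> U (MuTop V) TTop"
| u_MtZero: "u_stk \<Gamma> U S A B \<Longrightarrow> u_stk \<Gamma> U (MtZero S) TZero B"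
| u_MuBang: "u_cmd \<Gamma> {} c A \<Longrightarrow> u_val \<Gamma> {} (MuBang c) (TBang A)"
| u_SBang: "u_stk \<Gamma> U S A B \<Longrightarrow> u_stk \<Gamma> U (SBang S) (TBang A) B"
| u_VDia: "u_val \<Gamma> U V A \<Longrightarrow> u_val \<Gamma> U (VDia V) (TDia A)"
| u_MtDia: "u_cmd (A # \<Gamma>) (bindu A {}) c B \<Longrightarrow> is_dia B \<Longrightarrow>
    u_stk \<Gamma> {} (MtDia c) (TDia A) B"

lemmas u_intros = u_val_u_stk_u_expr_u_ctxt_u_cmd.intros

text \<open>The variables that a term with usage set \<open>U\<close> may mention: those of type !B
  can occur without being recorded in \<open>U\<close>.\<close>

definition avail :: "ty list \<Rightarrow> nat set \<Rightarrow> nat set" where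
  "avail \<Gamma> U = U \<union> {i. i < length \<Gamma> \<and> is_bang (\<Gamma> ! i)}"

definition lin :: "ty list \<Rightarrow> nat set" where
  "lin \<Gamma> = {i. i < length \<Gamma> \<and> \<not> is_bang (\<Gamma> ! i)}"

lemma lin_Nil [simp]: "lin [] = {}"
  by (simp add: lin_def)

lemma lin_Cons [simp]: "lin (A # \<Gamma>) = bindu A (lin \<Gamma>)"
  by (auto simp: lin_def bindu_def less_Suc_eq_0_disj)

lemma lin_append: "lin (\<Gamma>' @ \<Gamma>) = lin \<Gamma>' \<union> (\<lambda>i. i + length \<Gamma>') ` lin \<Gamma>"
proof (induction \<Gamma>')
  case (Cons A \<Gamma>')
  then show ?case by (simp add: bindu_def image_Un image_image Un_assoc)
qed simp

lemma avail_bindu [simp]: "avail (A # \<Gamma>) (bindu A U) = insert 0 (Suc ` avail \<Gamma> U)"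
  by (auto simp: avail_def bindu_def less_Suc_eq_0_disj)

lemma avail_Un: "avail \<Gamma> (U \<union> U') = avail \<Gamma> U \<union> avail \<Gamma> U'"
  by (auto simp: avail_def)

lemma avail_lin: "avail \<Gamma> (lin \<Gamma>) = {..<length \<Gamma>}"
  by (auto simp: avail_def lin_def)

lemma bindu_subset_lin: "bindu A U \<subseteq> lin (A # \<Gamma>) \<longleftrightarrow> U \<subseteq> lin \<Gamma>"
  by (auto simp: bindu_def)

lemma u_subset_lin:
  "u_val \<Gamma> U V A \<Longrightarrow> U \<subseteq> lin \<Gamma>"
  "u_stk \<Gamma> U S A B \<Longrightarrow> U \<subseteq> lin \<Gamma>"
  "u_expr \<Gamma> U t A \<Longrightarrow> U \<subseteq> lin \<Gamma>"
  "u_ctxt \<Gamma> U e A B \<Longrightarrow> U \<subseteq> lin \<Gamma>"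
  "u_cmd \<Gamma> U c B \<Longrightarrow> U \<subseteq> lin \<Gamma>"
proof (induction rule: u_val_u_stk_u_expr_u_ctxt_u_cmd.inducts)
  case (u_Var i \<Gamma> A U)
  then show ?case by (auto simp: lin_def)
qed (auto simp: bindu_subset_lin simp del: lin_Cons)

text \<open>Only available variables and co-variable 0 can be free. In values and expressions even
  that co-variable is bound, so their clauses leave \<open>k\<close> and \<open>k'\<close>
  unrelated.\<close>

lemma u_ext:
  "u_val \<Gamma> U V A \<Longrightarrow> \<forall>i\<in>avail \<Gamma> U. s i = s' i \<Longrightarrow> sub_val s k V = sub_val s' k' V"
  "u_stk \<Gamma> U S A B \<Longrightarrow> \<forall>i\<in>avail \<Gamma> U. s i = s' i \<Longrightarrow> k 0 = k' 0 \<Longrightarrow>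
    sub_stk s k S = sub_stk s' k' S"
  "u_expr \<Gamma> U t A \<Longrightarrow> \<forall>i\<in>avail \<Gamma> U. s i = s' i \<Longrightarrow> sub_expr s k t = sub_expr s' k' t"
  "u_ctxt \<Gamma> U e A B \<Longrightarrow> \<forall>i\<in>avail \<Gamma> U. s i = s' i \<Longrightarrow> k 0 = k' 0 \<Longrightarrow>
    sub_ctxt s k e = sub_ctxt s' k' e"
  "u_cmd \<Gamma> U c B \<Longrightarrow> \<forall>i\<in>avail \<Gamma> U. s i = s' i \<Longrightarrow> k 0 = k' 0 \<Longrightarrow>
    sub_cmd s k c = sub_cmd s' k' c"
proof (induction arbitrary: s s' k k' and s s' k k' and s s' k k' and s s' k k' and s s' k k'
    rule: u_val_u_stk_u_expr_u_ctxt_u_cmd.inducts)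
  case (u_Var i \<Gamma> A U)
  then show ?case by (auto simp: avail_def split: if_splits)
next
  case (u_MtTensor B A \<Gamma> U c C)
  show ?case using u_MtTensor.prems by (auto intro!: u_MtTensor.IH)
qed (simp_all add: avail_Un ball_Un)

text \<open>
  The next two lemmas make the side conditions of \<open>\<mu>!\<alpha>.c\<close> and of \<open>\<mu>\<^sup>~\<diamond>x.c\<close> stable under substitution.
\<close>

lemma u_val_bang:
  assumes "u_val \<Gamma> U V A" "is_bang A" shows "U = {}"
  using assms by (cases rule: u_val.cases) (auto simp: is_bang_def)

lemma u_stk_dia:
  assumes "u_stk \<Gamma> U S A B" "is_dia A" shows "U = {}" "is_dia B"
  using assms by (cases rule: u_stk.cases; auto simp: is_dia_def)+

lemma bindu_Int: "bindu A U \<inter> Suc ` U' = Suc ` (U \<inter> U')"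
  by (auto simp: bindu_def)

section \<open>Renaming in the system with usage sets\<close>

text \<open>Injectivity is demanded only on linearly used variables, so variables of type !B may be
  contracted. Surjectivity is not demanded, since the renamed term gets the image of
  \<open>U\<close> as its usage set.\<close>

definition ren_ok :: "ty list \<Rightarrow> nat set \<Rightarrow> (nat \<Rightarrow> nat) \<Rightarrow> ty list \<Rightarrow> bool" where
  "ren_ok \<Gamma> U r \<Gamma>' \<longleftrightarrow>
     (\<forall>i\<in>avail \<Gamma> U. r i < length \<Gamma>' \<and> \<Gamma>' ! r i = \<Gamma> ! i) \<and> inj_on r U"

lemma ren_ok_up: "ren_ok \<Gamma> U r \<Gamma>' \<Longrightarrow> ren_ok (A # \<Gamma>) (bindu A U) (up r) (A # \<Gamma>')"
  unfolding ren_ok_def avail_bindu by (auto simp: bindu_def inj_on_def)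

lemma ren_ok_Un:
  assumes "ren_ok \<Gamma> (U \<union> U') r \<Gamma>'"
  shows "ren_ok \<Gamma> U r \<Gamma>'" "ren_ok \<Gamma> U' r \<Gamma>'" "U \<inter> U' = {} \<Longrightarrow> r ` U \<inter> r ` U' = {}"
  using assms unfolding ren_ok_def avail_Un inj_on_def by (blast, blast, blast)

lemma up_image_bindu: "up r ` bindu A U = bindu A (r ` U)"
  by (auto simp: bindu_def image_Un image_image)

text \<open>The condition \<open>l 0 = 0\<close> fixes the only free co-variable of a stack, context
  or command. Disjoint usage sets in a binary rule stay disjoint by injectivity on their
  union.\<close>

lemma u_ren:
  "u_val \<Gamma> U V A \<Longrightarrow> ren_ok \<Gamma> U r \<Gamma>' \<Longrightarrow> u_val \<Gamma>' (r ` U) (ren_val r l V) A"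
  "u_stk \<Gamma> U S A B \<Longrightarrow> ren_ok \<Gamma> U r \<Gamma>' \<Longrightarrow> l 0 = 0 \<Longrightarrow> u_stk \<Gamma>' (r ` U) (ren_stk r l S) A B"
  "u_expr \<Gamma> U t A \<Longrightarrow> ren_ok \<Gamma> U r \<Gamma>' \<Longrightarrow> u_expr \<Gamma>' (r ` U) (ren_expr r l t) A"
  "u_ctxt \<Gamma> U e A B \<Longrightarrow> ren_ok \<Gamma> U r \<Gamma>' \<Longrightarrow> l 0 = 0 \<Longrightarrow> u_ctxt \<Gamma>' (r ` U) (ren_ctxt r l e) A B"
  "u_cmd \<Gamma> U c B \<Longrightarrow> ren_ok \<Gamma> U r \<Gamma>' \<Longrightarrow> l 0 = 0 \<Longrightarrow> u_cmd \<Gamma>' (r ` U) (ren_cmd r l c) B"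
proof (induction arbitrary: r l \<Gamma>' and r l \<Gamma>' and r l \<Gamma>' and r l \<Gamma>' and r l \<Gamma>'
    rule: u_val_u_stk_u_expr_u_ctxt_u_cmd.inducts)
  case (u_Var i \<Gamma> A U)
  then show ?case
    by (auto intro!: u_intros simp: ren_ok_def avail_def)
next
  case (u_CutP \<Gamma> U t A U' S B W)
  show ?case using u_CutP.hyps u_CutP.prems
    by (auto intro!: u_val_u_stk_u_expr_u_ctxt_u_cmd.u_CutP[where A = A] u_CutP.IH dest: ren_ok_Un simp: image_Un)
next
  case (u_CutN \<Gamma> U t A U' S B W)
  show ?case using u_CutN.hyps u_CutN.prems
    by (auto intro!: u_val_u_stk_u_expr_u_ctxt_u_cmd.u_CutN[where A = A] u_CutN.IH dest: ren_ok_Un simp: image_Un)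
next
  case (u_Push \<Gamma> U t A U' S B C W)
  show ?case using u_Push.hyps u_Push.prems
    by (auto intro!: u_val_u_stk_u_expr_u_ctxt_u_cmd.u_Push u_Push.IH dest: ren_ok_Un simp: image_Un)
next
  case (u_VTensor \<Gamma> U t A U' S B W)
  show ?case using u_VTensor.hyps u_VTensor.prems
    by (auto intro!: u_val_u_stk_u_expr_u_ctxt_u_cmd.u_VTensor u_VTensor.IH dest: ren_ok_Un simp: image_Un)
next
  case (u_MtDia A \<Gamma> c B)
  have "u_cmd (A # \<Gamma>') (up r ` bindu A {}) (ren_cmd (up r) l c) B"
    by (intro u_MtDia.IH ren_ok_up u_MtDia.prems)
  then show ?case
    using u_MtDia.hyps
    by (auto intro!: u_val_u_stk_u_expr_u_ctxt_u_cmd.u_MtDia simp: up_image_bindu)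
next
  case (u_MuBang \<Gamma> c A)
  have "u_cmd \<Gamma>' (r ` {}) (ren_cmd r (up l) c) A"
    by (intro u_MuBang.IH u_MuBang.prems) simp
  then show ?case
    by (auto intro!: u_val_u_stk_u_expr_u_ctxt_u_cmd.u_MuBang)
next
  case (u_MtP A \<Gamma> U c B)
  show ?case using u_MtP.hyps u_MtP.prems u_MtP.IH[OF ren_ok_up[OF u_MtP.prems(1)]]
    by (auto intro!: u_val_u_stk_u_expr_u_ctxt_u_cmd.u_MtP simp: up_image_bindu)
next
  case (u_MtN A \<Gamma> U c B)
  show ?case using u_MtN.hyps u_MtN.prems u_MtN.IH[OF ren_ok_up[OF u_MtN.prems(1)]]
    by (auto intro!: u_val_u_stk_u_expr_u_ctxt_u_cmd.u_MtN simp: up_image_bindu)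
next
  case (u_MuFun A \<Gamma> U c B)
  show ?case using u_MuFun.IH[OF ren_ok_up[OF u_MuFun.prems(1)]]
    by (auto intro!: u_val_u_stk_u_expr_u_ctxt_u_cmd.u_MuFun simp: up_image_bindu)
next
  case (u_MtTensor B A \<Gamma> U c C)
  show ?case
    using u_MtTensor.prems u_MtTensor.IH[OF ren_ok_up[OF ren_ok_up[OF u_MtTensor.prems(1)]]]
    by (auto intro!: u_val_u_stk_u_expr_u_ctxt_u_cmd.u_MtTensor simp: up_image_bindu)
next
  case (u_MtPlus A \<Gamma> U c C B d)
  show ?case
    using u_MtPlus.prems u_MtPlus.IH(1)[OF ren_ok_up[OF u_MtPlus.prems(1)]]
      u_MtPlus.IH(2)[OF ren_ok_up[OF u_MtPlus.prems(1)]]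
    by (auto intro!: u_val_u_stk_u_expr_u_ctxt_u_cmd.u_MtPlus simp: up_image_bindu)
qed (auto intro!: u_intros)

section \<open>Substitution in the system with usage sets\<close>

text \<open>\<open>W i\<close> is the usage set of the value put for variable \<open>i\<close>.
  Disjointness is asked only between linear variables, because a value put for a variable of type !B
  has empty usage by \<open>u_val_bang\<close>.\<close>

definition sub_ok :: "ty list \<Rightarrow> nat set \<Rightarrow> (nat \<Rightarrow> val) \<Rightarrow> (nat \<Rightarrow> nat set) \<Rightarrow> ty list \<Rightarrow> bool" where
  "sub_ok \<Gamma> U s W \<Gamma>' \<longleftrightarrow> (\<forall>i\<in>avail \<Gamma> U. u_val \<Gamma>' (W i) (s i) (\<Gamma> ! i)) \<and>
     (\<forall>i\<in>U. \<forall>j\<in>U. i \<noteq> j \<longrightarrow> W i \<inter> W j = {})"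

definition liftu :: "ty \<Rightarrow> (nat \<Rightarrow> nat set) \<Rightarrow> nat \<Rightarrow> nat set" where
  "liftu A W = case_nat (if is_bang A then {} else {0}) (\<lambda>i. Suc ` W i)"

lemma u_wk:
  "u_val \<Gamma> U V B \<Longrightarrow> u_val (A # \<Gamma>) (Suc ` U) (ren_val Suc l V) B"
  "u_stk \<Gamma> U S B C \<Longrightarrow> l 0 = 0 \<Longrightarrow> u_stk (A # \<Gamma>) (Suc ` U) (ren_stk Suc l S) B C"
  by (rule u_ren; auto simp: ren_ok_def avail_def lin_def dest!: u_subset_lin)+

lemma u_ren_covar:
  "u_val \<Gamma> U V B \<Longrightarrow> u_val \<Gamma> U (ren_val id l V) B"
  using u_ren(1)[of \<Gamma> U V B id \<Gamma> l] u_subset_lin(1)[of \<Gamma> U V B]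
  by (auto simp: ren_ok_def avail_def lin_def)

lemma sub_ok_liftv:
  assumes "sub_ok \<Gamma> U s W \<Gamma>'"
  shows "sub_ok (A # \<Gamma>) (bindu A U) (liftv_val s) (liftu A W) (A # \<Gamma>')"
proof -
  have "u_val (A # \<Gamma>') (if is_bang A then {} else {0}) (Var 0) A"
    by (rule u_Var) auto
  then show ?thesis
    using assms unfolding sub_ok_def avail_bindu
    by (auto simp: liftu_def bindu_def intro: u_wk split: if_splits)
qed

lemma sub_ok_liftk: "sub_ok \<Gamma> U s W \<Gamma>' \<Longrightarrow> sub_ok \<Gamma> U (liftk_val s) W \<Gamma>'"
  by (auto simp: sub_ok_def intro: u_ren_covar)

lemma UN_liftu: "(\<Union>i\<in>bindu A U. liftu A W i) = bindu A (\<Union>i\<in>U. W i)"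
  by (auto simp: bindu_def liftu_def)

lemma bindu_Un: "bindu A (U \<union> U') = bindu A U \<union> Suc ` U'"
  by (auto simp: bindu_def)

lemma sub_ok_Un:
  assumes "sub_ok \<Gamma> (U \<union> U') s W \<Gamma>'"
  shows "sub_ok \<Gamma> U s W \<Gamma>'" "sub_ok \<Gamma> U' s W \<Gamma>'"
    "U \<inter> U' = {} \<Longrightarrow> (\<Union>i\<in>U. W i) \<inter> (\<Union>i\<in>U'. W i) = {}"
proof -
  show "sub_ok \<Gamma> U s W \<Gamma>'" "sub_ok \<Gamma> U' s W \<Gamma>'"
    using assms unfolding sub_ok_def avail_Un by blast+
  show "(\<Union>i\<in>U. W i) \<inter> (\<Union>i\<in>U'. W i) = {}" if "U \<inter> U' = {}"
    using assms that unfolding sub_ok_def by (simp add: disjoint_iff) (metis UnI1 UnI2)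
qed

text \<open>The stack \<open>k 0\<close> brings its own usage set \<open>X\<close> and changes the
  type on the right from \<open>B\<close> to \<open>C\<close>. Under a \<mu> the lifted stack is
  \<open>Covar 0\<close> with empty usage, so values and expressions put no condition on
  \<open>k\<close>.\<close>

lemma u_sub:
  "u_val \<Gamma> U V A \<Longrightarrow> sub_ok \<Gamma> U s W \<Gamma>' \<Longrightarrow> u_val \<Gamma>' (\<Union>i\<in>U. W i) (sub_val s k V) A"
  "u_stk \<Gamma> U S A B \<Longrightarrow> sub_ok \<Gamma> U s W \<Gamma>' \<Longrightarrow> u_stk \<Gamma>' X (k 0) B C \<Longrightarrow>
    (\<Union>i\<in>U. W i) \<inter> X = {} \<Longrightarrow> u_stk \<Gamma>' ((\<Union>i\<in>U. W i) \<union> X) (sub_stk s k S) A C"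
  "u_expr \<Gamma> U t A \<Longrightarrow> sub_ok \<Gamma> U s W \<Gamma>' \<Longrightarrow> u_expr \<Gamma>' (\<Union>i\<in>U. W i) (sub_expr s k t) A"
  "u_ctxt \<Gamma> U e A B \<Longrightarrow> sub_ok \<Gamma> U s W \<Gamma>' \<Longrightarrow> u_stk \<Gamma>' X (k 0) B C \<Longrightarrow>
    (\<Union>i\<in>U. W i) \<inter> X = {} \<Longrightarrow> u_ctxt \<Gamma>' ((\<Union>i\<in>U. W i) \<union> X) (sub_ctxt s k e) A C"
  "u_cmd \<Gamma> U c B \<Longrightarrow> sub_ok \<Gamma> U s W \<Gamma>' \<Longrightarrow> u_stk \<Gamma>' X (k 0) B C \<Longrightarrow>
    (\<Union>i\<in>U. W i) \<inter> X = {} \<Longrightarrow> u_cmd \<Gamma>' ((\<Union>i\<in>U. W i) \<union> X) (sub_cmd s k c) C"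
proof (induction arbitrary: s k W \<Gamma>' and s k W \<Gamma>' X C and s k W \<Gamma>' and s k W \<Gamma>' X C
    and s k W \<Gamma>' X C rule: u_val_u_stk_u_expr_u_ctxt_u_cmd.inducts)
  case (u_Var i \<Gamma> A U)
  then have *: "u_val \<Gamma>' (W i) (s i) A"
    by (auto simp: sub_ok_def avail_def split: if_splits)
  then show ?case
    \<comment> \<open>If \<open>A\<close> is of the form !B, then \<open>U\<close> is empty, and
      \<open>W i\<close> must be empty too, as a value of such a type uses no linear
      variable.\<close>
    using u_Var u_val_bang[OF *] * by (cases "is_bang A") auto
next
  case (u_CutP \<Gamma> U t A U' S B Y)
  have ok: "sub_ok \<Gamma> (U \<union> U') s W \<Gamma>'"
    using u_CutP by simp
  show ?case unfolding sub_cmd.simps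
  proof (rule u_val_u_stk_u_expr_u_ctxt_u_cmd.u_CutP)
    show "u_expr \<Gamma>' (\<Union>i\<in>U. W i) (sub_expr s k t) A"
      by (intro u_CutP.IH sub_ok_Un[OF ok])
    show "u_stk \<Gamma>' ((\<Union>i\<in>U'. W i) \<union> X) (sub_stk s k S) A C"
      using u_CutP by (intro u_CutP.IH sub_ok_Un[OF ok]) auto
    show "(\<Union>i\<in>U. W i) \<inter> ((\<Union>i\<in>U'. W i) \<union> X) = {}"
      using u_CutP sub_ok_Un[OF ok] by auto
  qed (use u_CutP in auto)
next
  case (u_CutN \<Gamma> U t A U' S B Y)
  have ok: "sub_ok \<Gamma> (U \<union> U') s W \<Gamma>'"
    using u_CutN by simp
  show ?case unfolding sub_cmd.simps
  proof (rule u_val_u_stk_u_expr_u_ctxt_u_cmd.u_CutN)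
    show "u_val \<Gamma>' (\<Union>i\<in>U. W i) (sub_val s k t) A"
      by (intro u_CutN.IH sub_ok_Un[OF ok])
    show "u_ctxt \<Gamma>' ((\<Union>i\<in>U'. W i) \<union> X) (sub_ctxt s k S) A C"
      using u_CutN by (intro u_CutN.IH sub_ok_Un[OF ok]) auto
    show "(\<Union>i\<in>U. W i) \<inter> ((\<Union>i\<in>U'. W i) \<union> X) = {}"
      using u_CutN sub_ok_Un[OF ok] by auto
  qed (use u_CutN in auto)
next
  case (u_Push \<Gamma> U t A U' S B D Y)
  have ok: "sub_ok \<Gamma> (U \<union> U') s W \<Gamma>'"
    using u_Push by simp
  show ?case unfolding sub_stk.simps
  proof (rule u_val_u_stk_u_expr_u_ctxt_u_cmd.u_Push)
    show "u_val \<Gamma>' (\<Union>i\<in>U. W i) (sub_val s k t) A"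
      by (intro u_Push.IH sub_ok_Un[OF ok])
    show "u_stk \<Gamma>' ((\<Union>i\<in>U'. W i) \<union> X) (sub_stk s k S) B C"
      using u_Push by (intro u_Push.IH sub_ok_Un[OF ok]) auto
    show "(\<Union>i\<in>U. W i) \<inter> ((\<Union>i\<in>U'. W i) \<union> X) = {}"
      using u_Push sub_ok_Un[OF ok] by auto
  qed (use u_Push in auto)
next
  case (u_VTensor \<Gamma> U t A U' S B Y)
  have ok: "sub_ok \<Gamma> (U \<union> U') s W \<Gamma>'"
    using u_VTensor by simp
  show ?case unfolding sub_val.simps
  proof (rule u_val_u_stk_u_expr_u_ctxt_u_cmd.u_VTensor)
    show "u_val \<Gamma>' (\<Union>i\<in>U. W i) (sub_val s k t) A" "u_val \<Gamma>' (\<Union>i\<in>U'. W i) (sub_val s k S) B"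
      by (intro u_VTensor.IH sub_ok_Un[OF ok])+
    show "(\<Union>i\<in>U. W i) \<inter> (\<Union>i\<in>U'. W i) = {}"
      using u_VTensor sub_ok_Un[OF ok] by auto
  qed (use u_VTensor in auto)
next
  case (u_MtP A \<Gamma> U c B)
  have "u_cmd (A # \<Gamma>') ((\<Union>i\<in>bindu A U. liftu A W i) \<union> Suc ` X)
    (sub_cmd (liftv_val s) (liftv_stk k) c) C"
    using u_MtP by (intro u_MtP.IH sub_ok_liftv) (auto simp: UN_liftu bindu_Int intro: u_wk)
  then show ?case
    using u_MtP.hyps
    by (auto intro!: u_val_u_stk_u_expr_u_ctxt_u_cmd.u_MtP simp: UN_liftu bindu_Un)
next
  case (u_MtN A \<Gamma> U c B)
  have "u_cmd (A # \<Gamma>') ((\<Union>i\<in>bindu A U. liftu A W i) \<union> Suc ` X)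
    (sub_cmd (liftv_val s) (liftv_stk k) c) C"
    using u_MtN by (intro u_MtN.IH sub_ok_liftv) (auto simp: UN_liftu bindu_Int intro: u_wk)
  then show ?case
    using u_MtN.hyps
    by (auto intro!: u_val_u_stk_u_expr_u_ctxt_u_cmd.u_MtN simp: UN_liftu bindu_Un)
next
  case (u_MtPlus A \<Gamma> U c D B d)
  have "u_cmd (A # \<Gamma>') ((\<Union>i\<in>bindu A U. liftu A W i) \<union> Suc ` X)
    (sub_cmd (liftv_val s) (liftv_stk k) c) C"
    using u_MtPlus by (intro u_MtPlus.IH sub_ok_liftv) (auto simp: UN_liftu bindu_Int intro: u_wk)
  moreover have "u_cmd (B # \<Gamma>') ((\<Union>i\<in>bindu B U. liftu B W i) \<union> Suc ` X)
    (sub_cmd (liftv_val s) (liftv_stk k) d) C"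
    using u_MtPlus by (intro u_MtPlus.IH sub_ok_liftv) (auto simp: UN_liftu bindu_Int intro: u_wk)
  ultimately show ?case
    by (auto intro!: u_val_u_stk_u_expr_u_ctxt_u_cmd.u_MtPlus simp: UN_liftu bindu_Un)
next
  case (u_MtTensor B A \<Gamma> U c D)
  have "u_cmd (B # A # \<Gamma>')
    ((\<Union>i\<in>bindu B (bindu A U). liftu B (liftu A W) i) \<union> Suc ` Suc ` X)
    (sub_cmd (liftv_val (liftv_val s)) (liftv_stk (liftv_stk k)) c) C"
    using u_MtTensor
    by (intro u_MtTensor.IH sub_ok_liftv) (auto simp: UN_liftu bindu_Int intro!: u_wk simp del: image_image)
  then show ?case
    by (auto intro!: u_val_u_stk_u_expr_u_ctxt_u_cmd.u_MtTensor simp: UN_liftu bindu_Un)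
next
  case (u_MtDia A \<Gamma> c B)
  \<comment> \<open>The stack put for the co-variable consumes a type of the form \<diamond>D, so it
    uses no linear variable and its type on the right has this form again: the side conditions of
    the rule survive.\<close>
  have X: "X = {}" "is_dia C"
    using u_MtDia.hyps u_MtDia.prems u_stk_dia by auto
  have "u_cmd (A # \<Gamma>') ((\<Union>i\<in>bindu A {}. liftu A W i) \<union> Suc ` X)
    (sub_cmd (liftv_val s) (liftv_stk k) c) C"
    using u_MtDia by (intro u_MtDia.IH sub_ok_liftv) (auto simp: UN_liftu bindu_Int intro: u_wk)
  then show ?case
    using X by (auto intro!: u_val_u_stk_u_expr_u_ctxt_u_cmd.u_MtDia simp: UN_liftu)
next
  case (u_MuFun A \<Gamma> U c B)
  have "u_cmd (A # \<Gamma>') ((\<Union>i\<in>bindu A U. liftu A W i) \<union> {})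
    (sub_cmd (liftk_val (liftv_val s)) (liftk_stk (liftv_stk k)) c) B"
    using u_MuFun by (intro u_MuFun.IH sub_ok_liftk sub_ok_liftv) (auto intro: u_Covar)
  then show ?case
    by (auto intro!: u_val_u_stk_u_expr_u_ctxt_u_cmd.u_MuFun simp: UN_liftu)
next
  case (u_MuP \<Gamma> U c A)
  have "u_cmd \<Gamma>' ((\<Union>i\<in>U. W i) \<union> {}) (sub_cmd (liftk_val s) (liftk_stk k) c) A"
    using u_MuP by (intro u_MuP.IH sub_ok_liftk) (auto intro: u_Covar)
  then show ?case
    using u_MuP.hyps by (auto intro!: u_val_u_stk_u_expr_u_ctxt_u_cmd.u_MuP)
next
  case (u_MuN \<Gamma> U c A)
  have "u_cmd \<Gamma>' ((\<Union>i\<in>U. W i) \<union> {}) (sub_cmd (liftk_val s) (liftk_stk k) c) A"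
    using u_MuN by (intro u_MuN.IH sub_ok_liftk) (auto intro: u_Covar)
  then show ?case
    using u_MuN.hyps by (auto intro!: u_val_u_stk_u_expr_u_ctxt_u_cmd.u_MuN)
next
  case (u_MuBang \<Gamma> c A)
  have "u_cmd \<Gamma>' ((\<Union>i\<in>{}. W i) \<union> {}) (sub_cmd (liftk_val s) (liftk_stk k) c) A"
    using u_MuBang by (intro u_MuBang.IH sub_ok_liftk) (auto intro: u_Covar)
  then show ?case
    by (auto intro!: u_val_u_stk_u_expr_u_ctxt_u_cmd.u_MuBang)
next
  case (u_MuWith \<Gamma> U c A d B)
  have "u_cmd \<Gamma>' ((\<Union>i\<in>U. W i) \<union> {}) (sub_cmd (liftk_val s) (liftk_stk k) c) A"
    "u_cmd \<Gamma>' ((\<Union>i\<in>U. W i) \<union> {}) (sub_cmd (liftk_val s) (liftk_stk k) d) B"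
    using u_MuWith by (intro u_MuWith.IH sub_ok_liftk; auto intro: u_Covar)+
  then show ?case
    by (auto intro!: u_val_u_stk_u_expr_u_ctxt_u_cmd.u_MuWith)
next
  case (u_Covar \<Gamma> A)
  then show ?case by simp
next
  case (u_VUnit \<Gamma>)
  show ?case using u_val_u_stk_u_expr_u_ctxt_u_cmd.u_VUnit by simp
qed (auto intro!: u_intros)

section \<open>Equivalence of the two type systems\<close>

lemma structural_ren_ok:
  assumes "structural \<Gamma> \<sigma> \<Gamma>'"
  shows "ren_ok \<Gamma> (lin \<Gamma>) \<sigma> \<Gamma>'" "\<sigma> ` lin \<Gamma> = lin \<Gamma>'"
  using assms unfolding structural_def ren_ok_def avail_lin lin_def[symmetric]
  by (auto simp: bij_betw_def)

lemma ren_ok_shift: "ren_ok \<Gamma> (lin \<Gamma>) (\<lambda>i. i + length \<Gamma>') (\<Gamma>' @ \<Gamma>)"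
  by (auto simp: ren_ok_def avail_lin inj_on_def nth_append)

lemma ren_ok_append: "ren_ok \<Gamma>' (lin \<Gamma>') id (\<Gamma>' @ \<Gamma>)"
  by (auto simp: ren_ok_def avail_lin nth_append)

lemma lin_append_disjoint: "(\<lambda>i. i + length \<Gamma>') ` lin \<Gamma> \<inter> lin \<Gamma>' = {}"
  by (auto simp: lin_def)

lemma lin_bang: "\<forall>G\<in>set \<Gamma>. is_bang G \<Longrightarrow> lin \<Gamma> = {}"
  by (auto simp: lin_def)

text \<open>Both halves of a split context are renamed into the whole one, \<Gamma> by the shift and
  \<Gamma>' by the identity; their separate index ranges make the usage sets disjoint.\<close>

lemma ty_imp_u:
  "ty_val \<Gamma> V A \<Longrightarrow> u_val \<Gamma> (lin \<Gamma>) V A"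
  "ty_stk \<Gamma> S A B \<Longrightarrow> u_stk \<Gamma> (lin \<Gamma>) S A B"
  "ty_expr \<Gamma> t A \<Longrightarrow> u_expr \<Gamma> (lin \<Gamma>) t A"
  "ty_ctxt \<Gamma> e A B \<Longrightarrow> u_ctxt \<Gamma> (lin \<Gamma>) e A B"
  "ty_cmd \<Gamma> c B \<Longrightarrow> u_cmd \<Gamma> (lin \<Gamma>) c B"
proof (induction rule: ty_val_ty_stk_ty_expr_ty_ctxt_ty_cmd.inducts)
  case (ty_CutP \<Gamma> t A \<Gamma>' S B)
  show ?case
    using u_CutP[OF u_ren(3)[OF ty_CutP.IH(1) ren_ok_shift]
        u_ren(2)[OF ty_CutP.IH(2) ren_ok_append, where l = id, simplified]
        ty_CutP.hyps(3) lin_append_disjoint refl]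
    by (simp add: lin_append Un_commute)
next
  case (ty_CutN \<Gamma> V A \<Gamma>' e B)
  show ?case
    using u_CutN[OF u_ren(1)[OF ty_CutN.IH(1) ren_ok_shift]
        u_ren(4)[OF ty_CutN.IH(2) ren_ok_append, where l = id, simplified]
        ty_CutN.hyps(3) lin_append_disjoint refl]
    by (simp add: lin_append Un_commute)
next
  case (ty_Push \<Gamma> V A \<Gamma>' S B C)
  show ?case
    using u_Push[OF u_ren(1)[OF ty_Push.IH(1) ren_ok_shift]
        u_ren(2)[OF ty_Push.IH(2) ren_ok_append, where l = id, simplified]
        lin_append_disjoint refl]
    by (simp add: lin_append Un_commute)
next
  case (ty_VTensor \<Gamma> V A \<Gamma>' W B)
  show ?case
    using u_VTensor[OF u_ren(1)[OF ty_VTensor.IH(1) ren_ok_shift]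
        u_ren(1)[OF ty_VTensor.IH(2) ren_ok_append, where l = id, simplified]
        lin_append_disjoint refl]
    by (simp add: lin_append Un_commute)
next
  case (ty_struct_val \<Gamma> V A \<sigma> \<Gamma>')
  then show ?case using u_ren(1)[OF _ structural_ren_ok(1)] structural_ren_ok(2) by metis
next
  case (ty_struct_stk \<Gamma> S A B \<sigma> \<Gamma>')
  then show ?case using u_ren(2)[OF _ structural_ren_ok(1), of _ _ _ _ _ _ id] structural_ren_ok(2)
    by (metis id_apply)
next
  case (ty_struct_expr \<Gamma> t A \<sigma> \<Gamma>')
  then show ?case using u_ren(3)[OF _ structural_ren_ok(1)] structural_ren_ok(2) by metis
next
  case (ty_struct_ctxt \<Gamma> e A B \<sigma> \<Gamma>')
  then show ?case using u_ren(4)[OF _ structural_ren_ok(1), of _ _ _ _ _ _ id] structural_ren_ok(2)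
    by (metis id_apply)
next
  case (ty_struct_cmd \<Gamma> c B \<sigma> \<Gamma>')
  then show ?case using u_ren(5)[OF _ structural_ren_ok(1), of _ _ _ _ _ id] structural_ren_ok(2)
    by (metis id_apply)
next
  case (ty_Var A)
  then show ?case by (auto intro!: u_Var simp: bindu_def)
qed (auto intro!: u_intros simp: lin_bang)

lemma ty_ren_cong:
  "ty_val \<Gamma> V A \<Longrightarrow> \<forall>j<length \<Gamma>. r j = r' j \<Longrightarrow> ren_val r l V = ren_val r' l' V"
  "ty_stk \<Gamma> S A B \<Longrightarrow> \<forall>j<length \<Gamma>. r j = r' j \<Longrightarrow> l 0 = l' 0 \<Longrightarrow> ren_stk r l S = ren_stk r' l' S"
  "ty_expr \<Gamma> t A \<Longrightarrow> \<forall>j<length \<Gamma>. r j = r' j \<Longrightarrow> ren_expr r l t = ren_expr r' l' t"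
  "ty_ctxt \<Gamma> e A B \<Longrightarrow> \<forall>j<length \<Gamma>. r j = r' j \<Longrightarrow> l 0 = l' 0 \<Longrightarrow>
    ren_ctxt r l e = ren_ctxt r' l' e"
  "ty_cmd \<Gamma> c B \<Longrightarrow> \<forall>j<length \<Gamma>. r j = r' j \<Longrightarrow> l 0 = l' 0 \<Longrightarrow> ren_cmd r l c = ren_cmd r' l' c"
  by (unfold ren_eq_sub, auto intro!: u_ext dest!: ty_imp_u simp: avail_lin)

text \<open>The list \<open>l\<close> enumerates the available variables without repetition, and
  \<open>\<sigma> j\<close> is the position of \<open>\<tau> j\<close> in it. Bijectivity on linear
  variables is inherited from \<open>\<tau>\<close> because positions in \<open>l\<close> are
  unique.\<close>

lemma structural_factor:
  assumes \<tau>: "\<forall>j<length \<Gamma>1. \<tau> j < length \<Gamma> \<and> \<Gamma> ! \<tau> j = \<Gamma>1 ! j" "bij_betw \<tau> (lin \<Gamma>1) U"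
    and l: "distinct l" "set l = avail \<Gamma> U"
  obtains \<sigma> where "structural \<Gamma>1 \<sigma> (map ((!) \<Gamma>) l)" "\<forall>j<length \<Gamma>1. l ! \<sigma> j = \<tau> j"
proof -
  have "\<exists>p<length l. l ! p = \<tau> j" if "j < length \<Gamma>1" for j
  proof -
    have "\<tau> j \<in> avail \<Gamma> U"
      using that \<tau> by (cases "is_bang (\<Gamma>1 ! j)") (auto simp: avail_def lin_def bij_betw_def)
    then show ?thesis by (simp add: in_set_conv_nth flip: l(2))
  qed
  then obtain \<sigma> where \<sigma>: "\<And>j. j < length \<Gamma>1 \<Longrightarrow> \<sigma> j < length l \<and> l ! \<sigma> j = \<tau> j"
    by metis
  have "bij_betw \<sigma> (lin \<Gamma>1) (lin (map ((!) \<Gamma>) l))"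
  proof (rule bij_betwI')
    show "\<sigma> i = \<sigma> j \<longleftrightarrow> i = j" if "i \<in> lin \<Gamma>1" "j \<in> lin \<Gamma>1" for i j
    proof
      assume "\<sigma> i = \<sigma> j"
      then have "\<tau> i = \<tau> j"
        using \<sigma>[of i] \<sigma>[of j] that by (simp add: lin_def)
      then show "i = j"
        using \<tau>(2) that by (simp add: bij_betw_def inj_on_def)
    qed simp
    show "\<sigma> i \<in> lin (map ((!) \<Gamma>) l)" if "i \<in> lin \<Gamma>1" for i
      using that \<sigma> \<tau>(1) by (simp add: lin_def)
    fix p assume p: "p \<in> lin (map ((!) \<Gamma>) l)"
    then have "l ! p \<in> avail \<Gamma> U" "\<not> is_bang (\<Gamma> ! (l ! p))" "p < length l"
      by (auto simp: lin_def simp flip: l(2))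
    then have "l ! p \<in> U" by (simp add: avail_def)
    then obtain i where i: "i \<in> lin \<Gamma>1" "\<tau> i = l ! p"
      using \<tau>(2) unfolding bij_betw_def by fastforce
    then have "\<sigma> i < length l" "l ! \<sigma> i = l ! p"
      using \<sigma>[of i] by (simp_all add: lin_def)
    then have "\<sigma> i = p"
      using \<open>p < length l\<close>
      by (auto dest: nth_eq_iff_index_eq[OF l(1), THEN iffD1, rotated 2])
    then show "\<exists>i\<in>lin \<Gamma>1. p = \<sigma> i" using i by blast
  qed
  then have "structural \<Gamma>1 \<sigma> (map ((!) \<Gamma>) l)"
    using \<sigma> \<tau>(1) by (simp add: structural_def lin_def)
  then show ?thesis using \<sigma> that by blast
qed

text \<open>A term built by an original rule in the context \<open>\<Gamma>1\<close> is carried by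
  the structural rule into the context listed by \<open>l\<close>; lookup in \<open>l\<close> then
  recovers \<open>\<tau>\<close> on all indices that occur.\<close>

lemma ren_factor:
  assumes \<tau>: "\<forall>j<length \<Gamma>1. \<tau> j < length \<Gamma> \<and> \<Gamma> ! \<tau> j = \<Gamma>1 ! j" "bij_betw \<tau> (lin \<Gamma>1) U"
    and l: "distinct l" "set l = avail \<Gamma> U"
  shows "ty_val \<Gamma>1 V A \<Longrightarrow> \<exists>V'. ty_val (map ((!) \<Gamma>) l) V' A \<and> ren_val ((!) l) id V' = ren_val \<tau> id V"
    "ty_stk \<Gamma>1 S A B \<Longrightarrow> \<exists>S'. ty_stk (map ((!) \<Gamma>) l) S' A B \<and> ren_stk ((!) l) id S' = ren_stk \<tau> id S"
    "ty_cmd \<Gamma>1 c B \<Longrightarrow> \<exists>c'. ty_cmd (map ((!) \<Gamma>) l) c' B \<and> ren_cmd ((!) l) id c' = ren_cmd \<tau> id c"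
proof -
  obtain \<sigma> where \<sigma>: "structural \<Gamma>1 \<sigma> (map ((!) \<Gamma>) l)" "\<forall>j<length \<Gamma>1. l ! \<sigma> j = \<tau> j"
    using structural_factor[OF assms] .
  then have \<sigma>': "\<forall>j<length \<Gamma>1. ((!) l \<circ> \<sigma>) j = \<tau> j"
    by simp
  show "ty_val \<Gamma>1 V A \<Longrightarrow> \<exists>V'. ty_val (map ((!) \<Gamma>) l) V' A \<and> ren_val ((!) l) id V' = ren_val \<tau> id V"
    by (intro exI[of _ "ren_val \<sigma> id V"] conjI, erule ty_struct_val[OF _ \<sigma>(1)],
      unfold ren_ren comp_id, erule ty_ren_cong(1)[OF _ \<sigma>'])
  show "ty_stk \<Gamma>1 S A B \<Longrightarrow> \<exists>S'. ty_stk (map ((!) \<Gamma>) l) S' A B \<and> ren_stk ((!) l) id S' = ren_stk \<tau> id S"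
    by (intro exI[of _ "ren_stk \<sigma> id S"] conjI, erule ty_struct_stk[OF _ \<sigma>(1)],
      unfold ren_ren comp_id, erule ty_ren_cong(2)[OF _ \<sigma>' refl])
  show "ty_cmd \<Gamma>1 c B \<Longrightarrow> \<exists>c'. ty_cmd (map ((!) \<Gamma>) l) c' B \<and> ren_cmd ((!) l) id c' = ren_cmd \<tau> id c"
    by (intro exI[of _ "ren_cmd \<sigma> id c"] conjI, erule ty_struct_cmd[OF _ \<sigma>(1)],
      unfold ren_ren comp_id, erule ty_ren_cong(5)[OF _ \<sigma>' refl])
qed

lemma bij_betw_nth_lin:
  assumes "distinct l" "set l = avail \<Gamma> U" "U \<subseteq> lin \<Gamma>"
  shows "bij_betw ((!) l) (lin (map ((!) \<Gamma>) l)) U"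
proof (rule bij_betwI')
  show "l ! i = l ! j \<longleftrightarrow> i = j"
    if "i \<in> lin (map ((!) \<Gamma>) l)" "j \<in> lin (map ((!) \<Gamma>) l)" for i j
    using that assms(1) by (auto simp: lin_def nth_eq_iff_index_eq)
  show "l ! i \<in> U" if "i \<in> lin (map ((!) \<Gamma>) l)" for i
  proof -
    have "l ! i \<in> avail \<Gamma> U" using that by (auto simp: lin_def simp flip: assms(2))
    then show ?thesis using that by (auto simp: lin_def avail_def)
  qed
  fix x assume "x \<in> U"
  then have "x \<in> set l" using assms by (auto simp: avail_def)
  then show "\<exists>i\<in>lin (map ((!) \<Gamma>) l). x = l ! i"
    using \<open>x \<in> U\<close> assms(3) by (fastforce simp: in_set_conv_nth lin_def)
qed

text \<open>The premises of a binary rule share the variables of type !B, which therefore occur in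
  both lists. Lookup in \<open>l' @ l\<close> contracts them, but is bijective on linear variables
  because the usage sets are disjoint.\<close>

lemma split_lists:
  assumes "U \<subseteq> lin \<Gamma>" "U' \<subseteq> lin \<Gamma>" "U \<inter> U' = {}"
  obtains l l' where "distinct l" "set l = avail \<Gamma> U" "distinct l'" "set l' = avail \<Gamma> U'"
    "\<forall>j<length (map ((!) \<Gamma>) l' @ map ((!) \<Gamma>) l).
       (l' @ l) ! j < length \<Gamma> \<and> \<Gamma> ! ((l' @ l) ! j) = (map ((!) \<Gamma>) l' @ map ((!) \<Gamma>) l) ! j"
    "bij_betw ((!) (l' @ l)) (lin (map ((!) \<Gamma>) l' @ map ((!) \<Gamma>) l)) (U \<union> U')"
proof -
  have sub: "avail \<Gamma> U \<subseteq> {..<length \<Gamma>}" "avail \<Gamma> U' \<subseteq> {..<length \<Gamma>}"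
    using assms by (auto simp: avail_def lin_def)
  then have "finite (avail \<Gamma> U)" "finite (avail \<Gamma> U')"
    using finite_subset by blast+
  then obtain l l' where l: "distinct l" "set l = avail \<Gamma> U" and l': "distinct l'" "set l' = avail \<Gamma> U'"
    using finite_distinct_list by metis
  let ?\<Delta> = "map ((!) \<Gamma>) l" and ?\<Delta>' = "map ((!) \<Gamma>) l'"
  have "(l' @ l) ! j < length \<Gamma>" if "j < length (?\<Delta>' @ ?\<Delta>)" for j
  proof -
    have "(l' @ l) ! j \<in> set (l' @ l)" using that by (intro nth_mem) simp
    then show ?thesis using sub l l' by auto
  qed
  moreover have "\<Gamma> ! ((l' @ l) ! j) = (?\<Delta>' @ ?\<Delta>) ! j" if "j < length (?\<Delta>' @ ?\<Delta>)" for j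
    using that by (simp flip: map_append)
  moreover have "bij_betw ((!) (l' @ l)) (lin (?\<Delta>' @ ?\<Delta>)) (U \<union> U')"
  proof -
    have 1: "bij_betw ((!) (l' @ l)) (lin ?\<Delta>') U'"
      using bij_betw_nth_lin[OF l' assms(2)]
      by (rule bij_betw_cong[THEN iffD1, rotated]) (simp add: lin_def nth_append)
    have "bij_betw ((!) (l' @ l) \<circ> (\<lambda>i. i + length ?\<Delta>')) (lin ?\<Delta>) U"
      using bij_betw_nth_lin[OF l assms(1)]
      by (rule bij_betw_cong[THEN iffD1, rotated]) (simp add: lin_def nth_append)
    then have 2: "bij_betw ((!) (l' @ l)) ((\<lambda>i. i + length ?\<Delta>') ` lin ?\<Delta>) U"
      by (subst bij_betw_comp_iff[of "\<lambda>i. i + length ?\<Delta>'" "lin ?\<Delta>"])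
        (auto simp: bij_betw_def inj_on_def)
    show ?thesis
      using bij_betw_combine[OF 1 2] assms(3) by (simp add: lin_append Un_commute Int_commute)
  qed
  ultimately show ?thesis using that l l' by blast
qed

text \<open>Lookup beyond the end of a list is unspecified, so the two renamings agree only below
  the length; typing confines the indices of \<open>c\<close> to that range.\<close>

lemma ren_up_nth:
  "ty_cmd (A # map ((!) \<Gamma>) l) c B \<Longrightarrow>
    ren_cmd (up ((!) l)) id c = ren_cmd ((!) (0 # map Suc l)) id c"
  by (erule ty_ren_cong) (auto simp: less_Suc_eq_0_disj)

lemma ren_up_up_nth:
  "ty_cmd (A # A' # map ((!) \<Gamma>) l) c B \<Longrightarrow>
    ren_cmd (up (up ((!) l))) id c = ren_cmd ((!) (0 # map Suc (0 # map Suc l))) id c"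
  by (erule ty_ren_cong) (auto simp: less_Suc_eq_0_disj)

lemma list_bindu:
  assumes "distinct l" "set l = avail \<Gamma> U"
  shows "distinct (0 # map Suc l)" "set (0 # map Suc l) = avail (A # \<Gamma>) (bindu A U)"
    "map ((!) (A # \<Gamma>)) (0 # map Suc l) = A # map ((!) \<Gamma>) l"
  using assms by (auto simp: distinct_map)

text \<open>The original system has no weakening for linear variables, so those of \<Gamma> outside
  \<open>U\<close> cannot stay. The induction yields a term over the available variables alone,
  listed in any order, and lookup in \<open>l\<close> maps it back.\<close>

lemma u_imp_ty_aux:
  "u_val \<Gamma> U V A \<Longrightarrow> distinct l \<Longrightarrow> set l = avail \<Gamma> U \<Longrightarrow>
    \<exists>V'. ty_val (map ((!) \<Gamma>) l) V' A \<and> ren_val ((!) l) id V' = V"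
  "u_stk \<Gamma> U S A B \<Longrightarrow> distinct l \<Longrightarrow> set l = avail \<Gamma> U \<Longrightarrow>
    \<exists>S'. ty_stk (map ((!) \<Gamma>) l) S' A B \<and> ren_stk ((!) l) id S' = S"
  "u_expr \<Gamma> U t A \<Longrightarrow> distinct l \<Longrightarrow> set l = avail \<Gamma> U \<Longrightarrow>
    \<exists>t'. ty_expr (map ((!) \<Gamma>) l) t' A \<and> ren_expr ((!) l) id t' = t"
  "u_ctxt \<Gamma> U e A B \<Longrightarrow> distinct l \<Longrightarrow> set l = avail \<Gamma> U \<Longrightarrow>
    \<exists>e'. ty_ctxt (map ((!) \<Gamma>) l) e' A B \<and> ren_ctxt ((!) l) id e' = e"
  "u_cmd \<Gamma> U c B \<Longrightarrow> distinct l \<Longrightarrow> set l = avail \<Gamma> U \<Longrightarrow>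
    \<exists>c'. ty_cmd (map ((!) \<Gamma>) l) c' B \<and> ren_cmd ((!) l) id c' = c"
proof (induction arbitrary: l and l and l and l and l
    rule: u_val_u_stk_u_expr_u_ctxt_u_cmd.inducts)
  case (u_Var i \<Gamma> A U)
  \<comment> \<open>The original rule types a variable in the context \<open>[A]\<close>, whose
    single index is sent to \<open>i\<close>. When \<open>A\<close> is of the form !B, both sets are
    empty.\<close>
  have "bij_betw (\<lambda>_. i) (lin [A]) U"
    using u_Var.hyps by (simp add: bij_betw_def bindu_def)
  from ren_factor(1)[OF _ this u_Var.prems ty_Var] show ?case
    using u_Var.hyps by simp
next
  case (u_Covar \<Gamma> A)
  show ?case
    using ren_factor(2)[where \<tau> = id and S = "Covar 0", OF _ _ u_Covar.prems ty_Covar[of A]]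
    by (auto simp: bij_betw_def)
next
  case (u_VUnit \<Gamma>)
  show ?case
    using ren_factor(1)[where \<tau> = id and V = VUnit, OF _ _ u_VUnit.prems ty_VUnit]
    by (auto simp: bij_betw_def)
next
  case (u_CutP \<Gamma> U t A U' S B W)
  obtain m m' where m: "distinct m" "set m = avail \<Gamma> U" and m': "distinct m'" "set m' = avail \<Gamma> U'"
    and \<tau>: "\<forall>j<length (map ((!) \<Gamma>) m' @ map ((!) \<Gamma>) m).
       (m' @ m) ! j < length \<Gamma> \<and> \<Gamma> ! ((m' @ m) ! j) = (map ((!) \<Gamma>) m' @ map ((!) \<Gamma>) m) ! j"
      "bij_betw ((!) (m' @ m)) (lin (map ((!) \<Gamma>) m' @ map ((!) \<Gamma>) m)) (U \<union> U')"
    using split_lists u_subset_lin u_CutP.hyps by metis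
  obtain t' S' where t': "ty_expr (map ((!) \<Gamma>) m) t' A" "ren_expr ((!) m) id t' = t"
    and S': "ty_stk (map ((!) \<Gamma>) m') S' A B" "ren_stk ((!) m') id S' = S"
    using u_CutP.IH(1)[OF m] u_CutP.IH(2)[OF m'] by blast
  \<comment> \<open>The indices of \<open>t'\<close> are shifted past \<open>m'\<close>, so lookup
    in \<open>m' @ m\<close> lands in \<open>m\<close>.\<close>
  have "ren_expr ((!) (m' @ m)) id (shift_expr (map ((!) \<Gamma>) m') t') = t"
    unfolding ren_ren t'(2)[symmetric] using t'(1) by (rule ty_ren_cong) (simp add: nth_append)
  moreover have "ren_stk ((!) (m' @ m)) id S' = S"
    unfolding S'(2)[symmetric] using S'(1) by (rule ty_ren_cong) (simp_all add: nth_append)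
  ultimately show ?case
    using ren_factor(3)[OF \<tau> u_CutP.prems[unfolded \<open>W = U \<union> U'\<close>] ty_CutP[OF t'(1) S'(1) \<open>pol A = Pos\<close>]]
    by simp
next
  case (u_CutN \<Gamma> U t A U' S B W)
  obtain m m' where m: "distinct m" "set m = avail \<Gamma> U" and m': "distinct m'" "set m' = avail \<Gamma> U'"
    and \<tau>: "\<forall>j<length (map ((!) \<Gamma>) m' @ map ((!) \<Gamma>) m).
       (m' @ m) ! j < length \<Gamma> \<and> \<Gamma> ! ((m' @ m) ! j) = (map ((!) \<Gamma>) m' @ map ((!) \<Gamma>) m) ! j"
      "bij_betw ((!) (m' @ m)) (lin (map ((!) \<Gamma>) m' @ map ((!) \<Gamma>) m)) (U \<union> U')"
    using split_lists u_subset_lin u_CutN.hyps by metis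
  obtain t' S' where t': "ty_val (map ((!) \<Gamma>) m) t' A" "ren_val ((!) m) id t' = t"
    and S': "ty_ctxt (map ((!) \<Gamma>) m') S' A B" "ren_ctxt ((!) m') id S' = S"
    using u_CutN.IH(1)[OF m] u_CutN.IH(2)[OF m'] by blast
  have "ren_val ((!) (m' @ m)) id (shift_val (map ((!) \<Gamma>) m') t') = t"
    unfolding ren_ren t'(2)[symmetric] using t'(1) by (rule ty_ren_cong) (simp add: nth_append)
  moreover have "ren_ctxt ((!) (m' @ m)) id S' = S"
    unfolding S'(2)[symmetric] using S'(1) by (rule ty_ren_cong) (simp_all add: nth_append)
  ultimately show ?case
    using ren_factor(3)[OF \<tau> u_CutN.prems[unfolded \<open>W = U \<union> U'\<close>] ty_CutN[OF t'(1) S'(1) \<open>pol A = Neg\<close>]]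
    by simp
next
  case (u_Push \<Gamma> U t A U' S B C W)
  obtain m m' where m: "distinct m" "set m = avail \<Gamma> U" and m': "distinct m'" "set m' = avail \<Gamma> U'"
    and \<tau>: "\<forall>j<length (map ((!) \<Gamma>) m' @ map ((!) \<Gamma>) m).
       (m' @ m) ! j < length \<Gamma> \<and> \<Gamma> ! ((m' @ m) ! j) = (map ((!) \<Gamma>) m' @ map ((!) \<Gamma>) m) ! j"
      "bij_betw ((!) (m' @ m)) (lin (map ((!) \<Gamma>) m' @ map ((!) \<Gamma>) m)) (U \<union> U')"
    using split_lists u_subset_lin u_Push.hyps by metis
  obtain t' S' where t': "ty_val (map ((!) \<Gamma>) m) t' A" "ren_val ((!) m) id t' = t"
    and S': "ty_stk (map ((!) \<Gamma>) m') S' B C" "ren_stk ((!) m') id S' = S"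
    using u_Push.IH(1)[OF m] u_Push.IH(2)[OF m'] by blast
  have "ren_val ((!) (m' @ m)) id (shift_val (map ((!) \<Gamma>) m') t') = t"
    unfolding ren_ren t'(2)[symmetric] using t'(1) by (rule ty_ren_cong) (simp add: nth_append)
  moreover have "ren_stk ((!) (m' @ m)) id S' = S"
    unfolding S'(2)[symmetric] using S'(1) by (rule ty_ren_cong) (simp_all add: nth_append)
  ultimately show ?case
    using ren_factor(2)[OF \<tau> u_Push.prems[unfolded \<open>W = U \<union> U'\<close>] ty_Push[OF t'(1) S'(1)]]
    by simp
next
  case (u_VTensor \<Gamma> U t A U' S B W)
  obtain m m' where m: "distinct m" "set m = avail \<Gamma> U" and m': "distinct m'" "set m' = avail \<Gamma> U'"
    and \<tau>: "\<forall>j<length (map ((!) \<Gamma>) m' @ map ((!) \<Gamma>) m).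
       (m' @ m) ! j < length \<Gamma> \<and> \<Gamma> ! ((m' @ m) ! j) = (map ((!) \<Gamma>) m' @ map ((!) \<Gamma>) m) ! j"
      "bij_betw ((!) (m' @ m)) (lin (map ((!) \<Gamma>) m' @ map ((!) \<Gamma>) m)) (U \<union> U')"
    using split_lists u_subset_lin u_VTensor.hyps by metis
  obtain t' S' where t': "ty_val (map ((!) \<Gamma>) m) t' A" "ren_val ((!) m) id t' = t"
    and S': "ty_val (map ((!) \<Gamma>) m') S' B" "ren_val ((!) m') id S' = S"
    using u_VTensor.IH(1)[OF m] u_VTensor.IH(2)[OF m'] by blast
  have "ren_val ((!) (m' @ m)) id (shift_val (map ((!) \<Gamma>) m') t') = t"
    unfolding ren_ren t'(2)[symmetric] using t'(1) by (rule ty_ren_cong) (simp add: nth_append)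
  moreover have "ren_val ((!) (m' @ m)) id S' = S"
    unfolding S'(2)[symmetric] using S'(1) by (rule ty_ren_cong) (simp_all add: nth_append)
  ultimately show ?case
    using ren_factor(1)[OF \<tau> u_VTensor.prems[unfolded \<open>W = U \<union> U'\<close>] ty_VTensor[OF t'(1) S'(1)]]
    by simp
next
  case (u_MtP A \<Gamma> U c B)
  obtain c' where "ty_cmd (A # map ((!) \<Gamma>) l) c' B" "ren_cmd ((!) (0 # map Suc l)) id c' = c"
    using u_MtP.IH[OF list_bindu(1,2)[OF u_MtP.prems]] unfolding list_bindu(3)[OF u_MtP.prems] by blast
  then show ?case
    using u_MtP.hyps by (intro exI[of _ "MtP c'"]) (simp add: ty_MtP ren_up_nth)
next
  case (u_MtN A \<Gamma> U c B)
  obtain c' where "ty_cmd (A # map ((!) \<Gamma>) l) c' B" "ren_cmd ((!) (0 # map Suc l)) id c' = c"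
    using u_MtN.IH[OF list_bindu(1,2)[OF u_MtN.prems]] unfolding list_bindu(3)[OF u_MtN.prems] by blast
  then show ?case
    using u_MtN.hyps by (intro exI[of _ "MtN c'"]) (simp add: ty_MtN ren_up_nth)
next
  case (u_MuFun A \<Gamma> U c B)
  obtain c' where "ty_cmd (A # map ((!) \<Gamma>) l) c' B" "ren_cmd ((!) (0 # map Suc l)) id c' = c"
    using u_MuFun.IH[OF list_bindu(1,2)[OF u_MuFun.prems]] unfolding list_bindu(3)[OF u_MuFun.prems] by blast
  then show ?case
    by (intro exI[of _ "MuFun c'"]) (simp add: ty_MuFun ren_up_nth)
next
  case (u_MtDia A \<Gamma> c B)
  obtain c' where "ty_cmd (A # map ((!) \<Gamma>) l) c' B" "ren_cmd ((!) (0 # map Suc l)) id c' = c"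
    using u_MtDia.IH[OF list_bindu(1,2)[OF u_MtDia.prems]] unfolding list_bindu(3)[OF u_MtDia.prems] by blast
  moreover have "\<forall>G\<in>set (map ((!) \<Gamma>) l). is_bang G"
    using u_MtDia.prems by (simp add: avail_def)
  ultimately show ?case
    using u_MtDia.hyps by (intro exI[of _ "MtDia c'"]) (simp add: ty_MtDia ren_up_nth)
next
  case (u_MtTensor B A \<Gamma> U c C)
  note l = list_bindu(1)[OF u_MtTensor.prems] list_bindu(2,3)[OF u_MtTensor.prems, of A]
  obtain c' where "ty_cmd (B # A # map ((!) \<Gamma>) l) c' C"
    "ren_cmd ((!) (0 # map Suc (0 # map Suc l))) id c' = c"
    using u_MtTensor.IH[OF list_bindu(1,2)[OF l(1,2)]] unfolding list_bindu(3)[OF l(1,2)] l(3) by blast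
  then show ?case
    by (intro exI[of _ "MtTensor c'"]) (simp add: ty_MtTensor ren_up_up_nth del: list.map)
next
  case (u_MtPlus A \<Gamma> U c C B d)
  obtain c' where "ty_cmd (A # map ((!) \<Gamma>) l) c' C" "ren_cmd ((!) (0 # map Suc l)) id c' = c"
    using u_MtPlus.IH(1)[OF list_bindu(1,2)[OF u_MtPlus.prems]] unfolding list_bindu(3)[OF u_MtPlus.prems] by blast
  moreover obtain d' where "ty_cmd (B # map ((!) \<Gamma>) l) d' C" "ren_cmd ((!) (0 # map Suc l)) id d' = d"
    using u_MtPlus.IH(2)[OF list_bindu(1,2)[OF u_MtPlus.prems]] unfolding list_bindu(3)[OF u_MtPlus.prems] by blast
  ultimately show ?case
    by (intro exI[of _ "MtPlus c' d'"]) (simp add: ty_MtPlus ren_up_nth)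
next
  case (u_MuBang \<Gamma> c A)
  then obtain c' where "ty_cmd (map ((!) \<Gamma>) l) c' A" "ren_cmd ((!) l) id c' = c"
    by blast
  moreover have "\<forall>G\<in>set (map ((!) \<Gamma>) l). is_bang G"
    using u_MuBang.prems by (simp add: avail_def)
  ultimately show ?case
    by (intro exI[of _ "MuBang c'"]) (simp add: ty_MuBang)
next
  case (u_MuWith \<Gamma> U c A d B)
  then obtain c' d' where "ty_cmd (map ((!) \<Gamma>) l) c' A" "ren_cmd ((!) l) id c' = c"
      "ty_cmd (map ((!) \<Gamma>) l) d' B" "ren_cmd ((!) l) id d' = d"
    by blast
  then show ?case
    by (intro exI[of _ "MuWith c' d'"]) (simp add: ty_MuWith)
next
  case (u_Val \<Gamma> U V A)
  then show ?case by (metis ty_Val ren_expr.simps)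
next
  case (u_Stk \<Gamma> U S A B)
  then show ?case by (metis ty_Stk ren_ctxt.simps)
next
  case (u_MuP \<Gamma> U c A)
  then show ?case by (metis ty_MuP ren_expr.simps up_id)
next
  case (u_MuN \<Gamma> U c A)
  then show ?case by (metis ty_MuN ren_val.simps(2) up_id)
next
  case (u_Pi1 \<Gamma> U S A C B)
  then show ?case by (metis ty_Pi1 ren_stk.simps(7))
next
  case (u_Pi2 \<Gamma> U S B C A)
  then show ?case by (metis ty_Pi2 ren_stk.simps(8))
next
  case (u_In1 \<Gamma> U V A B)
  then show ?case by (metis ty_In1 ren_val.simps(5))
next
  case (u_In2 \<Gamma> U V B A)
  then show ?case by (metis ty_In2 ren_val.simps(6))
next
  case (u_MtUnit \<Gamma> U c B)
  then show ?case by (metis ty_MtUnit ren_stk.simps(3))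
next
  case (u_MuTop \<Gamma> U V A)
  then show ?case by (metis ty_MuTop ren_val.simps(9))
next
  case (u_MtZero \<Gamma> U S A B)
  then show ?case by (metis ty_MtZero ren_stk.simps(9))
next
  case (u_SBang \<Gamma> U S A B)
  then show ?case by (metis ty_SBang ren_stk.simps(10))
next
  case (u_VDia \<Gamma> U V A)
  then show ?case by (metis ty_VDia ren_val.simps(11))
qed

text \<open>Taking for \<open>l\<close> all indices in order makes lookup the identity on the
  indices that occur, and the restricted context is \<Gamma> itself.\<close>

lemma u_iff_ty:
  "u_val \<Gamma> (lin \<Gamma>) V A \<longleftrightarrow> ty_val \<Gamma> V A"
  "u_stk \<Gamma> (lin \<Gamma>) S A B \<longleftrightarrow> ty_stk \<Gamma> S A B"
  "u_expr \<Gamma> (lin \<Gamma>) t A \<longleftrightarrow> ty_expr \<Gamma> t A"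
  "u_ctxt \<Gamma> (lin \<Gamma>) e A B \<longleftrightarrow> ty_ctxt \<Gamma> e A B"
  "u_cmd \<Gamma> (lin \<Gamma>) c B \<longleftrightarrow> ty_cmd \<Gamma> c B"
proof -
  have l: "distinct [0..<length \<Gamma>]" "set [0..<length \<Gamma>] = avail \<Gamma> (lin \<Gamma>)"
    by (auto simp: avail_lin)
  have *: "\<forall>j<length \<Gamma>. [0..<length \<Gamma>] ! j = id j"
    by simp
  show "u_val \<Gamma> (lin \<Gamma>) V A \<longleftrightarrow> ty_val \<Gamma> V A"
    using u_imp_ty_aux(1)[OF _ l] ty_imp_u(1) ty_ren_cong(1)[OF _ *] unfolding map_nth
    by (metis ren_id(1))
  show "u_stk \<Gamma> (lin \<Gamma>) S A B \<longleftrightarrow> ty_stk \<Gamma> S A B"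
    using u_imp_ty_aux(2)[OF _ l] ty_imp_u(2) ty_ren_cong(2)[OF _ *] unfolding map_nth
    by (metis ren_id(2))
  show "u_expr \<Gamma> (lin \<Gamma>) t A \<longleftrightarrow> ty_expr \<Gamma> t A"
    using u_imp_ty_aux(3)[OF _ l] ty_imp_u(3) ty_ren_cong(3)[OF _ *] unfolding map_nth
    by (metis ren_id(3))
  show "u_ctxt \<Gamma> (lin \<Gamma>) e A B \<longleftrightarrow> ty_ctxt \<Gamma> e A B"
    using u_imp_ty_aux(4)[OF _ l] ty_imp_u(4) ty_ren_cong(4)[OF _ *] unfolding map_nth
    by (metis ren_id(4))
  show "u_cmd \<Gamma> (lin \<Gamma>) c B \<longleftrightarrow> ty_cmd \<Gamma> c B"
    using u_imp_ty_aux(5)[OF _ l] ty_imp_u(5) ty_ren_cong(5)[OF _ *] unfolding map_nth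
    by (metis ren_id(5))
qed

section \<open>Substitution lemmas for the original type system\<close>

lemmas ty_intros = ty_val_ty_stk_ty_expr_ty_ctxt_ty_cmd.intros

lemma ty_sub_cong:
  "ty_val \<Gamma> V A \<Longrightarrow> \<forall>i<length \<Gamma>. s i = s' i \<Longrightarrow> sub_val s k V = sub_val s' k' V"
  "ty_stk \<Gamma> S A B \<Longrightarrow> \<forall>i<length \<Gamma>. s i = s' i \<Longrightarrow> k 0 = k' 0 \<Longrightarrow> sub_stk s k S = sub_stk s' k' S"
  "ty_cmd \<Gamma> c B \<Longrightarrow> \<forall>i<length \<Gamma>. s i = s' i \<Longrightarrow> k 0 = k' 0 \<Longrightarrow> sub_cmd s k c = sub_cmd s' k' c"
  by (auto intro!: u_ext dest!: ty_imp_u simp: avail_lin)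

lemma ty_sub_trivial:
  "ty_cmd \<Gamma> c B \<Longrightarrow> \<forall>i<length \<Gamma>. s i = Var i \<Longrightarrow> k 0 = Covar 0 \<Longrightarrow> sub_cmd s k c = c"
  using ty_sub_cong(3)[of \<Gamma> c B s Var k Covar] by simp

text \<open>Only co-variable 0 can be free here, so shifting such a stack under variable binders has
  no effect.\<close>

lemma ty_stk_closed:
  assumes "ty_stk [] S A B"
  shows "ren_stk r id S = S" "k 0 = Covar 0 \<Longrightarrow> sub_stk s k S = S"
  using ty_ren_cong(2)[OF assms, of r id id id] ty_sub_cong(2)[OF assms, of s Var k Covar] by simp_all

text \<open>A value has no free co-variable, so going under a \<mu> leaves it unchanged.\<close>

lemma ty_val_ren_covar:
  "ty_val \<Gamma> V A \<Longrightarrow> ren_val id l V = V"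
  "ty_val \<Gamma> V A \<Longrightarrow> ren_val r l V = ren_val r id V"
  using ty_ren_cong(1)[of \<Gamma> V A id id l id] ty_ren_cong(1)[of \<Gamma> V A r r l id] by simp_all

lemma ty_inst_v:
  assumes c: "ty_cmd [A] c B" and V: "ty_val \<Gamma> V A"
  shows "ty_cmd \<Gamma> (inst_v c V) B"
proof -
  have "sub_ok [A] (lin [A]) (case_nat V Var) (\<lambda>_. lin \<Gamma>) \<Gamma>"
    using ty_imp_u(1)[OF V] unfolding sub_ok_def avail_lin
    by (auto simp: bindu_def split: if_splits)
  then have "u_cmd \<Gamma> ((\<Union>i\<in>lin [A]. lin \<Gamma>) \<union> {}) (inst_v c V) B"
    unfolding inst_v_def by (rule u_sub(5)[OF ty_imp_u(5)[OF c]]) (auto intro: u_Covar)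
  \<comment> \<open>If \<open>A\<close> is of the form !B, the union is over the empty set; but then
    \<open>V\<close> has empty usage, so \<Gamma> contains no linear variable either.\<close>
  moreover have "(\<Union>i\<in>lin [A]. lin \<Gamma>) = lin \<Gamma>"
    using u_val_bang[OF ty_imp_u(1)[OF V]] by (auto simp: bindu_def)
  ultimately show ?thesis by (simp add: u_iff_ty)
qed

text \<open>Serves to put () for a variable of type 1 while the rest of the context stays in place;
  the closed value contributes the empty usage set.\<close>

lemma ty_inst_v_closed:
  assumes c: "ty_cmd (A # \<Gamma>) c B" and V: "ty_val [] V A"
  shows "ty_cmd \<Gamma> (inst_v c V) B"
proof -
  have V': "u_val \<Gamma> {} V A"
    using u_ren(1)[OF ty_imp_u(1)[OF V], of id \<Gamma> id] by (simp add: ren_ok_def avail_def)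
  have V'': "u_val \<Gamma> (if is_bang B then {} else {i}) (Var i) B" if "i < length \<Gamma>" "B = \<Gamma> ! i" for i B
    using that by (intro u_Var) auto
  let ?W = "case_nat {} (\<lambda>i. if is_bang (\<Gamma> ! i) then {} else {i})"
  have "sub_ok (A # \<Gamma>) (lin (A # \<Gamma>)) (case_nat V Var) ?W \<Gamma>"
    using V' V'' unfolding sub_ok_def avail_lin by (auto split: nat.splits)
  then have "u_cmd \<Gamma> ((\<Union>i\<in>lin (A # \<Gamma>). ?W i) \<union> {}) (inst_v c V) B"
    unfolding inst_v_def by (rule u_sub(5)[OF ty_imp_u(5)[OF c]]) (auto intro: u_Covar)
  moreover have "(\<Union>i\<in>lin (A # \<Gamma>). ?W i) = lin \<Gamma>"
    by (auto simp: lin_def bindu_def split: nat.splits)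
  ultimately show ?thesis by (simp add: u_iff_ty)
qed

text \<open>Shifting \<open>c\<close> makes room for the variables of \<open>S\<close>. A nonempty
  \<Gamma>' serves for the stack x \<cdot> \<alpha> in the expansion at a function type.\<close>

lemma ty_inst_k:
  assumes c: "ty_cmd \<Gamma> c A" and S: "ty_stk \<Gamma>' S A B"
  shows "ty_cmd (\<Gamma>' @ \<Gamma>) (inst_k (ren_cmd (\<lambda>i. i + length \<Gamma>') id c) S) B"
proof -
  let ?\<Delta> = "\<Gamma>' @ \<Gamma>" and ?U = "(\<lambda>i. i + length \<Gamma>') ` lin \<Gamma>"
  have c': "u_cmd ?\<Delta> ?U (ren_cmd (\<lambda>i. i + length \<Gamma>') id c) A"
    using u_ren(5)[OF ty_imp_u(5)[OF c] ren_ok_shift] by simp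
  have S': "u_stk ?\<Delta> (lin \<Gamma>') S A B"
    using u_ren(2)[OF ty_imp_u(2)[OF S] ren_ok_append, of id] by simp
  have "u_val ?\<Delta> (if is_bang (?\<Delta> ! i) then {} else {i}) (Var i) (?\<Delta> ! i)" if "i < length ?\<Delta>" for i
    using that by (intro u_Var) auto
  moreover have "avail ?\<Delta> ?U \<subseteq> {..<length ?\<Delta>}"
    using u_subset_lin(5)[OF c'] by (auto simp: avail_def lin_def)
  ultimately have "sub_ok ?\<Delta> ?U Var (\<lambda>i. if is_bang (?\<Delta> ! i) then {} else {i}) ?\<Delta>"
    unfolding sub_ok_def by (intro conjI ballI impI) (blast, simp)
  then have "u_cmd ?\<Delta> ((\<Union>i\<in>?U. if is_bang (?\<Delta> ! i) then {} else {i}) \<union> lin \<Gamma>')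
      (inst_k (ren_cmd (\<lambda>i. i + length \<Gamma>') id c) S) B"
    unfolding inst_k_def using c' S' lin_append_disjoint[of \<Gamma>' \<Gamma>]
    by (intro u_sub(5)[OF c']) (auto split: if_splits)
  moreover have "(\<Union>i\<in>?U. if is_bang (?\<Delta> ! i) then {} else {i}) = ?U"
    by (auto simp: lin_def nth_append)
  ultimately show ?thesis by (simp add: Un_commute flip: u_iff_ty lin_append)
qed

lemma ty_inst_k_closed: "ty_cmd \<Gamma> c A \<Longrightarrow> ty_stk [] S A B \<Longrightarrow> ty_cmd \<Gamma> (inst_k c S) B"
  using ty_inst_k[of \<Gamma> c A "[]" S B] by simp

lemma eq_imp_ty:
  "eq_val \<Gamma> V V' A \<Longrightarrow> ty_val \<Gamma> V A \<and> ty_val \<Gamma> V' A"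
  "eq_stk \<Gamma> S S' A B \<Longrightarrow> ty_stk \<Gamma> S A B \<and> ty_stk \<Gamma> S' A B"
  "eq_expr \<Gamma> t t' A \<Longrightarrow> ty_expr \<Gamma> t A \<and> ty_expr \<Gamma> t' A"
  "eq_ctxt \<Gamma> e e' A B \<Longrightarrow> ty_ctxt \<Gamma> e A B \<and> ty_ctxt \<Gamma> e' A B"
  "eq_cmd \<Gamma> c c' B \<Longrightarrow> ty_cmd \<Gamma> c B \<and> ty_cmd \<Gamma> c' B"
  by (induction rule: eq_val_eq_stk_eq_expr_eq_ctxt_eq_cmd.inducts) (auto intro: ty_intros)

section \<open>Equations between commands\<close>

lemma ty_cut_closed:
  "ty_expr \<Gamma> t A \<Longrightarrow> ty_stk [] S A B \<Longrightarrow> pol A = Pos \<Longrightarrow> ty_cmd \<Gamma> (CutP t S) B"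
  "ty_val \<Gamma> V A \<Longrightarrow> ty_ctxt [] e A B \<Longrightarrow> pol A = Neg \<Longrightarrow> ty_cmd \<Gamma> (CutN V e) B"
  using ty_CutP[of \<Gamma> t A "[]" S B] ty_CutN[of \<Gamma> V A "[]" e B] by simp_all

lemma eq_cut_closed:
  "eq_expr \<Gamma> t t' A \<Longrightarrow> eq_stk [] S S' A B \<Longrightarrow> pol A = Pos \<Longrightarrow> eq_cmd \<Gamma> (CutP t S) (CutP t' S') B"
  "eq_val \<Gamma> V V' A \<Longrightarrow> eq_ctxt [] e e' A B \<Longrightarrow> pol A = Neg \<Longrightarrow> eq_cmd \<Gamma> (CutN V e) (CutN V' e') B"
  using eq_CutP[of \<Gamma> t t' A "[]" S S' B] eq_CutN[of \<Gamma> V V' A "[]" e e' B] by simp_all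

lemma beta_v:
  assumes "ty_cmd [A] c B" "ty_val \<Gamma> V A"
  shows "pol A = Pos \<Longrightarrow> eq_cmd \<Gamma> (CutP (Val V) (MtP c)) (inst_v c V) B"
    "pol A = Neg \<Longrightarrow> eq_cmd \<Gamma> (CutN V (MtN c)) (inst_v c V) B"
  using assms by (auto intro!: eq_red red.intros ty_cut_closed ty_inst_v ty_MtP ty_MtN ty_Val)

lemma beta_k:
  assumes "ty_cmd \<Gamma> c A" "ty_stk [] S A B"
  shows "pol A = Pos \<Longrightarrow> eq_cmd \<Gamma> (CutP (MuP c) S) (inst_k c S) B"
    "pol A = Neg \<Longrightarrow> eq_cmd \<Gamma> (CutN (MuN c) (Stk S)) (inst_k c S) B"
  using assms
  by (auto intro!: eq_red red.intros ty_cut_closed ty_inst_k_closed ty_MuP ty_MuN ty_Stk)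

lemma eq_cmd_conv:
  "eq_cmd \<Gamma> c d B \<Longrightarrow> eq_cmd \<Gamma> c' d' B \<Longrightarrow> eq_cmd \<Gamma> d d' B \<Longrightarrow> eq_cmd \<Gamma> c c' B"
  by (meson eq_sym_cmd eq_trans_cmd)

section \<open>Commands given by a value or by a stack\<close>

fun val_cmd :: "polarity \<Rightarrow> val \<Rightarrow> cmd" where
  "val_cmd Pos V = CutP (Val V) (Covar 0)"
| "val_cmd Neg V = CutN V (Stk (Covar 0))"

fun stk_cmd :: "polarity \<Rightarrow> stk \<Rightarrow> cmd" where
  "stk_cmd Pos S = CutP (Val (Var 0)) S"
| "stk_cmd Neg S = CutN (Var 0) (Stk S)"

text \<open>Having both forms makes the identity thunkable as well as linear, and yields both unit
  laws.\<close>

lemma id_cmd_eq: "id_cmd p = val_cmd p (Var 0)" "id_cmd p = stk_cmd p (Covar 0)"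
  by (cases p; simp)+

lemma ty_val_cmd: "ty_val \<Gamma> V B \<Longrightarrow> ty_cmd \<Gamma> (val_cmd (pol B) V) B"
  by (cases "pol B") (auto intro: ty_cut_closed ty_intros)

lemma ty_stk_cmd: "ty_stk [] S A B \<Longrightarrow> ty_cmd [A] (stk_cmd (pol A) S) B"
  by (cases "pol A") (auto intro: ty_cut_closed ty_intros)

lemma ty_id_cmd: "ty_cmd [A] (id_cmd (pol A)) A"
  unfolding id_cmd_eq by (intro ty_val_cmd ty_Var)

lemma ty_comp_cmd: "ty_cmd \<Gamma> c B \<Longrightarrow> ty_cmd [B] d C \<Longrightarrow> ty_cmd \<Gamma> (comp_cmd (pol B) c d) C"
  by (cases "pol B") (auto intro: ty_cut_closed ty_intros)

lemma eq_val_cmd: "eq_val \<Gamma> V V' B \<Longrightarrow> eq_cmd \<Gamma> (val_cmd (pol B) V) (val_cmd (pol B) V') B"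
  by (cases "pol B") (auto intro: eq_cut_closed eq_Val eq_refl_stk eq_refl_ctxt ty_intros)

lemma eq_stk_cmd: "eq_stk [] S S' A B \<Longrightarrow> eq_cmd [A] (stk_cmd (pol A) S) (stk_cmd (pol A) S') B"
  by (cases "pol A") (auto intro: eq_cut_closed eq_Stk eq_refl_expr eq_refl_val ty_intros)

lemma eq_comp_cmd: "eq_cmd \<Gamma> c c' B \<Longrightarrow> eq_cmd [B] d d' C \<Longrightarrow>
    eq_cmd \<Gamma> (comp_cmd (pol B) c d) (comp_cmd (pol B) c' d') C"
  by (cases "pol B") (auto intro: eq_cut_closed eq_MuP eq_MuN eq_MtP eq_MtN)

section \<open>Eta laws for the \<mu>-binders at each polarity\<close>

lemma eta_MuP:
  assumes "ty_val \<Gamma> V A" "pol A = Pos"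
  shows "eq_expr \<Gamma> (MuP (CutP (Val V) (Covar 0))) (Val V) A"
proof -
  have "expand_expr A (Val V) (MuP (CutP (ren_expr id Suc (Val V)) (Covar 0)))"
    using assms by (intro expand_expr.intros)
  then show ?thesis
    using assms ty_val_ren_covar(1)[OF assms(1), of Suc] ty_val_cmd[OF assms(1)]
    by (auto intro!: eq_sym_expr[OF eq_expand_expr] ty_Val ty_MuP)
qed

lemma eta_MuN:
  assumes "ty_val \<Gamma> V A" "pol A = Neg"
  shows "eq_val \<Gamma> (MuN (CutN V (Stk (Covar 0)))) V A"
proof -
  have "expand_val (length \<Gamma>) A V (MuN (CutN (ren_val id Suc V) (Stk (Covar 0))))"
    using assms by (intro expand_val.intros)
  then show ?thesis
    using assms ty_val_ren_covar(1)[OF assms(1), of Suc] ty_val_cmd[OF assms(1)]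
    by (auto intro!: eq_sym_val[OF eq_expand_val] ty_MuN)
qed

lemma eta_MtP:
  assumes "ty_stk [] S A B" "pol A = Pos"
  shows "eq_stk [] (MtP (CutP (Val (Var 0)) S)) S A B"
proof -
  have "expand_stk (length []) A S (MtP (CutP (Val (Var 0)) (ren_stk Suc id S)))"
    using assms by (intro expand_stk.intros)
  then show ?thesis
    using assms ty_stk_closed(1)[OF assms(1), of Suc] ty_stk_cmd[OF assms(1)]
    by (auto intro!: eq_sym_stk[OF eq_expand_stk] ty_MtP)
qed

lemma eta_MtN:
  assumes "ty_stk [] S A B" "pol A = Neg"
  shows "eq_ctxt [] (MtN (CutN (Var 0) (Stk S))) (Stk S) A B"
proof -
  have "expand_ctxt A (Stk S) (MtN (CutN (Var 0) (ren_ctxt Suc id (Stk S))))"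
    using assms by (intro expand_ctxt.intros)
  then show ?thesis
    using assms ty_stk_closed(1)[OF assms(1), of Suc] ty_stk_cmd[OF assms(1)]
    by (auto intro!: eq_sym_ctxt[OF eq_expand_ctxt] ty_MtN ty_Stk)
qed

text \<open>Composition wraps the value command in a \<mu>. The eta law strips it, and the remaining
  cut of \<open>V\<close> against the binder of \<open>c\<close> is a redex at either
  polarity.\<close>

lemma comp_val_cmd:
  assumes "ty_val \<Gamma> V B" "ty_cmd [B] c C"
  shows "eq_cmd \<Gamma> (comp_cmd (pol B) (val_cmd (pol B) V) c) (inst_v c V) C"
proof (cases "pol B")
  case Pos
  have "eq_cmd \<Gamma> (CutP (MuP (CutP (Val V) (Covar 0))) (MtP c)) (CutP (Val V) (MtP c)) C"
    using assms Pos by (intro eq_cut_closed(1) eta_MuP eq_refl_stk ty_MtP)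
  then show ?thesis
    using eq_trans_cmd[OF _ beta_v(1)[OF assms(2,1) Pos]] Pos by simp
next
  case Neg
  have "eq_cmd \<Gamma> (CutN (MuN (CutN V (Stk (Covar 0)))) (MtN c)) (CutN V (MtN c)) C"
    using assms Neg by (intro eq_cut_closed(2) eta_MuN eq_refl_ctxt ty_MtN)
  then show ?thesis
    using eq_trans_cmd[OF _ beta_v(2)[OF assms(2,1) Neg]] Neg by simp
qed

text \<open>Here eta strips the variable binder around the stack command, which leaves the \<mu> of
  \<open>c\<close> directly against \<open>S\<close>.\<close>

lemma comp_stk_cmd:
  assumes "ty_cmd \<Gamma> c A" "ty_stk [] S A B"
  shows "eq_cmd \<Gamma> (comp_cmd (pol A) c (stk_cmd (pol A) S)) (inst_k c S) B"
proof (cases "pol A")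
  case Pos
  have "eq_cmd \<Gamma> (CutP (MuP c) (MtP (CutP (Val (Var 0)) S))) (CutP (MuP c) S) B"
    using assms Pos by (intro eq_cut_closed(1) eta_MtP eq_refl_expr ty_MuP)
  then show ?thesis
    using eq_trans_cmd[OF _ beta_k(1)[OF assms Pos]] Pos by simp
next
  case Neg
  have "eq_cmd \<Gamma> (CutN (MuN c) (MtN (CutN (Var 0) (Stk S)))) (CutN (MuN c) (Stk S)) B"
    using assms Neg by (intro eq_cut_closed(2) eta_MtN eq_refl_val ty_MuN)
  then show ?thesis
    using eq_trans_cmd[OF _ beta_k(2)[OF assms Neg]] Neg by simp
qed

lemma inst_v_Var [simp]: "ty_cmd [A] c B \<Longrightarrow> inst_v c (Var 0) = c"
  unfolding inst_v_def by (rule ty_sub_trivial) auto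

lemma inst_k_Covar [simp]: "ty_cmd \<Gamma> c B \<Longrightarrow> inst_k c (Covar 0) = c"
  unfolding inst_k_def by (rule ty_sub_trivial) auto

text \<open>The composition binds the only variable of \<open>d\<close>, so \<open>V\<close> goes
  into \<open>c\<close> alone. This is the syntactic content of thunkability for value
  morphisms.\<close>

lemma inst_v_comp_cmd:
  assumes "ty_val \<Gamma> V A" "ty_cmd [A] c B" "ty_cmd [B] d C"
  shows "inst_v (comp_cmd p c d) V = comp_cmd p (inst_v c V) d"
proof -
  have "sub_cmd (liftk_val (case_nat V Var)) Covar c = sub_cmd (case_nat V Var) Covar c"
    using ty_val_ren_covar(1)[OF assms(1)] by (intro ty_sub_cong(3)[OF assms(2)]) auto
  moreover have "sub_cmd (liftv_val (case_nat V Var)) Covar d = d"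
    by (rule ty_sub_trivial[OF assms(3)]) auto
  ultimately show ?thesis by (cases p) (simp_all add: inst_v_def)
qed

text \<open>The composition binds the only co-variable of \<open>c\<close>, so \<open>S\<close> goes
  into \<open>d\<close> alone; this gives linearity of stack morphisms.\<close>

lemma inst_k_comp_cmd:
  assumes "ty_stk [] S B C" "ty_cmd \<Gamma> c A" "ty_cmd [A] d B"
  shows "inst_k (comp_cmd p c d) S = comp_cmd p c (inst_k d S)"
proof -
  have "sub_cmd Var (liftv_stk (case_nat S Covar)) d = sub_cmd Var (case_nat S Covar) d"
    using ty_stk_closed(1)[OF assms(1)] by (intro ty_sub_cong(3)[OF assms(3)]) auto
  moreover have "sub_cmd Var (liftk_stk (case_nat S Covar)) c = c"
    by (rule ty_sub_trivial[OF assms(2)]) auto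
  ultimately show ?thesis by (cases p) (simp_all add: inst_k_def)
qed

section \<open>Cancellation laws from the expansions at 1, \<otimes> and \<multimap>\<close>

text \<open>Cutting a variable against \<open>S\<close> gives it the last index of the joint
  context; exchange brings it to index 0, where the unit laws below expect it.\<close>

lemma structural_rotate:
  "structural (\<Gamma> @ [A]) (\<lambda>i. if i < length \<Gamma> then Suc i else 0) (A # \<Gamma>)"
proof -
  have "inj_on (\<lambda>i. if i < length \<Gamma> then Suc i else 0) {..<Suc (length \<Gamma>)}"
    by (auto simp: inj_on_def)
  moreover have "lin (\<Gamma> @ [A]) \<subseteq> {..<Suc (length \<Gamma>)}"
    by (auto simp: lin_def)
  moreover have "(\<lambda>i. if i < length \<Gamma> then Suc i else 0) ` lin (\<Gamma> @ [A]) = lin (A # \<Gamma>)"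
  proof -
    have "(\<lambda>i. if i < length \<Gamma> then Suc i else 0) ` lin \<Gamma> = Suc ` lin \<Gamma>"
      by (intro image_cong) (auto simp: lin_def)
    then show ?thesis by (auto simp: lin_append bindu_def image_Un)
  qed
  ultimately show ?thesis
    unfolding structural_def lin_def[symmetric]
    by (auto simp: bij_betw_def nth_append less_Suc_eq intro: inj_on_subset)
qed

lemma ty_cut_head:
  assumes "ty_stk \<Gamma> S A B" "pol A = Pos"
  shows "ty_cmd (A # \<Gamma>) (CutP (Val (Var 0)) (ren_stk Suc id S)) B"
proof -
  have "ty_cmd (\<Gamma> @ [A]) (CutP (shift_expr \<Gamma> (Val (Var 0))) S) B"
    by (rule ty_CutP[OF ty_Val[OF ty_Var] assms])
  from ty_struct_cmd[OF this structural_rotate] show ?thesis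
    using ty_ren_cong(2)[OF assms(1), of "\<lambda>i. if i < length \<Gamma> then Suc i else 0" Suc id id]
    by simp
qed

lemma eq_cut_head:
  assumes "eq_stk \<Gamma> S S' A B" "pol A = Pos"
  shows "eq_cmd (A # \<Gamma>) (CutP (Val (Var 0)) (ren_stk Suc id S)) (CutP (Val (Var 0)) (ren_stk Suc id S')) B"
proof -
  have "eq_cmd (\<Gamma> @ [A]) (CutP (shift_expr \<Gamma> (Val (Var 0))) S) (CutP (shift_expr \<Gamma> (Val (Var 0))) S') B"
    by (rule eq_CutP[OF eq_refl_expr[OF ty_Val[OF ty_Var]] assms])
  from eq_struct_cmd[OF this structural_rotate] show ?thesis
    using assms(1)[THEN eq_imp_ty(2)] ty_ren_cong(2)[of \<Gamma> _ A B "\<lambda>i. if i < length \<Gamma> then Suc i else 0" Suc id id]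
    by simp
qed

text \<open>The stack \<open>MtP d\<close> expands at type 1 to a match on () whose body contracts
  to the instance of \<open>d\<close> at (). Cutting both stacks with the head variable returns
  \<open>d\<close> on one side.\<close>

lemma unit_eta:
  assumes "ty_cmd (TOne # \<Gamma>) d B"
  shows "eq_cmd (TOne # \<Gamma>) d (CutP (Val (Var 0)) (MtUnit (ren_cmd Suc id (inst_v d VUnit)))) B"
proof -
  have S: "ty_stk \<Gamma> (MtP d) TOne B"
    using assms by (auto intro: ty_MtP)
  have cut: "ty_cmd \<Gamma> (CutP (Val VUnit) (MtP d)) B"
    using ty_CutP[OF ty_Val[OF ty_VUnit] S] by simp
  have "eq_cmd \<Gamma> (CutP (Val VUnit) (MtP d)) (inst_v d VUnit) B"
    using cut assms by (auto intro!: eq_red red.intros ty_inst_v_closed ty_VUnit)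
  then have "eq_stk \<Gamma> (MtUnit (CutP (Val VUnit) (MtP d))) (MtUnit (inst_v d VUnit)) TOne B"
    by (rule eq_MtUnit)
  moreover have "eq_stk \<Gamma> (MtP d) (MtUnit (CutP (Val VUnit) (MtP d))) TOne B"
    using S cut by (intro eq_expand_stk expand_stk.intros(2) ty_MtUnit)
  ultimately have "eq_stk \<Gamma> (MtP d) (MtUnit (inst_v d VUnit)) TOne B"
    by (rule eq_trans_stk[rotated])
  from eq_cut_head[OF this] have 1: "eq_cmd (TOne # \<Gamma>) (CutP (Val (Var 0)) (ren_stk Suc id (MtP d)))
      (CutP (Val (Var 0)) (MtUnit (ren_cmd Suc id (inst_v d VUnit)))) B"
    by simp
  have "inst_v (ren_cmd (up Suc) id d) (Var 0) = d"
    unfolding inst_v_def sub_ren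
    by (rule ty_sub_trivial[OF assms]) (auto simp: up_def split: nat.splits)
  then have "red (CutP (Val (Var 0)) (ren_stk Suc id (MtP d))) d"
    using red.intros(1)[of "Var 0" "ren_cmd (up Suc) id d"] by simp
  then have "eq_cmd (TOne # \<Gamma>) (CutP (Val (Var 0)) (ren_stk Suc id (MtP d))) d B"
    using ty_cut_head[OF S] assms by (auto intro: eq_red)
  then show ?thesis using 1 eq_sym_cmd eq_trans_cmd by blast
qed

lemma unit_cancel:
  assumes "ty_cmd (TOne # \<Gamma>) d B" "ty_cmd (TOne # \<Gamma>) d' B"
    and "eq_cmd \<Gamma> (inst_v d VUnit) (inst_v d' VUnit) B"
  shows "eq_cmd (TOne # \<Gamma>) d d' B"
  using eq_cmd_conv[OF unit_eta[OF assms(1)] unit_eta[OF assms(2)]]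
    eq_cut_head[OF eq_MtUnit[OF assms(3)]] by simp

lemma ty_pair: "ty_val [B, A] (VTensor (Var 1) (Var 0)) (TTensor A B)"
  using ty_VTensor[OF ty_Var ty_Var, of B A] by simp

lemma tensor_eta:
  assumes "ty_cmd [TTensor A B] c C"
  shows "eq_cmd [TTensor A B] c
    (CutP (Val (Var 0)) (MtTensor (inst_v c (VTensor (Var 1) (Var 0))))) C"
proof -
  let ?V = "VTensor (Var 1) (Var 0)"
  have S: "ty_stk [] (MtP c) (TTensor A B) C"
    using assms by (auto intro: ty_MtP)
  have cut: "ty_cmd [B, A] (CutP (Val ?V) (MtP c)) C"
    using ty_cut_closed(1)[OF ty_Val[OF ty_pair] S] by simp
  have "eq_cmd [B, A] (CutP (Val ?V) (MtP c)) (inst_v c ?V) C"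
    using beta_v(1)[OF assms ty_pair] by simp
  moreover have "expand_stk (length []) (TTensor A B) (MtP c) (MtTensor (CutP (Val ?V) (MtP c)))"
    using expand_stk.intros(3)[of "length []" A B "MtP c"] by (simp only: ty_stk_closed(1)[OF S])
  ultimately have "eq_stk [] (MtP c) (MtTensor (inst_v c ?V)) (TTensor A B) C"
    using S cut eq_trans_stk[OF eq_expand_stk eq_MtTensor] ty_MtTensor by blast
  then have "eq_cmd [TTensor A B] (CutP (Val (Var 0)) (MtP c)) (CutP (Val (Var 0)) (MtTensor (inst_v c ?V))) C"
    by (auto intro!: eq_cut_closed eq_refl_expr ty_Val ty_Var)
  moreover have "eq_cmd [TTensor A B] (CutP (Val (Var 0)) (MtP c)) c C"
    using beta_v(1)[OF assms ty_Var] assms by simp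
  ultimately show ?thesis using eq_sym_cmd eq_trans_cmd by blast
qed

text \<open>In the body of a match on u \<otimes> x the unit u has index 1, whereas
  \<open>unit_cancel\<close> acts on index 0; exchange mediates.\<close>

lemma structural_swap: "structural [A, B] (case_nat 1 (\<lambda>_. 0)) [B, A]"
  unfolding structural_def lin_def[symmetric]
  by (auto simp: bij_betw_def inj_on_def less_Suc_eq bindu_def numeral_2_eq_2)

text \<open>The map \<open>x \<mapsto> () \<otimes> x\<close> is epi.\<close>

lemma down_cancel:
  assumes "ty_cmd [down N] c B" "ty_cmd [down N] c' B"
    and "eq_cmd [N] (inst_v c (VTensor VUnit (Var 0))) (inst_v c' (VTensor VUnit (Var 0))) B"
  shows "eq_cmd [down N] c c' B"
proof -
  let ?\<sigma> = "case_nat 1 (\<lambda>_. 0) :: nat \<Rightarrow> nat" and ?V = "VTensor (Var 0) (Var (Suc 0))"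
  have V: "ty_val [TOne, N] ?V (down N)"
    using ty_struct_val[OF ty_pair[of N TOne] structural_swap] by (simp add: down_def)
  have unit: "inst_v (inst_v d ?V) VUnit = inst_v d (VTensor VUnit (Var 0))"
    and swap: "ren_cmd ?\<sigma> id (inst_v d ?V) = inst_v d (VTensor (Var 1) (Var 0))"
    if "ty_cmd [down N] d B" for d
    unfolding inst_v_def sub_sub ren_sub by (rule ty_sub_cong(3)[OF that]; simp)+
  \<comment> \<open>Cancelling the unit component leaves the instances at () \<otimes> x, which are
    equal by assumption.\<close>
  have "eq_cmd [TOne, N] (inst_v c ?V) (inst_v c' ?V) B"
    using assms by (intro unit_cancel ty_inst_v[OF _ V]) (simp_all add: unit)
  then have "eq_cmd [N, TOne] (inst_v c (VTensor (Var 1) (Var 0))) (inst_v c' (VTensor (Var 1) (Var 0))) B"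
    using eq_struct_cmd[OF _ structural_swap] assms(1,2) by (metis swap)
  then have "eq_cmd [down N] (CutP (Val (Var 0)) (MtTensor (inst_v c (VTensor (Var 1) (Var 0)))))
      (CutP (Val (Var 0)) (MtTensor (inst_v c' (VTensor (Var 1) (Var 0))))) B"
    unfolding down_def
    by (intro eq_cut_closed(1)[OF eq_refl_expr[OF ty_Val[OF ty_Var]] eq_MtTensor]) simp_all
  then show ?thesis
    using eq_cmd_conv[OF tensor_eta tensor_eta] assms(1,2) by (simp add: down_def)
qed

text \<open>The map \<open>z \<mapsto> \<langle>z \<parallel> () \<cdot> \<alpha>\<rangle>\<close> is mono.\<close>

lemma up_cancel:
  assumes "ty_cmd \<Gamma> c (shift_up P)" "ty_cmd \<Gamma> c' (shift_up P)"
    and "eq_cmd \<Gamma> (inst_k c (Push VUnit (Covar 0))) (inst_k c' (Push VUnit (Covar 0))) P"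
  shows "eq_cmd \<Gamma> c c' (shift_up P)"
proof -
  \<comment> \<open>\<open>?d c\<close> is \<open>c\<close> run against x \<cdot> \<alpha> for a
    fresh x of type 1, that is, the contracted body of its expansion at 1 \<multimap> P.\<close>
  let ?S = "Push (Var 0) (Covar 0)" and ?d = "\<lambda>c. inst_k (ren_cmd Suc id c) (Push (Var 0) (Covar 0))"
  have S: "ty_stk [TOne] ?S (shift_up P) P"
    using ty_Push[OF ty_Var ty_Covar, of TOne P] by (simp add: shift_up_def)
  have d: "ty_cmd (TOne # \<Gamma>) (?d c) P" if "ty_cmd \<Gamma> c (shift_up P)" for c
    using ty_inst_k[OF that S] by simp
  have unit: "inst_v (?d c) VUnit = inst_k c (Push VUnit (Covar 0))" if "ty_cmd \<Gamma> c (shift_up P)" for c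
    unfolding inst_v_def inst_k_def sub_sub sub_ren by (rule ty_sub_cong(3)[OF that]) simp_all
  have eta: "eq_cmd \<Gamma> c (CutN (MuFun (?d c)) (Stk (Covar 0))) (shift_up P)"
    if c: "ty_cmd \<Gamma> c (shift_up P)" for c
  proof -
    have V: "ty_val \<Gamma> (MuN c) (shift_up P)"
      using c by (auto intro: ty_MuN simp: shift_up_def)
    have cut: "ty_cmd (TOne # \<Gamma>) (CutN (ren_val Suc Suc (MuN c)) (Stk ?S)) P"
      using ty_CutN[OF V ty_Stk[OF S]] ty_val_ren_covar(2)[OF V, of Suc Suc]
      by (simp add: shift_up_def)
    \<comment> \<open>The expansion also shifts co-variables, but the only one of \<open>c\<close>
      is bound by its \<mu> and stays at index 0.\<close>
    have "inst_k (ren_cmd Suc (up Suc) c) ?S = ?d c"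
      unfolding inst_k_def sub_ren by (rule ty_sub_cong(3)[OF c]) simp_all
    then have "red (CutN (ren_val Suc Suc (MuN c)) (Stk ?S)) (?d c)"
      using red.intros(4)[of "ren_cmd Suc (up Suc) c" ?S] by simp
    then have "eq_cmd (TOne # \<Gamma>) (CutN (ren_val Suc Suc (MuN c)) (Stk ?S)) (?d c) P"
      using cut d[OF c] by (rule eq_red)
    then have "eq_val \<Gamma> (MuFun (CutN (ren_val Suc Suc (MuN c)) (Stk ?S))) (MuFun (?d c)) (shift_up P)"
      unfolding shift_up_def by (rule eq_MuFun)
    moreover have "eq_val \<Gamma> (MuN c) (MuFun (CutN (ren_val Suc Suc (MuN c)) (Stk ?S))) (shift_up P)"
      using V cut unfolding shift_up_def by (intro eq_expand_val expand_val.intros(2) ty_MuFun)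
    ultimately have "eq_val \<Gamma> (MuN c) (MuFun (?d c)) (shift_up P)"
      by (rule eq_trans_val[rotated])
    then have "eq_cmd \<Gamma> (CutN (MuN c) (Stk (Covar 0))) (CutN (MuFun (?d c)) (Stk (Covar 0))) (shift_up P)"
      using eq_val_cmd[of \<Gamma> _ _ "shift_up P"] by (simp add: shift_up_def)
    moreover have "eq_cmd \<Gamma> (CutN (MuN c) (Stk (Covar 0))) c (shift_up P)"
      using beta_k(2)[OF c ty_Covar] c by (simp add: shift_up_def)
    ultimately show ?thesis using eq_sym_cmd eq_trans_cmd by blast
  qed
  have "eq_cmd (TOne # \<Gamma>) (?d c) (?d c') P"
    using assms by (intro unit_cancel d) (simp_all add: unit)
  then have "eq_cmd \<Gamma> (CutN (MuFun (?d c)) (Stk (Covar 0))) (CutN (MuFun (?d c')) (Stk (Covar 0))) (shift_up P)"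
    using eq_val_cmd[OF eq_MuFun] by (simp add: shift_up_def)
  then show ?thesis
    by (rule eq_cmd_conv[OF eta[OF assms(1)] eta[OF assms(2)]])
qed

section \<open>The non-associative category\<close>

abbreviation "H \<equiv> Hom Dcat"
abbreviation "cmp \<equiv> Comp Dcat"
abbreviation "idn \<equiv> Idn Dcat"

lemma equiv_eqv: "equiv (cmds A B) (eqv A B)"
proof (rule equivI)
  show "eqv A B \<subseteq> cmds A B \<times> cmds A B"
    using eq_imp_ty(5) by (auto simp: eqv_def cmds_def)
  show "refl_on (cmds A B) (eqv A B)"
    by (auto simp: refl_on_def eqv_def cmds_def intro: eq_refl_cmd)
  show "sym (eqv A B)"
    by (auto simp: sym_def eqv_def intro: eq_sym_cmd)
  show "trans (eqv A B)"
    by (auto simp: trans_def eqv_def intro: eq_trans_cmd)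
qed

lemma mem_cls_iff: "d \<in> cls A B c \<longleftrightarrow> eq_cmd [A] c d B"
  by (simp add: cls_def eqv_def)

lemma cls_eqI: "eq_cmd [A] c d B \<Longrightarrow> cls A B c = cls A B d"
  unfolding cls_def by (rule equiv_class_eq[OF equiv_eqv]) (simp add: eqv_def)

text \<open>Typing makes the class of \<open>d\<close> nonempty, which excludes that the classes
  agree merely by both being empty.\<close>

lemma cls_eqD: "ty_cmd [A] d B \<Longrightarrow> cls A B c = cls A B d \<Longrightarrow> eq_cmd [A] c d B"
  using mem_cls_iff[of d A B d] mem_cls_iff[of d A B c] eq_refl_cmd by simp

lemma cls_in_H: "ty_cmd [A] c B \<Longrightarrow> cls A B c \<in> H A B"
  by (auto simp: Dcat_def cls_def cmds_def intro: quotientI)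

lemma H_cases:
  assumes "f \<in> H A B"
  obtains c where "ty_cmd [A] c B" "f = cls A B c"
  using assms by (auto simp: Dcat_def cls_def cmds_def elim: quotientE)

text \<open>The class contains its representative, so this is a union of a constant family over a
  nonempty set. It evaluates every operation defined through representatives.\<close>

lemma UN_cls:
  assumes "ty_cmd [A] c B" "\<And>d. eq_cmd [A] c d B \<Longrightarrow> F d = F c"
  shows "(\<Union>d\<in>cls A B c. F d) = F c"
proof -
  have "c \<in> cls A B c" using assms(1) by (simp add: mem_cls_iff eq_refl_cmd)
  moreover have "F d = F c" if "d \<in> cls A B c" for d
    using that assms(2) by (simp add: mem_cls_iff)
  ultimately show ?thesis by blast
qed

lemma cmp_cls:
  assumes "ty_cmd [A] c B" "ty_cmd [B] d C"
  shows "cmp A B C (cls B C d) (cls A B c) = cls A C (comp_cmd (pol B) c d)"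
proof -
  have "(\<Union>d'\<in>cls B C d. cls A C (comp_cmd (pol B) c' d')) = cls A C (comp_cmd (pol B) c' d)"
    if "ty_cmd [A] c' B" for c'
    by (rule UN_cls[OF assms(2)])
      (rule cls_eqI[OF eq_sym_cmd[OF eq_comp_cmd[OF eq_refl_cmd[OF that]]]])
  moreover have "(\<Union>c'\<in>cls A B c. cls A C (comp_cmd (pol B) c' d)) = cls A C (comp_cmd (pol B) c d)"
    by (rule UN_cls[OF assms(1)])
      (rule cls_eqI[OF eq_sym_cmd[OF eq_comp_cmd[OF _ eq_refl_cmd[OF assms(2)]]]])
  moreover have "ty_cmd [A] c' B" if "c' \<in> cls A B c" for c'
    using that eq_imp_ty(5) by (simp add: mem_cls_iff)
  ultimately show ?thesis by (simp add: Dcat_def)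
qed

lemma cmp_in_H: "f \<in> H A B \<Longrightarrow> g \<in> H B C \<Longrightarrow> cmp A B C g f \<in> H A C"
  by (elim H_cases) (simp add: cmp_cls cls_in_H ty_comp_cmd)

section \<open>Morphisms given by a value or by a stack\<close>

definition vmor :: "ty \<Rightarrow> ty \<Rightarrow> val \<Rightarrow> cmd set" where
  "vmor A B V = cls A B (val_cmd (pol B) V)"

definition smor :: "ty \<Rightarrow> ty \<Rightarrow> stk \<Rightarrow> cmd set" where
  "smor A B S = cls A B (stk_cmd (pol A) S)"

lemma UN_vmor:
  assumes "ty_cmd [A] c B" "\<And>d. eq_cmd [A] c d B \<Longrightarrow> eq_val [X] (V c) (V d) Y"
  shows "(\<Union>d\<in>cls A B c. vmor X Y (V d)) = vmor X Y (V c)"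
  unfolding vmor_def
  by (rule UN_cls[OF assms(1)]) (rule cls_eqI[OF eq_sym_cmd[OF eq_val_cmd[OF assms(2)]]])

lemma UN_smor:
  assumes "ty_cmd [A] c B" "\<And>d. eq_cmd [A] c d B \<Longrightarrow> eq_stk [] (S c) (S d) X Y"
  shows "(\<Union>d\<in>cls A B c. smor X Y (S d)) = smor X Y (S c)"
  unfolding smor_def
  by (rule UN_cls[OF assms(1)]) (rule cls_eqI[OF eq_sym_cmd[OF eq_stk_cmd[OF assms(2)]]])

lemma idn_eq: "idn A = vmor A A (Var 0)" "idn A = smor A A (Covar 0)"
  by (simp_all add: Dcat_def vmor_def smor_def id_cmd_eq(1)) (metis id_cmd_eq)

lemma vmor_in_H: "ty_val [A] V B \<Longrightarrow> vmor A B V \<in> H A B"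
  unfolding vmor_def by (intro cls_in_H ty_val_cmd)

lemma smor_in_H: "ty_stk [] S A B \<Longrightarrow> smor A B S \<in> H A B"
  unfolding smor_def by (intro cls_in_H ty_stk_cmd)

lemma idn_in_H: "idn A \<in> H A A"
  unfolding idn_eq(1) by (intro vmor_in_H ty_Var)

lemma cmp_vmor:
  "ty_val [A] V B \<Longrightarrow> ty_cmd [B] c C \<Longrightarrow> cmp A B C (cls B C c) (vmor A B V) = cls A C (inst_v c V)"
  by (simp add: vmor_def cmp_cls ty_val_cmd cls_eqI[OF comp_val_cmd])

lemma cmp_smor:
  "ty_cmd [A] c B \<Longrightarrow> ty_stk [] S B C \<Longrightarrow> cmp A B C (smor B C S) (cls A B c) = cls A C (inst_k c S)"
  by (simp add: smor_def cmp_cls ty_stk_cmd cls_eqI[OF comp_stk_cmd])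

lemma cmp_idn_right: "f \<in> H A B \<Longrightarrow> cmp A A B f (idn A) = f"
  by (elim H_cases) (simp add: idn_eq(1) cmp_vmor ty_Var)

lemma cmp_idn_left: "f \<in> H A B \<Longrightarrow> cmp A B B (idn B) f = f"
  by (elim H_cases) (simp add: idn_eq(2) cmp_smor ty_Covar)

abbreviation "thunkable \<equiv> thunkable_mor Dcat"
abbreviation "linear \<equiv> linear_mor Dcat"

lemma thunk_assoc:
  "thunkable A B f \<Longrightarrow> g \<in> H B C \<Longrightarrow> h \<in> H C D \<Longrightarrow>
    cmp A B D (cmp B C D h g) f = cmp A C D h (cmp A B C g f)"
  by (auto simp: thunkable_mor_def Dcat_def)

lemma lin_assoc:
  "linear C D h \<Longrightarrow> f \<in> H A B \<Longrightarrow> g \<in> H B C \<Longrightarrow>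
    cmp A B D (cmp B C D h g) f = cmp A C D h (cmp A B C g f)"
  by (auto simp: linear_mor_def Dcat_def)

lemma thunkableI:
  "(\<And>C D g h. g \<in> H B C \<Longrightarrow> h \<in> H C D \<Longrightarrow>
    cmp A B D (cmp B C D h g) f = cmp A C D h (cmp A B C g f)) \<Longrightarrow> thunkable A B f"
  by (auto simp: thunkable_mor_def)

lemma linearI:
  "(\<And>A B f g. f \<in> H A B \<Longrightarrow> g \<in> H B C \<Longrightarrow>
    cmp A B D (cmp B C D h g) f = cmp A C D h (cmp A B C g f)) \<Longrightarrow> linear C D h"
  by (auto simp: linear_mor_def)

lemma thunkable_vmor:
  assumes V: "ty_val [A] V B"
  shows "thunkable A B (vmor A B V)"
proof (rule thunkableI)
  fix C D g h
  assume "g \<in> H B C" "h \<in> H C D"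
  then obtain c d where c: "ty_cmd [B] c C" "g = cls B C c" and d: "ty_cmd [C] d D" "h = cls C D d"
    by (elim H_cases)
  show "cmp A B D (cmp B C D h g) (vmor A B V) = cmp A C D h (cmp A B C g (vmor A B V))"
    using V c(1) d(1) unfolding c(2) d(2)
    by (simp add: cmp_cls cmp_vmor ty_comp_cmd ty_inst_v inst_v_comp_cmd)
qed

lemma linear_smor:
  assumes S: "ty_stk [] S C D"
  shows "linear C D (smor C D S)"
proof (rule linearI)
  fix A B f g
  assume "f \<in> H A B" "g \<in> H B C"
  then obtain c d where c: "ty_cmd [A] c B" "f = cls A B c" and d: "ty_cmd [B] d C" "g = cls B C d"
    by (elim H_cases)
  show "cmp A B D (cmp B C D (smor C D S) g) f = cmp A C D (smor C D S) (cmp A B C g f)"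
    using S c(1) d(1) unfolding c(2) d(2)
    by (simp add: cmp_cls cmp_smor ty_comp_cmd ty_inst_k_closed inst_k_comp_cmd)
qed

text \<open>By beta, a command with positive input x equals the cut of x against the stack that
  binds x, so every morphism with positive source is a stack morphism.\<close>

lemma linear_Pos:
  assumes "pol A = Pos" "f \<in> H A B"
  shows "linear A B f"
proof -
  obtain c where c: "ty_cmd [A] c B" "f = cls A B c"
    using assms(2) by (elim H_cases)
  have "f = smor A B (MtP c)"
    using beta_v(1)[OF c(1) ty_Var assms(1)] c assms(1)
    by (auto simp: smor_def intro!: cls_eqI eq_sym_cmd)
  then show ?thesis using c(1) assms(1) by (simp add: linear_smor ty_MtP)
qed

section \<open>The categories of thunkable and of linear morphisms\<close>

lemma thunkable_cmp:
  assumes "f \<in> H A B" "g \<in> H B C" "thunkable A B f" "thunkable B C g"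
  shows "thunkable A C (cmp A B C g f)"
proof (rule thunkableI)
  fix D E h k
  assume "h \<in> H C D" "k \<in> H D E"
  then show "cmp A C E (cmp C D E k h) (cmp A B C g f) = cmp A D E k (cmp A C D h (cmp A B C g f))"
    using assms by (metis thunk_assoc cmp_in_H)
qed

lemma linear_cmp:
  assumes "f \<in> H A B" "g \<in> H B C" "linear A B f" "linear B C g"
  shows "linear A C (cmp A B C g f)"
proof (rule linearI)
  fix D E h k
  assume "h \<in> H D E" "k \<in> H E A"
  then show "cmp D E C (cmp E A C (cmp A B C g f) k) h = cmp D A C (cmp A B C g f) (cmp D E A k h)"
    using assms by (metis lin_assoc cmp_in_H)
qed

lemma Pt_simps [simp]:
  "Ob Pt = {A. pol A = Pos}" "Hom Pt A B = {f \<in> H A B. thunkable A B f}" "Idn Pt = idn" "Comp Pt = cmp"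
  by (simp_all add: Pt_def Dcat_def)

lemma Nl_simps [simp]:
  "Ob Nl = {A. pol A = Neg}" "Hom Nl A B = {f \<in> H A B. linear A B f}" "Idn Nl = idn" "Comp Nl = cmp"
  by (simp_all add: Nl_def Dcat_def)

lemma category_Pt: "category Pt"
proof
  show "Idn Pt X \<in> Hom Pt X X" for X
    using thunkable_vmor[OF ty_Var] idn_in_H by (simp add: idn_eq(1))
qed (auto simp: cmp_in_H thunkable_cmp cmp_idn_left cmp_idn_right thunk_assoc)

lemma category_Nl: "category Nl"
proof
  show "Idn Nl X \<in> Hom Nl X X" for X
    using linear_smor[OF ty_Covar] idn_in_H by (simp add: idn_eq(2))
qed (auto simp: cmp_in_H linear_cmp cmp_idn_left cmp_idn_right lin_assoc)

section \<open>The shifts\<close>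

lemma red_eq:
  "red c c' \<Longrightarrow> ty_cmd \<Gamma> c B \<Longrightarrow> ty_cmd \<Gamma> c' B \<Longrightarrow> eq_cmd \<Gamma> c' d B \<Longrightarrow> eq_cmd \<Gamma> c d B"
  by (rule eq_trans_cmd[OF eq_red])

definition theta :: "ty \<Rightarrow> cmd set" where
  "theta N = vmor N (down N) (VTensor VUnit (Var 0))"

text \<open>The \<pi> of the overview: match on u \<otimes> x, consume the unit u, return x. The
  pair binder gives u index 1 and x index 0, and the match on () binds nothing.\<close>

definition proj :: "ty \<Rightarrow> cmd set" where
  "proj N = smor (down N) N (MtTensor (CutP (Val (Var 1)) (MtUnit (CutN (Var 0) (Stk (Covar 0))))))"

definition lam :: "ty \<Rightarrow> cmd set" where
  "lam P = smor (shift_up P) P (Push VUnit (Covar 0))"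

text \<open>The \<kappa> of the overview: a function that consumes its unit argument and returns x.
  The argument has index 0, which moves x to index 1.\<close>

definition kap :: "ty \<Rightarrow> cmd set" where
  "kap P = vmor P (shift_up P)
     (MuFun (CutP (Val (Var 0)) (MtUnit (CutP (Val (Var 1)) (Covar 0)))))"

lemma pol_shift [simp]: "pol (down N) = Pos" "pol (shift_up P) = Neg"
  by (simp_all add: down_def shift_up_def)

lemma ty_unit_tensor: "ty_val \<Gamma> V N \<Longrightarrow> ty_val \<Gamma> (VTensor VUnit V) (down N)"
  using ty_VTensor[OF ty_VUnit, of \<Gamma> V N] by (simp add: down_def)

lemma ty_unit_push: "ty_stk \<Gamma> S P B \<Longrightarrow> ty_stk \<Gamma> (Push VUnit S) (shift_up P) B"
  using ty_Push[OF ty_VUnit, of \<Gamma> S P B] by (simp add: shift_up_def)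

lemma ty_proj:
  assumes "pol N = Neg"
  shows "ty_stk [] (MtTensor (CutP (Val (Var 1)) (MtUnit (CutN (Var 0) (Stk (Covar 0)))))) (down N) N"
proof -
  have "ty_cmd ([N] @ [TOne]) (CutP (shift_expr [N] (Val (Var 0))) (MtUnit (id_cmd (pol N)))) N"
    by (rule ty_CutP[OF ty_Val[OF ty_Var] ty_MtUnit[OF ty_id_cmd]]) simp
  then show ?thesis using assms by (auto simp: down_def intro: ty_MtTensor)
qed

lemma ty_kap:
  assumes "pol P = Pos"
  shows "ty_val [P] (MuFun (CutP (Val (Var 0)) (MtUnit (CutP (Val (Var 1)) (Covar 0))))) (shift_up P)"
proof -
  have "ty_stk [P] (MtUnit (id_cmd (pol P))) TOne P"
    by (intro ty_MtUnit ty_id_cmd)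
  then show ?thesis
    using ty_cut_head assms by (fastforce simp: shift_up_def intro: ty_MuFun)
qed

lemma theta_in_H: "theta N \<in> H N (down N)"
  and theta_thunkable: "thunkable N (down N) (theta N)"
  unfolding theta_def by (intro vmor_in_H thunkable_vmor ty_unit_tensor ty_Var)+

lemma proj_in_H: "pol N = Neg \<Longrightarrow> proj N \<in> H (down N) N"
  and proj_linear: "pol N = Neg \<Longrightarrow> linear (down N) N (proj N)"
  unfolding proj_def by (intro smor_in_H linear_smor ty_proj; assumption)+

lemma lam_in_H: "lam P \<in> H (shift_up P) P"
  and lam_linear: "linear (shift_up P) P (lam P)"
  unfolding lam_def by (intro smor_in_H linear_smor ty_unit_push ty_Covar)+

lemma kap_in_H: "pol P = Pos \<Longrightarrow> kap P \<in> H P (shift_up P)"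
  and kap_thunkable: "pol P = Pos \<Longrightarrow> thunkable P (shift_up P) (kap P)"
  unfolding kap_def by (intro vmor_in_H thunkable_vmor ty_kap; assumption)+

lemma proj_theta:
  assumes "pol N = Neg"
  shows "cmp N (down N) N (proj N) (theta N) = idn N"
proof -
  let ?S = "MtTensor (CutP (Val (Var 1)) (MtUnit (CutN (Var 0) (Stk (Covar 0)))))"
  let ?V = "VTensor VUnit (Var 0)"
  let ?c = "CutP (Val VUnit) (MtUnit (CutN (Var 0) (Stk (Covar 0))))"
  have V: "ty_val [N] ?V (down N)"
    by (intro ty_unit_tensor ty_Var)
  have id: "ty_cmd [N] (CutN (Var 0) (Stk (Covar 0))) N"
    using ty_id_cmd[of N] assms by simp
  have "ty_cmd [N] (CutP (Val ?V) ?S) N"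
    using ty_cut_closed(1)[OF ty_Val[OF V] ty_proj[OF assms]] by simp
  moreover have c: "ty_cmd [N] ?c N"
    using ty_CutP[OF ty_Val[OF ty_VUnit] ty_MtUnit[OF id]] by simp
  moreover have "red (CutP (Val ?V) ?S) ?c"
    using red.intros(6)[of VUnit "Var 0" "CutP (Val (Var 1)) (MtUnit (CutN (Var 0) (Stk (Covar 0))))"]
    by (simp add: inst_vv_def)
  moreover have "eq_cmd [N] ?c (CutN (Var 0) (Stk (Covar 0))) N"
    by (intro eq_red red.intros c id)
  ultimately have *: "eq_cmd [N] (CutP (Val ?V) ?S) (CutN (Var 0) (Stk (Covar 0))) N"
    by (blast intro: red_eq)
  have "cmp N (down N) N (proj N) (theta N) = cls N N (inst_v (CutP (Val (Var 0)) ?S) ?V)"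
    unfolding theta_def proj_def smor_def
    using V ty_stk_cmd[OF ty_proj[OF assms]] by (subst cmp_vmor) auto
  also have "inst_v (CutP (Val (Var 0)) ?S) ?V = CutP (Val ?V) ?S"
    using ty_stk_closed(2)[OF ty_proj[OF assms], of Covar]
    by (simp add: inst_v_def del: sub_stk.simps)
  finally show ?thesis
    using cls_eqI[OF *] assms by (simp add: idn_eq(2) smor_def)
qed

lemma theta_epi:
  assumes "f \<in> H (down N) B" "g \<in> H (down N) B"
    and "cmp N (down N) B f (theta N) = cmp N (down N) B g (theta N)"
  shows "f = g"
proof -
  obtain c d where c: "ty_cmd [down N] c B" "f = cls (down N) B c"
    and d: "ty_cmd [down N] d B" "g = cls (down N) B d"
    using assms(1,2) by (elim H_cases)
  let ?V = "VTensor VUnit (Var 0)"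
  have V: "ty_val [N] ?V (down N)"
    by (intro ty_unit_tensor ty_Var)
  have "cls N B (inst_v c ?V) = cls N B (inst_v d ?V)"
    using assms(3) c d V by (simp add: theta_def cmp_vmor)
  then have "eq_cmd [down N] c d B"
    using c(1) d(1) V by (intro down_cancel cls_eqD ty_inst_v)
  then show ?thesis using c(2) d(2) by (simp add: cls_eqI)
qed

lemma lam_kap:
  assumes "pol P = Pos"
  shows "cmp P (shift_up P) P (lam P) (kap P) = idn P"
proof -
  let ?W = "MuFun (CutP (Val (Var 0)) (MtUnit (CutP (Val (Var 1)) (Covar 0))))"
  let ?c = "CutP (Val VUnit) (MtUnit (CutP (Val (Var 0)) (Covar 0)))"
  have S: "ty_stk [] (Push VUnit (Covar 0)) (shift_up P) P"
    by (intro ty_unit_push ty_Covar)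
  have id: "ty_cmd [P] (CutP (Val (Var 0)) (Covar 0)) P"
    using ty_id_cmd[of P] assms by simp
  have "ty_cmd [P] (CutN ?W (Stk (Push VUnit (Covar 0)))) P"
    using ty_cut_closed(2)[OF ty_kap[OF assms] ty_Stk[OF S]] by simp
  moreover have c: "ty_cmd [P] ?c P"
    using ty_CutP[OF ty_Val[OF ty_VUnit] ty_MtUnit[OF id]] by simp
  moreover have "red (CutN ?W (Stk (Push VUnit (Covar 0)))) ?c"
    using red.intros(9)[of "CutP (Val (Var 0)) (MtUnit (CutP (Val (Var 1)) (Covar 0)))" VUnit "Covar 0"]
    by (simp add: inst_vk_def)
  moreover have "eq_cmd [P] ?c (CutP (Val (Var 0)) (Covar 0)) P"
    by (intro eq_red red.intros c id)
  ultimately have *: "eq_cmd [P] (CutN ?W (Stk (Push VUnit (Covar 0)))) (CutP (Val (Var 0)) (Covar 0)) P"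
    by (blast intro: red_eq)
  have "cmp P (shift_up P) P (lam P) (kap P) = cls P P (inst_v (CutN (Var 0) (Stk (Push VUnit (Covar 0)))) ?W)"
    unfolding kap_def lam_def smor_def
    using ty_kap[OF assms] ty_stk_cmd[OF S] by (subst cmp_vmor) auto
  then show ?thesis
    using cls_eqI[OF *] assms by (simp add: idn_eq(2) smor_def inst_v_def)
qed

lemma lam_mono:
  assumes "f \<in> H A (shift_up P)" "g \<in> H A (shift_up P)"
    and "cmp A (shift_up P) P (lam P) f = cmp A (shift_up P) P (lam P) g"
  shows "f = g"
proof -
  obtain c d where c: "ty_cmd [A] c (shift_up P)" "f = cls A (shift_up P) c"
    and d: "ty_cmd [A] d (shift_up P)" "g = cls A (shift_up P) d"
    using assms(1,2) by (elim H_cases)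
  let ?S = "Push VUnit (Covar 0)"
  have S: "ty_stk [] ?S (shift_up P) P"
    by (intro ty_unit_push ty_Covar)
  have "cls A P (inst_k c ?S) = cls A P (inst_k d ?S)"
    using assms(3) c d S by (simp add: lam_def cmp_smor)
  then have "eq_cmd [A] c d (shift_up P)"
    using c(1) d(1) S by (intro up_cancel cls_eqD ty_inst_k_closed)
  then show ?thesis using c(2) d(2) by (simp add: cls_eqI)
qed

section \<open>Transposition along the shifts\<close>

text \<open>As \<open>M\<close> is negative, the \<mu> binding the output of \<open>c\<close> is a
  value: substituting it for y in () \<otimes> y is a beta step, and the transpose is a value
  morphism, thunkable for every \<open>f\<close>.\<close>

lemma down_transpose_eq:
  assumes "pol M = Neg" "f \<in> H P M"
  shows "down_transpose P M f = cmp P M (down M) (theta M) f"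
    "thunkable P (down M) (down_transpose P M f)"
proof -
  obtain c where c: "ty_cmd [P] c M" "f = cls P M c"
    using assms(2) by (elim H_cases)
  have V: "ty_val [P] (VTensor VUnit (MuN d)) (down M)" if "ty_cmd [P] d M" for d
    using that assms(1) by (intro ty_unit_tensor ty_MuN)
  have "eq_val [P] (VTensor VUnit (MuN c)) (VTensor VUnit (MuN d)) (down M)" if "eq_cmd [P] c d M" for d
    using eq_VTensor[OF eq_refl_val[OF ty_VUnit] eq_MuN[OF that assms(1)]] by (simp add: down_def)
  from UN_vmor[OF c(1), where V = "\<lambda>c. VTensor VUnit (MuN c)", OF this]
  have "down_transpose P M f = vmor P (down M) (VTensor VUnit (MuN c))"
    by (simp add: down_transpose_def c(2) vmor_def)
  moreover have "cmp P M (down M) (theta M) f = vmor P (down M) (VTensor VUnit (MuN c))"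
  proof -
    let ?e = "CutP (Val (VTensor VUnit (Var 0))) (Covar 0)"
    have e: "ty_cmd [M] ?e (down M)"
      using ty_val_cmd[OF ty_unit_tensor[OF ty_Var]] by simp
    have "eq_cmd [P] (comp_cmd (pol M) c ?e) (inst_v ?e (MuN c)) (down M)"
      using beta_v(2)[OF e ty_MuN[OF c(1) assms(1)] assms(1)] assms(1) by simp
    then show ?thesis
      using cls_eqI e c by (simp add: theta_def vmor_def cmp_cls inst_v_def)
  qed
  ultimately show "down_transpose P M f = cmp P M (down M) (theta M) f"
    "thunkable P (down M) (down_transpose P M f)"
    using thunkable_vmor[OF V[OF c(1)]] by simp_all
qed

text \<open>As \<open>P\<close> is positive, the binder of the input of \<open>c\<close> is a stack,
  so it can be substituted for \<alpha> in () \<cdot> \<alpha>, and the transpose is linear for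
  every \<open>f\<close>.\<close>

lemma up_transpose_eq:
  assumes "pol P = Pos" "f \<in> H P N"
  shows "up_transpose P N f = cmp (shift_up P) P N f (lam P)"
    "linear (shift_up P) N (up_transpose P N f)"
proof -
  obtain c where c: "ty_cmd [P] c N" "f = cls P N c"
    using assms(2) by (elim H_cases)
  have S: "ty_stk [] (Push VUnit (MtP c)) (shift_up P) N"
    using c(1) assms(1) by (intro ty_unit_push ty_MtP)
  have "eq_stk [] (Push VUnit (MtP c)) (Push VUnit (MtP d)) (shift_up P) N" if "eq_cmd [P] c d N" for d
    using eq_Push[OF eq_refl_val[OF ty_VUnit] eq_MtP[OF that assms(1)]] by (simp add: shift_up_def)
  from UN_smor[OF c(1), where S = "\<lambda>c. Push VUnit (MtP c)", OF this]
  have "up_transpose P N f = smor (shift_up P) N (Push VUnit (MtP c))"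
    by (simp add: up_transpose_def c(2) smor_def)
  moreover have "cmp (shift_up P) P N f (lam P) = smor (shift_up P) N (Push VUnit (MtP c))"
  proof -
    let ?e = "CutN (Var 0) (Stk (Push VUnit (Covar 0)))"
    have e: "ty_cmd [shift_up P] ?e P"
      using ty_stk_cmd[OF ty_unit_push[OF ty_Covar]] by simp
    have "eq_cmd [shift_up P] (comp_cmd (pol P) ?e c) (inst_k ?e (MtP c)) N"
      using beta_k(1)[OF e ty_MtP[OF c(1) assms(1)] assms(1)] assms(1) by simp
    then show ?thesis
      using cls_eqI e c by (simp add: lam_def smor_def cmp_cls inst_k_def)
  qed
  ultimately show "up_transpose P N f = cmp (shift_up P) P N f (lam P)"
    "linear (shift_up P) N (up_transpose P N f)"
    using linear_smor[OF S] by simp_all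
qed

text \<open>The mono \<lambda> is cancelled; by its linearity \<lambda> \<circ> (\<kappa> \<circ>
  \<lambda>) rebrackets to (\<lambda> \<circ> \<kappa>) \<circ> \<lambda>.\<close>

lemma kap_lam:
  assumes "pol P = Pos"
  shows "cmp (shift_up P) P (shift_up P) (kap P) (lam P) = idn (shift_up P)"
proof (rule lam_mono)
  show "cmp (shift_up P) P (shift_up P) (kap P) (lam P) \<in> H (shift_up P) (shift_up P)"
    "idn (shift_up P) \<in> H (shift_up P) (shift_up P)"
    using lam_in_H kap_in_H[OF assms] by (auto intro: cmp_in_H idn_in_H)
  show "cmp (shift_up P) (shift_up P) P (lam P) (cmp (shift_up P) P (shift_up P) (kap P) (lam P)) =
      cmp (shift_up P) (shift_up P) P (lam P) (idn (shift_up P))"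
    using lin_assoc[OF lam_linear lam_in_H kap_in_H] assms lam_in_H
    by (simp add: lam_kap cmp_idn_left cmp_idn_right)
qed

lemma theta_proj:
  assumes "pol N = Neg"
  shows "cmp (down N) N (down N) (theta N) (proj N) = idn (down N)"
proof (rule theta_epi)
  show "cmp (down N) N (down N) (theta N) (proj N) \<in> H (down N) (down N)"
    "idn (down N) \<in> H (down N) (down N)"
    using theta_in_H proj_in_H[OF assms] by (auto intro: cmp_in_H idn_in_H)
  show "cmp N (down N) (down N) (cmp (down N) N (down N) (theta N) (proj N)) (theta N) =
      cmp N (down N) (down N) (idn (down N)) (theta N)"
    using thunk_assoc[OF theta_thunkable proj_in_H theta_in_H] assms theta_in_H
    by (simp add: proj_theta cmp_idn_left cmp_idn_right)
qed

lemma proj_down_transpose: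
  assumes "pol M = Neg" "f \<in> H P M"
  shows "cmp P (down M) M (proj M) (down_transpose P M f) = f"
  using lin_assoc[OF proj_linear assms(2) theta_in_H] assms
  by (simp add: down_transpose_eq(1) proj_theta cmp_idn_left)

text \<open>This direction of the bijection rests on thunkability of \<open>f\<close>, which
  rebrackets \<theta> \<circ> (\<pi> \<circ> f) to (\<theta> \<circ> \<pi>) \<circ> f.\<close>

lemma down_transpose_proj:
  assumes "pol M = Neg" "f \<in> H P (down M)" "thunkable P (down M) f"
  shows "down_transpose P M (cmp P (down M) M (proj M) f) = f"
  using thunk_assoc[OF assms(3) proj_in_H theta_in_H] assms
  by (simp add: down_transpose_eq(1) cmp_in_H[OF assms(2)] proj_in_H theta_proj cmp_idn_left)

lemma up_transpose_kap:
  assumes "pol P = Pos" "f \<in> H P N"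
  shows "cmp P (shift_up P) N (up_transpose P N f) (kap P) = f"
  using thunk_assoc[OF kap_thunkable lam_in_H assms(2)] assms
  by (simp add: up_transpose_eq(1) lam_kap cmp_idn_right)

text \<open>Here linearity of \<open>f\<close> rebrackets (f \<circ> \<kappa>) \<circ> \<lambda> to
  f \<circ> (\<kappa> \<circ> \<lambda>).\<close>

lemma kap_up_transpose:
  assumes "pol P = Pos" "f \<in> H (shift_up P) N" "linear (shift_up P) N f"
  shows "up_transpose P N (cmp P (shift_up P) N f (kap P)) = f"
  using lin_assoc[OF assms(3) lam_in_H kap_in_H] assms
  by (simp add: up_transpose_eq(1) cmp_in_H[OF kap_in_H] kap_lam cmp_idn_right)

lemma down_transpose_in_Pt:
  "pol M = Neg \<Longrightarrow> f \<in> H P M \<Longrightarrow> down_transpose P M f \<in> Hom Pt P (down M)"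
  using down_transpose_eq(2) by (simp add: down_transpose_eq(1) cmp_in_H theta_in_H)

lemma up_transpose_in_Nl:
  "pol P = Pos \<Longrightarrow> f \<in> H P N \<Longrightarrow> up_transpose P N f \<in> Hom Nl (shift_up P) N"
  using up_transpose_eq(2) by (simp add: up_transpose_eq(1) cmp_in_H[OF lam_in_H])

lemma bij_down_transpose:
  assumes "pol M = Neg"
  shows "bij_betw (down_transpose P M) (H P M) (Hom Pt P (down M))"
proof (rule bij_betw_byWitness[where f' = "cmp P (down M) M (proj M)"])
  show "down_transpose P M ` H P M \<subseteq> Hom Pt P (down M)"
    using assms down_transpose_in_Pt by blast
  show "cmp P (down M) M (proj M) ` Hom Pt P (down M) \<subseteq> H P M"
    using proj_in_H[OF assms] by (auto intro: cmp_in_H)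
qed (simp_all add: assms proj_down_transpose down_transpose_proj)

lemma bij_up_transpose:
  assumes "pol P = Pos"
  shows "bij_betw (up_transpose P N) (H P N) (Hom Nl (shift_up P) N)"
proof (rule bij_betw_byWitness[where f' = "\<lambda>f. cmp P (shift_up P) N f (kap P)"])
  show "up_transpose P N ` H P N \<subseteq> Hom Nl (shift_up P) N"
    using assms up_transpose_in_Nl by blast
  show "(\<lambda>f. cmp P (shift_up P) N f (kap P)) ` Hom Nl (shift_up P) N \<subseteq> H P N"
    using kap_in_H[OF assms] by (auto intro: cmp_in_H)
qed (simp_all add: assms up_transpose_kap kap_up_transpose)

section \<open>Functoriality of the shifts\<close>

text \<open>After precomposition with the epi \<theta> both sides become \<theta> \<circ> f: on the
  left the match meets the pair () \<otimes> x, on the right \<pi> cancels.\<close>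

lemma down_map_eq:
  assumes "pol N = Neg" "pol M = Neg" "f \<in> H N M"
  shows "down_map N M f = cmp (down N) M (down M) (theta M) (cmp (down N) N M f (proj N))"
proof -
  obtain c where c: "ty_cmd [N] c M" "f = cls N M c"
    using assms(3) by (elim H_cases)
  let ?V = "VTensor VUnit (Var 0)" and ?S = "\<lambda>c. MtTensor (CutP (Val (VTensor (Var 1) (MuN c))) (Covar 0))"
  have V: "ty_val [N] ?V (down N)"
    by (intro ty_unit_tensor ty_Var)
  have pair: "ty_val [N, TOne] (VTensor (Var 1) (MuN c)) (down M)"
    using ty_VTensor[OF ty_Var ty_MuN[OF c(1) assms(2)], of TOne] by (simp add: down_def)
  have S: "ty_stk [] (?S c) (down N) (down M)"
    using ty_val_cmd[OF pair] unfolding down_def by (intro ty_MtTensor) simp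
  have "eq_stk [] (?S c) (?S d) (down N) (down M)" if "eq_cmd [N] c d M" for d
  proof -
    have "eq_val [N, TOne] (VTensor (Var 1) (MuN c)) (VTensor (Var 1) (MuN d)) (down M)"
      using eq_VTensor[OF eq_refl_val[OF ty_Var] eq_MuN[OF that assms(2)], of TOne]
      by (simp add: down_def)
    from eq_val_cmd[OF this] show ?thesis
      unfolding down_def by (intro eq_MtTensor) simp
  qed
  from UN_smor[OF c(1), where S = ?S, OF this] have map: "down_map N M f = smor (down N) (down M) (?S c)"
    by (simp add: down_map_def c(2) smor_def)
  let ?r = "CutP (Val (VTensor VUnit (MuN c))) (Covar 0)"
  have "red (CutP (Val ?V) (?S c)) ?r"
  proof -
    have "sub_cmd (liftk_val (case_nat (Var 0) (case_nat VUnit Var))) Covar c = c"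
      by (rule ty_sub_trivial[OF c(1)]) auto
    then show ?thesis
      using red.intros(6)[of VUnit "Var 0" "CutP (Val (VTensor (Var 1) (MuN c))) (Covar 0)"]
      by (simp add: inst_vv_def)
  qed
  moreover have "ty_cmd [N] (CutP (Val ?V) (?S c)) (down M)"
    using ty_cut_closed(1)[OF ty_Val[OF V] S] by simp
  moreover have r: "ty_cmd [N] ?r (down M)"
    using ty_val_cmd[OF ty_unit_tensor[OF ty_MuN[OF c(1) assms(2)]]] by simp
  ultimately have *: "eq_cmd [N] (CutP (Val ?V) (?S c)) ?r (down M)"
    by (intro eq_red)
  have "cmp N (down N) (down M) (down_map N M f) (theta N) = cls N (down M) (inst_v (CutP (Val (Var 0)) (?S c)) ?V)"
    unfolding theta_def map smor_def using V ty_stk_cmd[OF S] by (subst cmp_vmor) auto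
  also have "inst_v (CutP (Val (Var 0)) (?S c)) ?V = CutP (Val ?V) (?S c)"
    using ty_stk_closed(2)[OF S, of Covar] by (simp add: inst_v_def del: sub_stk.simps)
  also have "cls N (down M) (CutP (Val ?V) (?S c)) = cls N (down M) ?r"
    by (rule cls_eqI[OF *])
  also have "\<dots> = cmp N M (down M) (theta M) f"
  proof -
    let ?e = "CutP (Val ?V) (Covar 0)"
    have e: "ty_cmd [M] ?e (down M)"
      using ty_val_cmd[OF ty_unit_tensor[OF ty_Var]] by simp
    have "eq_cmd [N] (comp_cmd (pol M) c ?e) ?r (down M)"
      using beta_v(2)[OF e ty_MuN[OF c(1) assms(2)] assms(2)] assms(2) by (simp add: inst_v_def)
    then show ?thesis
      using cls_eqI e c by (simp add: theta_def vmor_def cmp_cls)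
  qed
  finally have "cmp N (down N) (down M) (down_map N M f) (theta N) = cmp N M (down M) (theta M) f" .
  moreover have "cmp N (down N) (down M) (cmp (down N) M (down M) (theta M) (cmp (down N) N M f (proj N))) (theta N)
      = cmp N M (down M) (theta M) f"
    using assms theta_in_H proj_in_H[of N]
    by (simp add: thunk_assoc[OF theta_thunkable] cmp_in_H proj_theta cmp_idn_right)
  ultimately have "cmp N (down N) (down M) (down_map N M f) (theta N) =
      cmp N (down N) (down M) (cmp (down N) M (down M) (theta M) (cmp (down N) N M f (proj N))) (theta N)"
    by (rule trans[OF _ sym])
  moreover have "down_map N M f \<in> H (down N) (down M)"
    unfolding map by (rule smor_in_H[OF S])
  ultimately show ?thesis
    by (intro theta_epi[OF _ cmp_in_H[OF cmp_in_H[OF proj_in_H[OF assms(1)] assms(3)] theta_in_H]])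
qed

text \<open>The defining command is given by a value, whence thunkability. The third equation is
  naturality of \<lambda>, by one beta step for functions; it implies the first since \<lambda> is
  mono.\<close>

lemma up_map_eq:
  assumes "pol P = Pos" "pol Q = Pos" "f \<in> H P Q"
  shows "up_map P Q f = cmp (shift_up P) P (shift_up Q) (cmp P Q (shift_up Q) (kap Q) f) (lam P)"
    "thunkable (shift_up P) (shift_up Q) (up_map P Q f)"
    "cmp (shift_up P) (shift_up Q) Q (lam Q) (up_map P Q f) = cmp (shift_up P) P Q f (lam P)"
proof -
  obtain c where c: "ty_cmd [P] c Q" "f = cls P Q c"
    using assms(3) by (elim H_cases)
  let ?S = "Push VUnit (Covar 0)" and ?V = "\<lambda>c. MuFun (CutN (Var 1) (Stk (Push (Var 0) (MtP c))))"
  have S: "ty_stk [] ?S (shift_up Q) Q"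
    by (intro ty_unit_push ty_Covar)
  have push: "ty_stk [TOne] (Push (Var 0) (MtP c)) (shift_up P) Q"
    using ty_Push[OF ty_Var ty_MtP[OF c(1) assms(1)], of TOne] by (simp add: shift_up_def)
  have V: "ty_val [shift_up P] (?V c) (shift_up Q)"
    using ty_CutN[OF ty_Var ty_Stk[OF push]]
    by (auto simp: shift_up_def[of Q] intro: ty_MuFun)
  have "eq_val [shift_up P] (?V c) (?V d) (shift_up Q)" if "eq_cmd [P] c d Q" for d
  proof -
    have "eq_stk [TOne] (Push (Var 0) (MtP c)) (Push (Var 0) (MtP d)) (shift_up P) Q"
      using eq_Push[OF eq_refl_val[OF ty_Var] eq_MtP[OF that assms(1)], of TOne]
      by (simp add: shift_up_def)
    then show ?thesis
      using eq_CutN[OF eq_refl_val[OF ty_Var] eq_Stk]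
      by (fastforce simp: shift_up_def[of Q] intro: eq_MuFun)
  qed
  from UN_vmor[OF c(1), where V = ?V, OF this] have map: "up_map P Q f = vmor (shift_up P) (shift_up Q) (?V c)"
    by (simp add: up_map_def c(2) vmor_def)
  then show "thunkable (shift_up P) (shift_up Q) (up_map P Q f)"
    using thunkable_vmor[OF V] by simp
  let ?r = "CutN (Var 0) (Stk (Push VUnit (MtP c)))"
  have "red (CutN (?V c) (Stk ?S)) ?r"
  proof -
    have "sub_cmd (liftv_val (case_nat VUnit Var)) (liftv_stk (case_nat (Covar 0) Covar)) c = c"
      by (rule ty_sub_trivial[OF c(1)]) auto
    then show ?thesis
      using red.intros(9)[of "CutN (Var 1) (Stk (Push (Var 0) (MtP c)))" VUnit "Covar 0"]
      by (simp add: inst_vk_def)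
  qed
  moreover have "ty_cmd [shift_up P] (CutN (?V c) (Stk ?S)) Q"
    using ty_cut_closed(2)[OF V ty_Stk[OF S]] by simp
  moreover have r: "ty_cmd [shift_up P] ?r Q"
    using ty_stk_cmd[OF ty_unit_push[OF ty_MtP[OF c(1) assms(1)]]] by simp
  ultimately have *: "eq_cmd [shift_up P] (CutN (?V c) (Stk ?S)) ?r Q"
    by (intro eq_red)
  have "cmp (shift_up P) (shift_up Q) Q (lam Q) (up_map P Q f) =
      cls (shift_up P) Q (inst_v (CutN (Var 0) (Stk ?S)) (?V c))"
    unfolding lam_def map smor_def using V ty_stk_cmd[OF S] by (subst cmp_vmor) auto
  also have "\<dots> = cls (shift_up P) Q ?r"
    using cls_eqI[OF *] by (simp add: inst_v_def)
  also have "\<dots> = cmp (shift_up P) P Q f (lam P)"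
  proof -
    let ?e = "CutN (Var 0) (Stk ?S)"
    have e: "ty_cmd [shift_up P] ?e P"
      using ty_stk_cmd[OF ty_unit_push[OF ty_Covar]] by simp
    have "eq_cmd [shift_up P] (comp_cmd (pol P) ?e c) ?r Q"
      using beta_k(1)[OF e ty_MtP[OF c(1) assms(1)] assms(1)] assms(1) by (simp add: inst_k_def)
    then show ?thesis
      using cls_eqI e c by (simp add: lam_def smor_def cmp_cls)
  qed
  finally show lam_map: "cmp (shift_up P) (shift_up Q) Q (lam Q) (up_map P Q f) = cmp (shift_up P) P Q f (lam P)" .
  have "cmp (shift_up P) (shift_up Q) Q (lam Q)
      (cmp (shift_up P) P (shift_up Q) (cmp P Q (shift_up Q) (kap Q) f) (lam P)) =
      cmp (shift_up P) P Q f (lam P)"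
    using assms lam_in_H kap_in_H[of Q]
    by (simp add: lin_assoc[OF lam_linear, symmetric] cmp_in_H lam_kap cmp_idn_left)
  with lam_map have "cmp (shift_up P) (shift_up Q) Q (lam Q) (up_map P Q f) =
      cmp (shift_up P) (shift_up Q) Q (lam Q)
        (cmp (shift_up P) P (shift_up Q) (cmp P Q (shift_up Q) (kap Q) f) (lam P))"
    by (rule trans[OF _ sym])
  moreover have "up_map P Q f \<in> H (shift_up P) (shift_up Q)"
    unfolding map by (rule vmor_in_H[OF V])
  ultimately show "up_map P Q f = cmp (shift_up P) P (shift_up Q) (cmp P Q (shift_up Q) (kap Q) f) (lam P)"
    by (intro lam_mono[OF _ cmp_in_H[OF lam_in_H cmp_in_H[OF assms(3) kap_in_H[OF assms(2)]]]])
qed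

text \<open>\<open>down_map X Y f\<close> is the transpose of f \<circ> \<pi>, hence thunkable, and
  this rebrackets the composites with it.\<close>

lemma functor_down: "cat_functor Nl Pt down down_map"
proof (rule cat_functor.intro[OF category_Nl category_Pt], unfold_locales)
  show "down_map X Y f \<in> Hom Pt (down X) (down Y)"
    if "X \<in> Ob Nl" "Y \<in> Ob Nl" "f \<in> Hom Nl X Y" for X Y f
  proof -
    have "cmp (down X) X Y f (proj X) \<in> H (down X) Y"
      using that proj_in_H[of X] by (auto intro: cmp_in_H)
    then show ?thesis
      using that down_transpose_in_Pt[of Y _ "down X"]
      by (simp add: down_map_eq down_transpose_eq(1))
  qed
  show "down_map X X (Idn Nl X) = Idn Pt (down X)" if "X \<in> Ob Nl" for X
    using that proj_in_H[of X] by (simp add: down_map_eq idn_in_H cmp_idn_left theta_proj)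
  fix X Y Z f g
  assume X: "X \<in> Ob Nl" "Y \<in> Ob Nl" "Z \<in> Ob Nl" "f \<in> Hom Nl X Y" "g \<in> Hom Nl Y Z"
  note [simp] = theta_in_H proj_in_H cmp_in_H
  let ?f = "cmp (down X) X Y f (proj X)" and ?g = "cmp (down Y) Y Z g (proj Y)"
  have f: "?f \<in> H (down X) Y" "cmp (down X) Y (down Y) (theta Y) ?f \<in> H (down X) (down Y)"
    using X by auto
  have th: "thunkable (down X) (down Y) (cmp (down X) Y (down Y) (theta Y) ?f)"
    using X f(1) down_transpose_eq[of Y ?f "down X"] by simp
  have "cmp (down X) (down Y) Z ?g (cmp (down X) Y (down Y) (theta Y) ?f) = cmp (down X) Y Z g ?f"
    using X f thunk_assoc[OF th proj_in_H[of Y], of g Z] lin_assoc[OF proj_linear[of Y] f(1) theta_in_H]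
    by (simp add: proj_theta cmp_idn_left)
  \<comment> \<open>Linearity of \<open>g\<close> enters here, to move the bracket from f \<circ>
    \<pi> to g \<circ> f.\<close>
  also have "\<dots> = cmp (down X) X Z (cmp X Y Z g f) (proj X)"
    using X lin_assoc[of Y Z g "proj X" "down X" X f] by simp
  finally show "down_map X Z (Comp Nl X Y Z g f) =
      Comp Pt (down X) (down Y) (down Z) (down_map Y Z g) (down_map X Y f)"
    using X f thunk_assoc[OF th, of ?g Z "theta Z"] by (simp add: down_map_eq)
qed simp

text \<open>Preservation of composition is tested against the mono \<lambda>, by its naturality and
  the thunkability of \<open>up_map X Y f\<close>.\<close>

lemma functor_up: "cat_functor Pt Nl shift_up up_map"
proof (rule cat_functor.intro[OF category_Pt category_Nl], unfold_locales)
  show in_Nl: "up_map X Y f \<in> Hom Nl (shift_up X) (shift_up Y)"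
    if "X \<in> Ob Pt" "Y \<in> Ob Pt" "f \<in> Hom Pt X Y" for X Y f
  proof -
    have "cmp X Y (shift_up Y) (kap Y) f \<in> H X (shift_up Y)"
      using that kap_in_H[of Y] by (auto intro: cmp_in_H)
    then show ?thesis
      using that up_transpose_in_Nl[of X _ "shift_up Y"]
      by (simp add: up_map_eq(1) up_transpose_eq(1))
  qed
  show "up_map X X (Idn Pt X) = Idn Nl (shift_up X)" if "X \<in> Ob Pt" for X
    using that kap_in_H[of X] by (simp add: up_map_eq(1) idn_in_H cmp_idn_right kap_lam)
  fix X Y Z f g
  assume X: "X \<in> Ob Pt" "Y \<in> Ob Pt" "Z \<in> Ob Pt" "f \<in> Hom Pt X Y" "g \<in> Hom Pt Y Z"
  note [simp] = lam_in_H kap_in_H cmp_in_H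
  have m: "up_map X Y f \<in> H (shift_up X) (shift_up Y)" "up_map Y Z g \<in> H (shift_up Y) (shift_up Z)"
    "up_map X Z (cmp X Y Z g f) \<in> H (shift_up X) (shift_up Z)"
    using X by (auto simp: up_map_eq(1))
  have "cmp (shift_up X) (shift_up Z) Z (lam Z)
      (cmp (shift_up X) (shift_up Y) (shift_up Z) (up_map Y Z g) (up_map X Y f)) =
    cmp (shift_up X) (shift_up Y) Z (cmp (shift_up Y) Y Z g (lam Y)) (up_map X Y f)"
    using X lin_assoc[OF lam_linear m(1,2)] by (simp add: up_map_eq(3))
  also have "\<dots> = cmp (shift_up X) Y Z g (cmp (shift_up X) X Y f (lam X))"
    using X thunk_assoc[OF up_map_eq(2)[of X Y f] lam_in_H[of Y], of g Z]
    by (simp add: up_map_eq(3))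
  \<comment> \<open>\<open>g\<close> is linear because its source is positive.\<close>
  also have "\<dots> = cmp (shift_up X) X Z (cmp X Y Z g f) (lam X)"
    using X lin_assoc[OF linear_Pos[of Y g Z] lam_in_H[of X], of f] by simp
  also have "\<dots> = cmp (shift_up X) (shift_up Z) Z (lam Z) (up_map X Z (cmp X Y Z g f))"
    using X by (simp add: up_map_eq(3))
  finally have "up_map X Z (cmp X Y Z g f) =
      cmp (shift_up X) (shift_up Y) (shift_up Z) (up_map Y Z g) (up_map X Y f)"
    by (intro lam_mono[OF m(3) cmp_in_H[OF m(1,2)] sym])
  then show "up_map X Z (Comp Pt X Y Z g f) =
      Comp Nl (shift_up X) (shift_up Y) (shift_up Z) (up_map Y Z g) (up_map X Y f)"
    by simp
qed simp

section \<open>The exponential modalities\<close>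

text \<open>Coextension for untransposed morphisms !N \<rightarrow> M of D; the comonad first
  applies \<pi> to undo the transposition.\<close>

definition bang_ext :: "ty \<Rightarrow> ty \<Rightarrow> cmd set \<Rightarrow> cmd set" where
  "bang_ext N M f = (\<Union>c\<in>f. vmor (TBang N) (TBang M) (MuBang c))"

text \<open>Extension for untransposed morphisms P \<rightarrow> \<diamond>Q of D; the monad first
  precomposes with \<kappa>.\<close>

definition dia_ext :: "ty \<Rightarrow> ty \<Rightarrow> cmd set \<Rightarrow> cmd set" where
  "dia_ext P Q f = (\<Union>c\<in>f. smor (TDia P) (TDia Q) (MtDia c))"

definition derel :: "ty \<Rightarrow> cmd set" where
  "derel N = smor (TBang N) N (SBang (Covar 0))"

definition ret :: "ty \<Rightarrow> cmd set" where
  "ret P = vmor P (TDia P) (VDia (Var 0))"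

lemma ty_bang: "ty_cmd [TBang N] c M \<Longrightarrow> ty_val [TBang N] (MuBang c) (TBang M)"
  by (auto intro: ty_MuBang simp: is_bang_def)

lemma ty_dia: "ty_cmd [P] c (TDia Q) \<Longrightarrow> ty_stk [] (MtDia c) (TDia P) (TDia Q)"
  by (auto intro: ty_MtDia simp: is_dia_def)

lemma ty_derel: "ty_stk [] (SBang (Covar 0)) (TBang N) N"
  by (intro ty_SBang ty_Covar)

lemma ty_ret: "ty_val [P] (VDia (Var 0)) (TDia P)"
  by (intro ty_VDia ty_Var)

lemma bang_ext_cls:
  assumes "ty_cmd [TBang N] c M"
  shows "bang_ext N M (cls (TBang N) M c) = vmor (TBang N) (TBang M) (MuBang c)"
proof -
  have "eq_val [TBang N] (MuBang c) (MuBang d) (TBang M)" if "eq_cmd [TBang N] c d M" for d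
    using that by (auto intro: eq_MuBang simp: is_bang_def)
  then show ?thesis
    unfolding bang_ext_def by (rule UN_vmor[OF assms])
qed

lemma dia_ext_cls:
  assumes "ty_cmd [P] c (TDia Q)"
  shows "dia_ext P Q (cls P (TDia Q) c) = smor (TDia P) (TDia Q) (MtDia c)"
proof -
  have "eq_stk [] (MtDia c) (MtDia d) (TDia P) (TDia Q)" if "eq_cmd [P] c d (TDia Q)" for d
    using that by (auto intro: eq_MtDia simp: is_dia_def)
  then show ?thesis
    unfolding dia_ext_def by (rule UN_smor[OF assms])
qed

lemma
  assumes "f \<in> H (TBang N) M"
  shows bang_ext_in_H: "bang_ext N M f \<in> H (TBang N) (TBang M)"
    and bang_ext_thunkable: "thunkable (TBang N) (TBang M) (bang_ext N M f)"
  using assms by (auto elim!: H_cases simp: bang_ext_cls intro!: vmor_in_H thunkable_vmor ty_bang)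

lemma
  assumes "f \<in> H P (TDia Q)"
  shows dia_ext_in_H: "dia_ext P Q f \<in> H (TDia P) (TDia Q)"
    and dia_ext_linear: "linear (TDia P) (TDia Q) (dia_ext P Q f)"
  using assms by (auto elim!: H_cases simp: dia_ext_cls intro!: smor_in_H linear_smor ty_dia)

lemma derel_in_H: "derel N \<in> H (TBang N) N"
  unfolding derel_def by (intro smor_in_H ty_derel)

lemma ret_in_H: "ret P \<in> H P (TDia P)"
  unfolding ret_def by (intro vmor_in_H ty_ret)

section \<open>Laws of promotion and dereliction\<close>

lemma derel_bang_ext:
  assumes "f \<in> H (TBang N) M"
  shows "cmp (TBang N) (TBang M) M (derel M) (bang_ext N M f) = f"
proof -
  obtain c where c: "ty_cmd [TBang N] c M" "f = cls (TBang N) M c"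
    using assms by (elim H_cases)
  have "ty_cmd [TBang N] (CutP (Val (MuBang c)) (SBang (Covar 0))) M"
    using ty_cut_closed(1)[OF ty_Val[OF ty_bang[OF c(1)]] ty_derel] by simp
  moreover have "red (CutP (Val (MuBang c)) (SBang (Covar 0))) c"
    using red.intros(12)[of c "Covar 0"] c(1) by simp
  ultimately have "eq_cmd [TBang N] (CutP (Val (MuBang c)) (SBang (Covar 0))) c M"
    using c(1) by (intro eq_red)
  from cls_eqI[OF this] show ?thesis
    using c ty_stk_cmd[OF ty_derel, of M]
    by (simp add: bang_ext_cls derel_def smor_def cmp_vmor ty_bang inst_v_def)
qed

lemma bang_ext_derel: "bang_ext N N (derel N) = idn (TBang N)"
proof -
  let ?W = "MuBang (CutP (Val (Var 0)) (SBang (Covar 0)))"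
  have d: "ty_cmd [TBang N] (CutP (Val (Var 0)) (SBang (Covar 0))) N"
    using ty_stk_cmd[OF ty_derel, of N] by simp
  have "eq_val [TBang N] (Var 0) ?W (TBang N)"
    using expand_val.intros(5)[of _ N "Var 0"] ty_bang[OF d]
    by (intro eq_expand_val ty_Var) simp_all
  from cls_eqI[OF eq_val_cmd[OF this]] show ?thesis
    using bang_ext_cls[OF d] by (simp add: derel_def smor_def vmor_def idn_eq(1))
qed

text \<open>Both sides are the value \<mu>!\<alpha>.c with \<mu>!\<alpha>.d put for its variable:
  the substituted value has no free co-variable, so it passes under the binder unshifted.\<close>

lemma bang_ext_cmp:
  assumes "f \<in> H (TBang M) K" "g \<in> H (TBang N) M"
  shows "bang_ext N K (cmp (TBang N) (TBang M) K f (bang_ext N M g)) =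
    cmp (TBang N) (TBang M) (TBang K) (bang_ext M K f) (bang_ext N M g)"
proof -
  obtain c d where c: "ty_cmd [TBang M] c K" "f = cls (TBang M) K c"
    and d: "ty_cmd [TBang N] d M" "g = cls (TBang N) M d"
    using assms by (elim H_cases)
  let ?V = "MuBang d"
  have V: "ty_val [TBang N] ?V (TBang M)" using ty_bang[OF d(1)] .
  have c': "ty_cmd [TBang M] (CutP (Val (MuBang c)) (Covar 0)) (TBang K)"
    using ty_val_cmd[OF ty_bang[OF c(1)]] by simp
  have "sub_cmd (liftk_val (case_nat ?V Var)) Covar c = sub_cmd (case_nat ?V Var) Covar c"
    using ty_val_ren_covar(1)[OF V, of Suc] by (intro ty_sub_cong(3)[OF c(1)]) auto
  then have "inst_v (CutP (Val (MuBang c)) (Covar 0)) ?V = CutP (Val (MuBang (inst_v c ?V))) (Covar 0)"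
    by (simp add: inst_v_def)
  then show ?thesis
    using c d V c' cmp_vmor[OF V c'] cmp_vmor[OF V c(1)] bang_ext_cls[OF ty_inst_v[OF c(1) V]]
    by (simp add: bang_ext_cls) (simp add: vmor_def)
qed

section \<open>Laws of the modality \<diamond>\<close>

lemma dia_ext_ret:
  assumes "f \<in> H P (TDia Q)"
  shows "cmp P (TDia P) (TDia Q) (dia_ext P Q f) (ret P) = f"
proof -
  obtain c where c: "ty_cmd [P] c (TDia Q)" "f = cls P (TDia Q) c"
    using assms by (elim H_cases)
  have "ty_cmd [P] (CutN (VDia (Var 0)) (Stk (MtDia c))) (TDia Q)"
    using ty_cut_closed(2)[OF ty_ret ty_Stk[OF ty_dia[OF c(1)]]] by simp
  moreover have "red (CutN (VDia (Var 0)) (Stk (MtDia c))) c"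
    using red.intros(13)[of "Var 0" c] c(1) by simp
  ultimately have "eq_cmd [P] (CutN (VDia (Var 0)) (Stk (MtDia c))) c (TDia Q)"
    using c(1) by (intro eq_red)
  moreover have "inst_v (CutN (Var 0) (Stk (MtDia c))) (VDia (Var 0)) = CutN (VDia (Var 0)) (Stk (MtDia c))"
    using ty_stk_closed(2)[OF ty_dia[OF c(1)], of Covar]
    by (simp add: inst_v_def del: sub_stk.simps)
  ultimately show ?thesis
    using c ty_stk_cmd[OF ty_dia[OF c(1)]] cls_eqI
    by (simp add: dia_ext_cls ret_def smor_def cmp_vmor ty_ret)
qed

lemma dia_ext_unit: "dia_ext P P (ret P) = idn (TDia P)"
proof -
  let ?S = "MtDia (CutN (VDia (Var 0)) (Stk (Covar 0)))"
  have d: "ty_cmd [P] (CutN (VDia (Var 0)) (Stk (Covar 0))) (TDia P)"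
    using ty_val_cmd[OF ty_ret, of P] by simp
  have "eq_stk [] (Covar 0) ?S (TDia P) (TDia P)"
    using expand_stk.intros(6)[of _ P "Covar 0"] ty_dia[OF d]
    by (intro eq_expand_stk ty_Covar) simp_all
  from cls_eqI[OF eq_stk_cmd[OF this]] show ?thesis
    using dia_ext_cls[OF d] by (simp add: ret_def smor_def vmor_def idn_eq(2))
qed

text \<open>Both sides bind x in \<open>d\<close> with the stack of \<open>c\<close> put for its
  co-variable; that stack has no free variable and passes under the binder of x unshifted.\<close>

lemma dia_ext_cmp:
  assumes "f \<in> H Q (TDia R)" "g \<in> H P (TDia Q)"
  shows "dia_ext P R (cmp P (TDia Q) (TDia R) (dia_ext Q R f) g) =
    cmp (TDia P) (TDia Q) (TDia R) (dia_ext Q R f) (dia_ext P Q g)"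
proof -
  obtain c d where c: "ty_cmd [Q] c (TDia R)" "f = cls Q (TDia R) c"
    and d: "ty_cmd [P] d (TDia Q)" "g = cls P (TDia Q) d"
    using assms by (elim H_cases)
  let ?S = "MtDia c"
  have S: "ty_stk [] ?S (TDia Q) (TDia R)" using ty_dia[OF c(1)] .
  have d': "ty_cmd [TDia P] (CutN (Var 0) (Stk (MtDia d))) (TDia Q)"
    using ty_stk_cmd[OF ty_dia[OF d(1)]] by simp
  have "sub_cmd Var (liftv_stk (case_nat ?S Covar)) d = sub_cmd Var (case_nat ?S Covar) d"
    using ty_stk_closed(1)[OF S, of Suc] by (intro ty_sub_cong(3)[OF d(1)]) auto
  then have "inst_k (CutN (Var 0) (Stk (MtDia d))) ?S = CutN (Var 0) (Stk (MtDia (inst_k d ?S)))"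
    by (simp add: inst_k_def)
  then show ?thesis
    using c d S d' cmp_smor[OF d' S] cmp_smor[OF d(1) S] dia_ext_cls[OF ty_inst_k_closed[OF d(1) S]]
    by (simp add: dia_ext_cls) (simp add: smor_def)
qed

section \<open>The relative comonad and the relative monad\<close>

lemma derel_eq: "cls (TBang N) N (CutP (Val (Var 0)) (SBang (Covar 0))) = derel N"
  by (simp add: derel_def smor_def)

lemma ret_eq: "cls P (TDia P) (CutN (VDia (Var 0)) (Stk (Covar 0))) = ret P"
  by (simp add: ret_def vmor_def)

text \<open>Coextensions are values, hence thunkable, which rebrackets the counit law; in the
  composition law it is linearity of \<pi> that moves it next to \<open>f\<close>.\<close>

lemma comonad_bang:
  "relative_comonad Nl Pt down down_map TBang (\<lambda>N. down_transpose (TBang N) N (derel N))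
     (\<lambda>N M f. bang_ext N M (cmp (TBang N) (down M) M (proj M) f))"
proof (rule relative_comonad.intro[OF functor_down], unfold_locales)
  fix X Y Z f g
  note [simp] = derel_in_H proj_in_H bang_ext_in_H bang_ext_thunkable theta_in_H
  have pf: "cmp (TBang X) (down Y) Y (proj Y) f \<in> H (TBang X) Y"
    if "pol Y = Neg" "f \<in> H (TBang X) (down Y)" for X Y f
    using that by (simp add: cmp_in_H)
  show "down_transpose (TBang X) X (derel X) \<in> Hom Pt (TBang X) (down X)" if "X \<in> Ob Nl"
    using that by (intro down_transpose_in_Pt) auto
  show "bang_ext X Y (cmp (TBang X) (down Y) Y (proj Y) f) \<in> Hom Pt (TBang X) (TBang Y)"
    if "X \<in> Ob Nl" "Y \<in> Ob Nl" "f \<in> Hom Pt (TBang X) (down Y)"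
    using that pf by simp
  show "f = Comp Pt (TBang X) (TBang Y) (down Y) (down_transpose (TBang Y) Y (derel Y))
      (bang_ext X Y (cmp (TBang X) (down Y) Y (proj Y) f))"
    if "X \<in> Ob Nl" "Y \<in> Ob Nl" "f \<in> Hom Pt (TBang X) (down Y)"
  proof -
    let ?f = "cmp (TBang X) (down Y) Y (proj Y) f"
    have "?f \<in> H (TBang X) Y" using that pf by simp
    then have "cmp (TBang X) (TBang Y) (down Y) (down_transpose (TBang Y) Y (derel Y)) (bang_ext X Y ?f) =
        down_transpose (TBang X) Y ?f"
      using that thunk_assoc[OF bang_ext_thunkable derel_in_H theta_in_H, of ?f X Y]
      by (simp add: down_transpose_eq(1) derel_bang_ext)
    then show ?thesis using that by (simp add: down_transpose_proj)
  qed
  show "bang_ext X X (cmp (TBang X) (down X) X (proj X) (down_transpose (TBang X) X (derel X))) = Idn Pt (TBang X)"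
    if "X \<in> Ob Nl"
    using that by (simp add: proj_down_transpose bang_ext_derel)
  show "bang_ext X Z (cmp (TBang X) (down Z) Z (proj Z)
      (Comp Pt (TBang X) (TBang Y) (down Z) f (bang_ext X Y (cmp (TBang X) (down Y) Y (proj Y) g)))) =
    Comp Pt (TBang X) (TBang Y) (TBang Z) (bang_ext Y Z (cmp (TBang Y) (down Z) Z (proj Z) f))
      (bang_ext X Y (cmp (TBang X) (down Y) Y (proj Y) g))"
    if "X \<in> Ob Nl" "Y \<in> Ob Nl" "Z \<in> Ob Nl" "f \<in> Hom Pt (TBang Y) (down Z)"
      "g \<in> Hom Pt (TBang X) (down Y)"
    using that pf lin_assoc[OF proj_linear[of Z] bang_ext_in_H[OF pf[of Y g X]], of f]
      bang_ext_cmp[OF pf[of Z f Y] pf[of Y g X]]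
    by simp
qed simp

text \<open>Extensions are given by stacks, hence linear, which rebrackets the unit law; in the
  composition law thunkability of \<kappa> moves it next to \<open>g\<close>.\<close>

lemma monad_dia:
  "relative_monad Pt Nl shift_up up_map TDia (\<lambda>P. up_transpose P (TDia P) (ret P))
     (\<lambda>P Q f. dia_ext P Q (cmp P (shift_up P) (TDia Q) f (kap P)))"
proof (rule relative_monad.intro[OF functor_up], unfold_locales)
  fix X Y Z f g
  note [simp] = ret_in_H kap_in_H dia_ext_in_H dia_ext_linear lam_in_H
  have fk: "cmp X (shift_up X) (TDia Y) f (kap X) \<in> H X (TDia Y)"
    if "pol X = Pos" "f \<in> H (shift_up X) (TDia Y)" for X Y f
    using that by (intro cmp_in_H[OF kap_in_H]) auto
  show "up_transpose X (TDia X) (ret X) \<in> Hom Nl (shift_up X) (TDia X)" if "X \<in> Ob Pt"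
    using that by (intro up_transpose_in_Nl) auto
  show "dia_ext X Y (cmp X (shift_up X) (TDia Y) f (kap X)) \<in> Hom Nl (TDia X) (TDia Y)"
    if "X \<in> Ob Pt" "Y \<in> Ob Pt" "f \<in> Hom Nl (shift_up X) (TDia Y)"
    using that fk by simp
  show "f = Comp Nl (shift_up X) (TDia X) (TDia Y)
      (dia_ext X Y (cmp X (shift_up X) (TDia Y) f (kap X))) (up_transpose X (TDia X) (ret X))"
    if "X \<in> Ob Pt" "Y \<in> Ob Pt" "f \<in> Hom Nl (shift_up X) (TDia Y)"
  proof -
    let ?f = "cmp X (shift_up X) (TDia Y) f (kap X)"
    have "?f \<in> H X (TDia Y)" using that fk by simp
    then have "cmp (shift_up X) (TDia X) (TDia Y) (dia_ext X Y ?f) (up_transpose X (TDia X) (ret X)) =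
        up_transpose X (TDia Y) ?f"
      using that lin_assoc[OF dia_ext_linear lam_in_H ret_in_H, of ?f X Y]
      by (simp add: up_transpose_eq(1) dia_ext_ret)
    then show ?thesis using that by (simp add: kap_up_transpose)
  qed
  show "dia_ext X X (cmp X (shift_up X) (TDia X) (up_transpose X (TDia X) (ret X)) (kap X)) = Idn Nl (TDia X)"
    if "X \<in> Ob Pt"
    using that by (simp add: up_transpose_kap dia_ext_unit)
  show "dia_ext X Z (cmp X (shift_up X) (TDia Z)
      (Comp Nl (shift_up X) (TDia Y) (TDia Z) (dia_ext Y Z (cmp Y (shift_up Y) (TDia Z) f (kap Y))) g) (kap X)) =
    Comp Nl (TDia X) (TDia Y) (TDia Z) (dia_ext Y Z (cmp Y (shift_up Y) (TDia Z) f (kap Y)))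
      (dia_ext X Y (cmp X (shift_up X) (TDia Y) g (kap X)))"
    if "X \<in> Ob Pt" "Y \<in> Ob Pt" "Z \<in> Ob Pt" "f \<in> Hom Nl (shift_up Y) (TDia Z)"
      "g \<in> Hom Nl (shift_up X) (TDia Y)"
    using that fk thunk_assoc[OF kap_thunkable[of X] _ dia_ext_in_H[OF fk[of Y f Z]], of g]
      dia_ext_cmp[OF fk[of Y f Z] fk[of X g Y]]
    by simp
qed simp

text \<open>Since transposition is bijective, the equations on transposed classes determine the
  (co)extension on every morphism concerned, so the existential quantifiers hide no choice
  there.\<close>

theorem proposition16:
  shows
    "(\<forall>P M. pol P = Pos \<longrightarrow> pol M = Neg \<longrightarrow>
        bij_betw (down_transpose P M) (Hom Dcat P M) (Hom Pt P (down M))) \<and>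
     (\<exists>coext.
        relative_comonad Nl Pt down down_map TBang
          (\<lambda>N. down_transpose (TBang N) N
                 (cls (TBang N) N (CutP (Val (Var 0)) (SBang (Covar 0)))))
          coext \<and>
        (\<forall>N M c. pol N = Neg \<longrightarrow> pol M = Neg \<longrightarrow> ty_cmd [TBang N] c M \<longrightarrow>
           coext N M (down_transpose (TBang N) M (cls (TBang N) M c)) =
           cls (TBang N) (TBang M) (CutP (Val (MuBang c)) (Covar 0)))) \<and>
     (\<forall>P N. pol P = Pos \<longrightarrow> pol N = Neg \<longrightarrow>
        bij_betw (up_transpose P N) (Hom Dcat P N) (Hom Nl (shift_up P) N)) \<and>
     (\<exists>ext.
        relative_monad Pt Nl shift_up up_map TDia
          (\<lambda>P. up_transpose P (TDia P)
                 (cls P (TDia P) (CutN (VDia (Var 0)) (Stk (Covar 0)))))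
          ext \<and>
        (\<forall>P Q c. pol P = Pos \<longrightarrow> pol Q = Pos \<longrightarrow> ty_cmd [P] c (TDia Q) \<longrightarrow>
           ext P Q (up_transpose P (TDia Q) (cls P (TDia Q) c)) =
           cls (TDia P) (TDia Q) (CutN (Var 0) (Stk (MtDia c)))))"
\<comment> \<open>The witnesses are the operations of \<open>comonad_bang\<close> and
  \<open>monad_dia\<close>, in which \<open>proj\<close> and \<open>kap\<close> undo the
  transpositions.\<close>
proof (intro conjI exI allI impI, unfold derel_eq ret_eq)
  fix N M c
  assume "pol M = Neg" "ty_cmd [TBang N] c M"
  then show "bang_ext N M (cmp (TBang N) (down M) M (proj M) (down_transpose (TBang N) M (cls (TBang N) M c))) =
      cls (TBang N) (TBang M) (CutP (Val (MuBang c)) (Covar 0))"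
    by (simp add: proj_down_transpose cls_in_H bang_ext_cls vmor_def)
next
  fix P Q c
  assume "pol P = Pos" "ty_cmd [P] c (TDia Q)"
  then show "dia_ext P Q (cmp P (shift_up P) (TDia Q) (up_transpose P (TDia Q) (cls P (TDia Q) c)) (kap P)) =
      cls (TDia P) (TDia Q) (CutN (Var 0) (Stk (MtDia c)))"
    by (simp add: up_transpose_kap cls_in_H dia_ext_cls smor_def)
qed (simp_all only: bij_down_transpose bij_up_transpose comonad_bang monad_dia)

end
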